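(* Let $\Omega_1,\Omega_2\subseteq\mathbb{C}$ be open. Suppose $u:\Omega_1\to\Omega_2$ is continuous, satisfies condition $( * )$ on $\Omega_1$ (the partial derivatives $u_x$, $u_y$ exist at every point of $\Omega_1$ except for countably many), and there is a function $P:\Omega_1\to\mathbb{C}$ such that $P\in L^p_{loc}(\Omega_1)$ for some $p$ with $2\le p<\infty$, and $$\frac{\partial u}{\partial\bar z}=P(z)$$ almost everywhere in $\Omega_1$. Then, for any $R\Subset\Omega_1$, $u|_R\in W^{1,2}(R)$. If, further, $p>2$, then for $\alpha=1-\frac2p$, $u|_R\in\mathcal{C}^{0,\alpha}(R)$.
   Context: Write $z=x+iy$. For a complex valued function $u$ on an open subset of $\mathbb{C}=\mathbb{R}^2$, $u_x,u_y$ denote the (complex valued) pointwise classical partial derivatives, and at points where both exist, $\frac{\partial u}{\partial\bar z}=\frac12(u_x+iu_y)$; this is the pointwise, not the distributional, derivative. $R\Subset\Omega$ means that $R$ is a bounded open rectangle $(a_1,b_1)\times(a_2,b_2)$ whose closure $\overline R$ is contained in the open set $\Omega$. $W^{1,2}(R)$ is the Sobolev space of (complex valued) functions in $L^2(R)$ whose first order distributional derivatives on $R$ are represented by functions in $L^2(R)$; $\mathcal{C}^{0,\alpha}(R)$ is the space of H\"older continuous functions on $R$ with exponent $\alpha$. *)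

theory Defs
  imports "HOL-Analysis.Analysis"
begin

definition has_partials_at :: "(complex \<Rightarrow> complex) \<Rightarrow> complex \<Rightarrow> bool" where
  "has_partials_at u z \<longleftrightarrow>
     (\<lambda>x. u (Complex x (Im z))) differentiable (at (Re z)) \<and>
     (\<lambda>y. u (Complex (Re z) y)) differentiable (at (Im z))"

text \<open>The next three operators are meaningful only where the partial derivatives exist
  (elsewhere \<open>vector_derivative\<close> is an unspecified value).\<close>

definition partial_x :: "(complex \<Rightarrow> complex) \<Rightarrow> complex \<Rightarrow> complex" where
  "partial_x u z = vector_derivative (\<lambda>x. u (Complex x (Im z))) (at (Re z))"

definition partial_y :: "(complex \<Rightarrow> complex) \<Rightarrow> complex \<Rightarrow> complex" where
  "partial_y u z = vector_derivative (\<lambda>y. u (Complex (Re z) y)) (at (Im z))"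

definition dbar :: "(complex \<Rightarrow> complex) \<Rightarrow> complex \<Rightarrow> complex" where
  "dbar u z = (partial_x u z + \<i> * partial_y u z) / 2"

definition condition_star :: "complex set \<Rightarrow> (complex \<Rightarrow> complex) \<Rightarrow> bool" where
  "condition_star \<Omega> u \<longleftrightarrow> countable {z \<in> \<Omega>. \<not> has_partials_at u z}"

definition compact_rectangle_in :: "complex set \<Rightarrow> complex set \<Rightarrow> bool"  (infix "\<Subset>" 50) where
  "R \<Subset> \<Omega> \<longleftrightarrow>
     (\<exists>a1 b1 a2 b2. a1 < b1 \<and> a2 < b2 \<and> R = box (Complex a1 a2) (Complex b1 b2)) \<and>
     closure R \<subseteq> \<Omega>"

definition Lp_on :: "real \<Rightarrow> complex set \<Rightarrow> (complex \<Rightarrow> complex) \<Rightarrow> bool" where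
  "Lp_on p S f \<longleftrightarrow>
     f \<in> borel_measurable (lebesgue_on S) \<and>
     integrable (lebesgue_on S) (\<lambda>z. norm (f z) powr p)"

definition Lp_loc :: "real \<Rightarrow> complex set \<Rightarrow> (complex \<Rightarrow> complex) \<Rightarrow> bool" where
  "Lp_loc p \<Omega> f \<longleftrightarrow> (\<forall>K. compact K \<and> K \<subseteq> \<Omega> \<longrightarrow> Lp_on p K f)"

text \<open>\<open>C_k k f\<close>: all partial derivatives of \<open>f\<close> of order at most \<open>k\<close> exist everywhere, and those
  of order \<open>k\<close> are continuous. For \<open>k > 0\<close> continuity of the lower orders is then automatic.\<close>

primrec C_k :: "nat \<Rightarrow> (complex \<Rightarrow> complex) \<Rightarrow> bool" where
  "C_k 0 f \<longleftrightarrow> continuous_on UNIV f"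
| "C_k (Suc k) f \<longleftrightarrow>
     (\<forall>z. has_partials_at f z) \<and> C_k k (partial_x f) \<and> C_k k (partial_y f)"

text \<open>Test functions on an open set are represented by their extension by zero to the plane.\<close>

definition test_function :: "complex set \<Rightarrow> (complex \<Rightarrow> complex) \<Rightarrow> bool" where
  "test_function \<Omega> \<phi> \<longleftrightarrow>
     (\<forall>k. C_k k \<phi>) \<and>
     compact (closure {z. \<phi> z \<noteq> 0}) \<and> closure {z. \<phi> z \<noteq> 0} \<subseteq> \<Omega>"

text \<open>For locally integrable \<open>f\<close> and \<open>g\<close>: the distribution given by \<open>g\<close> is the \<open>x\<close>-derivative
  (respectively \<open>y\<close>-derivative) of the one given by \<open>f\<close>.\<close>

definition weak_partial_x ::
  "complex set \<Rightarrow> (complex \<Rightarrow> complex) \<Rightarrow> (complex \<Rightarrow> complex) \<Rightarrow> bool" where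
  "weak_partial_x \<Omega> f g \<longleftrightarrow>
     (\<forall>\<phi>. test_function \<Omega> \<phi> \<longrightarrow>
        (LINT z|lebesgue_on \<Omega>. f z * partial_x \<phi> z) = - (LINT z|lebesgue_on \<Omega>. g z * \<phi> z))"

definition weak_partial_y ::
  "complex set \<Rightarrow> (complex \<Rightarrow> complex) \<Rightarrow> (complex \<Rightarrow> complex) \<Rightarrow> bool" where
  "weak_partial_y \<Omega> f g \<longleftrightarrow>
     (\<forall>\<phi>. test_function \<Omega> \<phi> \<longrightarrow>
        (LINT z|lebesgue_on \<Omega>. f z * partial_y \<phi> z) = - (LINT z|lebesgue_on \<Omega>. g z * \<phi> z))"

definition W12 :: "complex set \<Rightarrow> (complex \<Rightarrow> complex) \<Rightarrow> bool" where
  "W12 \<Omega> f \<longleftrightarrow> Lp_on 2 \<Omega> f \<and>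
     (\<exists>g. Lp_on 2 \<Omega> g \<and> weak_partial_x \<Omega> f g) \<and>
     (\<exists>h. Lp_on 2 \<Omega> h \<and> weak_partial_y \<Omega> f h)"

definition Holder_on :: "real \<Rightarrow> complex set \<Rightarrow> (complex \<Rightarrow> complex) \<Rightarrow> bool" where
  "Holder_on \<alpha> S f \<longleftrightarrow>
     (\<exists>C. \<forall>z\<in>S. \<forall>w\<in>S. norm (f z - f w) \<le> C * norm (z - w) powr \<alpha>)"

end

theory Submission
  imports Defs
begin

text \<open>
  The hypotheses control only the combination \<open>u_x + \<i> u_y\<close>, at almost every point. Nothing is said
  about the integrability of \<open>u_x\<close> or \<open>u_y\<close>, and pointwise derivatives need not represent the
  distributional ones. Three facts bridge this gap. All of them concern a continuous function \<open>f\<close>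
  on the plane that has partial derivatives off a countable set, and \<open>D\<close> stands for \<open>f_x + \<i> f_y\<close>. After
  multiplication of \<open>u\<close> by a cutoff function, \<open>f\<close> may be assumed to have compact support and \<open>D\<close> to
  belong to \<open>L\<^sup>p\<close>.

  Green's formula (\<open>Green_rectangle\<close>): if \<open>D\<close> is integrable, its integral over a rectangle
  is determined by the values of \<open>f\<close> on the boundary. This is the argument of Looman and Menchoff. The
  points near which the formula fails form a closed set \<open>F\<close>. If \<open>F\<close> is not empty, then by Baire's
  theorem some portion of \<open>F\<close> is a single point or is such that horizontal and vertical difference
  quotients of \<open>f\<close> are bounded uniformly at its points. Along lines one can then integrate the
  partial derivatives over \<open>F\<close> and bound the rest of the increment of \<open>f\<close> by the length of the complement
  of \<open>F\<close> (\<open>increment_across_closed_set\<close>), so that the defect of the formula on a rectangle is bounded by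
  an integral over the points outside \<open>F\<close>. On fine subdivisions only rectangles that meet \<open>F\<close> contribute,
  and the bounds tend to zero: the portion is regular after all.

  Square integrability (\<open>partials_square_integrable\<close>): if \<open>D\<close> is in \<open>L\<^sup>2\<close>, then so are \<open>f_x\<close> and \<open>f_y\<close>,
  with norms at most that of \<open>D\<close>. For smooth functions this holds because the integral of the
  Jacobian determinant vanishes. Here the derivatives are replaced by increments averaged over the
  sides of a small rectangle. These are commuting antisymmetric operators, so the mixed term
  vanishes for them as well (\<open>inner_product_incr_real\<close>); Green's formula says that their combination is
  the integral of \<open>D\<close> over the rectangle; and Fatou's lemma returns to the derivatives. Once \<open>f_x\<close> and
  \<open>f_y\<close> are known to be integrable, the fundamental theorem of calculus on almost every line (with
  countably many exceptional points) shows that they are the weak derivatives.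

  Hoelder continuity (\<open>Hoelder_estimate\<close>): Green's formula for the product of \<open>f\<close> with a smooth
  approximation of the Cauchy kernel represents \<open>f\<close> as the Cauchy transform of \<open>D\<close>. The difference of
  the kernels at \<open>z\<close> and \<open>w\<close> has \<open>q\<close>-th power integral of the order \<open>\<bar>z - w\<bar> powr (2 - q)\<close> for the
  exponent \<open>q\<close> dual to \<open>p > 2\<close> (\<open>nn_integral_cauchy_gap\<close>), and Young's inequality gives the exponent
  \<open>1 - 2 / p\<close>.
\<close>

section \<open>The fundamental theorem of calculus with countably many exceptional points\<close>

text \<open>The gauge proof of the fundamental theorem controls the increment of \<open>f\<close> over a tagged interval
\<open>[u, v]\<close> by a small multiple of \<open>v - u\<close> when the tag is a point of differentiability. At the
\<open>n\<close>-th exceptional point continuity only makes the increment less than a prescribed multiple of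
\<open>2\<^sup>-\<^sup>n\<close>, and this is charged to the increasing function \<open>j\<close> that jumps by at least \<open>2\<^sup>-\<^sup>n\<close>
there: the increments of \<open>j\<close> telescope over a tagged division, so that no count of the
intervals sharing a tag is required.\<close>

lemma fundamental_theorem_of_calculus_countable:
  fixes f :: "real \<Rightarrow> 'a::banach"
  assumes ab: "a \<le> b" and S: "countable S" and cont: "continuous_on {a..b} f"
    and deriv: "\<And>x. x \<in> {a..b} - S \<Longrightarrow> (f has_vector_derivative f' x) (at x within {a..b})"
  shows "(f' has_integral (f b - f a)) {a..b}"
proof -
  define q where "q = from_nat_into S"
  \<comment> \<open>Both a left and a right jump, so that an interval having the \<open>n\<close>-th point as an endpoint is charged too.\<close>
  define t where "t n y = (1/2::real)^n * (of_bool (q n < y) + of_bool (q n \<le> y))" for n y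
  define j where "j y = (\<Sum>n. t n y)" for y
  have t_le: "0 \<le> t n y" "t n y \<le> 2 * (1/2)^n" for n y
    by (auto simp: t_def of_bool_def)
  have geo: "(\<lambda>n. 2 * (1/2::real)^n) sums 4"
    using sums_mult[OF geometric_sums[of "1/2::real"], of 2] by simp
  have sumt: "summable (\<lambda>n. t n y)" for y
    by (rule summable_comparison_test'[where g="\<lambda>n. 2 * (1/2)^n" and N=0])
       (use geo t_le in \<open>auto simp: sums_iff\<close>)
  have j_bounds: "0 \<le> j y" "j y \<le> 4" for y
    unfolding j_def using suminf_le[OF t_le(2) sumt, of y] geo suminf_nonneg[OF sumt t_le(1)]
    by (auto simp: sums_iff)
  have t_mono: "t n u \<le> t n v" if "u \<le> v" for n u v
    using that by (auto simp: t_def of_bool_def)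
  have j_mono: "j u \<le> j v" if "u \<le> v" for u v
    unfolding j_def by (rule suminf_le[OF t_mono[OF that] sumt sumt])
  have j_jump: "(1/2)^n \<le> j v - j u" if "u < v" "u \<le> q n" "q n \<le> v" for u v n
  proof -
    have "(1/2)^n \<le> t n v - t n u"
      using that by (auto simp: t_def of_bool_def)
    also have "\<dots> = (\<Sum>i\<in>{n}. t i v - t i u)" by simp
    also have "\<dots> \<le> (\<Sum>i. t i v - t i u)"
      by (rule sum_le_suminf) (use t_mono that sumt in \<open>auto intro!: summable_diff\<close>)
    also have "\<dots> = j v - j u"
      unfolding j_def by (rule suminf_diff[symmetric, OF sumt sumt])
    finally show ?thesis .
  qed
  have local_bound: "\<exists>d>0. \<forall>u v. a \<le> u \<and> u \<le> x \<and> x \<le> v \<and> v \<le> b \<and> x - u < d \<and> v - x < d \<longrightarrow>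
         norm ((v - u) *\<^sub>R f' x - (f v - f u)) \<le> e * ((v - u) + (j v - j u))"
    if x: "x \<in> {a..b}" and e: "e > 0" for x e
  proof -
    define r where "r y = f y - f x - (y - x) *\<^sub>R f' x" for y
    have r_diff: "(v - u) *\<^sub>R f' x - (f v - f u) = r u - r v" for u v
      by (simp add: r_def algebra_simps)
    show ?thesis
    proof (cases "x \<in> S")
      case False
      then have "(f has_vector_derivative f' x) (at x within {a..b})"
        using deriv x by blast
      then obtain d where d: "d > 0"
        "\<And>y. y \<in> {a..b} \<Longrightarrow> \<bar>y - x\<bar> < d \<Longrightarrow> norm (r y) \<le> e * \<bar>y - x\<bar>"
        unfolding has_vector_derivative_def has_derivative_within_alt r_def
        using e unfolding real_norm_def by blast
      show ?thesis
      proof (rule exI[of _ d], safe)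
        fix u v assume uv: "a \<le> u" "u \<le> x" "x \<le> v" "v \<le> b" "x - u < d" "v - x < d"
        have "norm (r u - r v) \<le> norm (r u) + norm (r v)" by (rule norm_triangle_ineq4)
        also have "\<dots> \<le> e * (x - u) + e * (v - x)"
          using d(2)[of u] d(2)[of v] uv by (intro add_mono) auto
        also have "\<dots> \<le> e * ((v - u) + (j v - j u))"
          using j_mono[of u v] uv e by (simp add: algebra_simps)
        finally show "norm ((v - u) *\<^sub>R f' x - (f v - f u)) \<le> e * (v - u + (j v - j u))"
          by (simp add: r_diff)
      qed (use d in auto)
    next
      case True
      then obtain n where n: "q n = x" 
        unfolding q_def using from_nat_into_surj[OF S True] by blast
      have "continuous_on {a..b} r"
        unfolding r_def by (intro continuous_intros cont)
      then obtain d where d: "d > 0"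
        "\<And>y. y \<in> {a..b} \<Longrightarrow> \<bar>y - x\<bar> < d \<Longrightarrow> norm (r y - r x) < e * (1/2)^n / 2"
      proof -
        have "e * (1/2)^n / 2 > 0" using e by simp
        then show ?thesis
          using \<open>continuous_on {a..b} r\<close> x that unfolding continuous_on_iff dist_norm real_norm_def by blast
      qed
      have rx: "r x = 0" by (simp add: r_def)
      show ?thesis
      proof (rule exI[of _ d], safe)
        fix u v assume uv: "a \<le> u" "u \<le> x" "x \<le> v" "v \<le> b" "x - u < d" "v - x < d"
        show "norm ((v - u) *\<^sub>R f' x - (f v - f u)) \<le> e * (v - u + (j v - j u))"
        proof (cases "u = v")
          case False
          have "norm (r u - r v) \<le> norm (r u) + norm (r v)" by (rule norm_triangle_ineq4)
          also have "\<dots> \<le> e * (1/2)^n"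
            using d(2)[of u] d(2)[of v] uv rx by auto
          also have "\<dots> \<le> e * (j v - j u)"
            using j_jump[of u v n] uv n e False by simp
          also have "\<dots> \<le> e * ((v - u) + (j v - j u))"
            using uv e by simp
          finally show ?thesis by (simp add: r_diff)
        qed simp
      qed (use d in auto)
    qed
  qed
  show ?thesis
    unfolding has_integral box_real[symmetric]
  proof safe
    fix e0 :: real assume "e0 > 0"
    \<comment> \<open>The increments of \<open>j\<close> add up to at most 4.\<close>
    define e where "e = e0 / (b - a + 5)"
    have e: "e > 0" using \<open>e0 > 0\<close> ab by (simp add: e_def)
    obtain d where d: "\<And>x. x \<in> {a..b} \<Longrightarrow> d x > 0"
      "\<And>x u v. x \<in> {a..b} \<Longrightarrow> a \<le> u \<Longrightarrow> u \<le> x \<Longrightarrow> x \<le> v \<Longrightarrow> v \<le> b \<Longrightarrow> x - u < d x \<Longrightarrow> v - x < d x \<Longrightarrow>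
         norm ((v - u) *\<^sub>R f' x - (f v - f u)) \<le> e * ((v - u) + (j v - j u))"
      proof -
      have "\<forall>x\<in>{a..b}. \<exists>d>0. \<forall>u v. a \<le> u \<and> u \<le> x \<and> x \<le> v \<and> v \<le> b \<and> x - u < d \<and> v - x < d \<longrightarrow>
         norm ((v - u) *\<^sub>R f' x - (f v - f u)) \<le> e * ((v - u) + (j v - j u))"
        using local_bound[OF _ e] by blast
      from bchoice[OF this] show ?thesis using that by blast
      qed
    define \<gamma> where "\<gamma> x = ball x (if x \<in> {a..b} then d x else 1)" for x
    have gauge: "gauge \<gamma>"
      unfolding \<gamma>_def by (rule gauge_ball_dependent) (use d in auto)
    have main: "norm ((\<Sum>(x, K)\<in>p. measure lborel K *\<^sub>R f' x) - (f b - f a)) < e0"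
      if p: "p tagged_division_of cbox a b" and fine: "\<gamma> fine p" for p
    proof -
      have tele: "(\<Sum>n\<in>p. h (Sup (snd n)) - h (Inf (snd n))) = h b - h a" for h :: "real \<Rightarrow> 'c::real_normed_vector"
      proof -
        have "(\<Sum>(x, K)\<in>p. h (Sup K) - h (Inf K)) = h b - h a"
          by (rule additive_tagged_division_1[OF ab]) (use p in \<open>simp only: box_real\<close>)
        then show ?thesis by (simp only: case_prod_unfold)
      qed
      have "(\<Sum>(x, K)\<in>p. measure lborel K *\<^sub>R f' x) - (f b - f a) =
            (\<Sum>n\<in>p. measure lborel (snd n) *\<^sub>R f' (fst n)) - (\<Sum>n\<in>p. f (Sup (snd n)) - f (Inf (snd n)))"
        unfolding tele[of f] case_prod_unfold ..
      also have "\<dots> = (\<Sum>n\<in>p. measure lborel (snd n) *\<^sub>R f' (fst n) - (f (Sup (snd n)) - f (Inf (snd n))))"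
        by (rule sum_subtractf[symmetric])
      finally have "norm ((\<Sum>(x, K)\<in>p. measure lborel K *\<^sub>R f' x) - (f b - f a)) =
            norm (\<Sum>n\<in>p. measure lborel (snd n) *\<^sub>R f' (fst n) - (f (Sup (snd n)) - f (Inf (snd n))))"
        by (rule arg_cong)
      also have "\<dots> \<le> (\<Sum>n\<in>p. e * ((Sup (snd n) - Inf (snd n)) + (j (Sup (snd n)) - j (Inf (snd n)))))"
      proof (rule sum_norm_le)
        fix n assume "n \<in> p"
        then obtain x K where n: "n = (x, K)" and xK: "(x, K) \<in> p" by (cases n) auto
        then have "x \<in> K" and Kab: "K \<subseteq> cbox a b" using p by blast+
        then obtain u v where K: "K = cbox u v" using p xK by auto
        have uv: "u \<le> x" "x \<le> v" using \<open>x \<in> K\<close> K by auto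
        then have "u \<in> K" "v \<in> K" by (auto simp: K)
        have "K \<subseteq> \<gamma> x" using fine xK by blast
        then have "u \<in> \<gamma> x" "v \<in> \<gamma> x" using \<open>u \<in> K\<close> \<open>v \<in> K\<close> by auto
        moreover have "x \<in> {a..b}" using \<open>x \<in> K\<close> Kab by auto
        ultimately have "norm ((v - u) *\<^sub>R f' x - (f v - f u)) \<le> e * ((v - u) + (j v - j u))"
          using \<open>u \<in> K\<close> \<open>v \<in> K\<close> Kab uv by (intro d(2)) (auto simp: \<gamma>_def dist_real_def)
        then show "norm (measure lborel (snd n) *\<^sub>R f' (fst n) - (f (Sup (snd n)) - f (Inf (snd n))))
             \<le> e * (Sup (snd n) - Inf (snd n) + (j (Sup (snd n)) - j (Inf (snd n))))"
          using uv by (simp add: K n)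
      qed
      also have "\<dots> = e * ((b - a) + (j b - j a))"
        unfolding tele[of "\<lambda>x. x", symmetric] tele[of j, symmetric] sum.distrib[symmetric]
        by (rule sum_distrib_left[symmetric])
      also have "\<dots> < e * (b - a + 5)"
        using j_bounds[of b] j_bounds[of a] e by simp
      also have "\<dots> = e0" using ab by (simp add: e_def)
      finally show ?thesis .
    qed
    show "\<exists>\<gamma>. gauge \<gamma> \<and> (\<forall>p. p tagged_division_of cbox a b \<and> \<gamma> fine p \<longrightarrow>
            norm ((\<Sum>(x, K)\<in>p. measure lborel K *\<^sub>R f' x) - (f b - f a)) < e0)"
      using gauge main by (intro exI[of _ \<gamma>] conjI allI impI) simp_all
  qed
qed

section \<open>Increments across a closed set\<close>

text \<open>The gaps to the right of the points in question are disjoint open intervals.\<close>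

lemma countable_right_isolated:
  fixes K :: "real set"
  shows "countable {t\<in>K. \<exists>d>0. \<forall>k\<in>K. k \<le> t \<or> t + d \<le> k}"
proof -
  define I where "I = {t\<in>K. \<exists>d>0. \<forall>k\<in>K. k \<le> t \<or> t + d \<le> k}"
  have "\<forall>t\<in>I. \<exists>d>0. \<forall>k\<in>K. k \<le> t \<or> t + d \<le> k"
    unfolding I_def by blast
  from bchoice[OF this] obtain d where
    d: "\<And>t. t \<in> I \<Longrightarrow> d t > 0" "\<And>t k. t \<in> I \<Longrightarrow> k \<in> K \<Longrightarrow> k \<le> t \<or> t + d t \<le> k"
    by blast
  have IK: "t \<in> K" if "t \<in> I" for t using that by (simp add: I_def)
  have disj: "{s<..<s + d s} \<inter> {t<..<t + d t} = {}" if "s \<in> I" "t \<in> I" "s < t" for s t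
    using d(2)[OF that(1) IK[OF that(2)]] that(3) by auto
  have "countable ((\<lambda>t. {t<..<t + d t}) ` I)"
  proof (rule countable_disjoint_open_subsets)
    show "pairwise disjnt ((\<lambda>t. {t<..<t + d t}) ` I)"
    proof (rule pairwise_imageI)
      fix s t assume "s \<in> I" "t \<in> I" "s \<noteq> t"
      then show "disjnt {s<..<s + d s} {t<..<t + d t}"
        using disj[of s t] disj[of t s] unfolding disjnt_def by (metis Int_commute linorder_neqE)
    qed
  qed auto
  moreover have "inj_on (\<lambda>t. {t<..<t + d t}) I"
  proof (rule inj_onI)
    fix s t assume "s \<in> I" "t \<in> I" "{s<..<s + d s} = {t<..<t + d t}"
    moreover from this have "{t<..<t + d t} \<noteq> {}" using d(1)[of t] by simp
    ultimately show "s = t"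
      using disj[of s t] disj[of t s] by (metis Int_absorb linorder_neqE)
  qed
  ultimately show ?thesis unfolding I_def[symmetric] by (rule countable_image_inj_on)
qed

lemma countable_left_isolated:
  fixes K :: "real set"
  shows "countable {t\<in>K. \<exists>d>0. \<forall>k\<in>K. t \<le> k \<or> k \<le> t - d}"
proof (rule countable_subset)
  let ?R = "{t\<in>uminus ` K. \<exists>d>0. \<forall>k\<in>uminus ` K. k \<le> t \<or> t + d \<le> k}"
  show "countable (uminus ` ?R)"
    by (intro countable_image countable_right_isolated)
  show "{t\<in>K. \<exists>d>0. \<forall>k\<in>K. t \<le> k \<or> k \<le> t - d} \<subseteq> uminus ` ?R"
  proof safe
    fix t d assume t: "t \<in> K" "d > (0::real)" "\<forall>k\<in>K. t \<le> k \<or> k \<le> t - d"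
    have "\<forall>k\<in>uminus ` K. k \<le> -t \<or> -t + d \<le> k"
    proof
      fix k assume "k \<in> uminus ` K"
      then obtain l where "l \<in> K" "k = - l" by blast
      then show "k \<le> -t \<or> -t + d \<le> k" using t(3) by force
    qed
    then have "-t \<in> ?R" using t by blast
    then have "- (- t) \<in> uminus ` ?R" by (rule imageI)
    then show "t \<in> uminus ` ?R" by (simp only: minus_minus)
  qed
qed

text \<open>The derivative is under control only on \<open>K\<close>. Let \<open>G\<close> agree with \<open>g\<close> on \<open>K\<close> and at the two
ends, and be affine on the gaps. Off a countable set it is differentiable, with derivative \<open>g'\<close> on
\<open>K\<close> (a point of \<open>K\<close> that \<open>K\<close> approaches from both sides sees only chords of \<open>g\<close> on its own
side) and with slope at most \<open>N\<close> in the gaps. The fundamental theorem for \<open>G\<close> then leaves only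
the integral of the slopes over the complement of \<open>K\<close>.\<close>

lemma increment_across_closed_set:
  fixes g g' :: "real \<Rightarrow> complex"
  assumes ab: "a \<le> b" and K: "closed K" "K \<subseteq> {a..b}" "K \<noteq> {}" and S: "countable S"
    and cont: "continuous_on {a..b} g"
    and lip: "\<And>t y. t \<in> K \<Longrightarrow> y \<in> {a..b} \<Longrightarrow> norm (g y - g t) \<le> N * \<bar>y - t\<bar>"
    and deriv: "\<And>t. t \<in> K - S \<Longrightarrow> (g has_vector_derivative g' t) (at t)"
    and g'N: "\<And>t. t \<in> K - S \<Longrightarrow> norm (g' t) \<le> N" and N: "N \<ge> 0"
    and g'm: "g' \<in> borel_measurable borel"
  shows "norm (g b - g a - (LINT t:K|lborel. g' t)) \<le> N * measure lborel ({a..b} - K)"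
proof -
  \<comment> \<open>The ends are added so that every gap is bounded by two points of \<open>L\<close>.\<close>
  define L where "L = insert a (insert b K)"
  have L: "closed L" "L \<subseteq> {a..b}" "a \<in> L" "b \<in> L" "K \<subseteq> L"
    using K ab by (auto simp: L_def)
  define lo where "lo t = Sup (L \<inter> {..t})" for t
  define hi where "hi t = Inf (L \<inter> {t..})" for t
  have lo: "lo t \<in> L" "lo t \<le> t" "k \<in> L \<Longrightarrow> k \<le> t \<Longrightarrow> k \<le> lo t" if "a \<le> t" for t k
  proof -
    have bd: "bdd_above (L \<inter> {..t})" by (auto intro!: bdd_aboveI[of _ t])
    have "Sup (L \<inter> {..t}) \<in> L \<inter> {..t}"
      by (rule closed_contains_Sup) (use L that bd in auto)
    then show "lo t \<in> L" "lo t \<le> t" by (auto simp: lo_def)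
    show "k \<le> lo t" if "k \<in> L" "k \<le> t"
      unfolding lo_def by (rule cSup_upper) (use that bd in auto)
  qed
  have hi: "hi t \<in> L" "t \<le> hi t" "k \<in> L \<Longrightarrow> t \<le> k \<Longrightarrow> hi t \<le> k" if "t \<le> b" for t k
  proof -
    have bd: "bdd_below (L \<inter> {t..})" by (auto intro!: bdd_belowI[of _ t])
    have "Inf (L \<inter> {t..}) \<in> L \<inter> {t..}"
      by (rule closed_contains_Inf) (use L that bd in auto)
    then show "hi t \<in> L" "t \<le> hi t" by (auto simp: hi_def)
    show "hi t \<le> k" if "k \<in> L" "t \<le> k"
      unfolding hi_def by (rule cInf_lower) (use that bd in auto)
  qed
  define slope where "slope t = (1 / (hi t - lo t)) *\<^sub>R (g (hi t) - g (lo t))" for t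
  define G where "G t = (if t \<in> L then g t else g (lo t) + (t - lo t) *\<^sub>R slope t)" for t
  define s where "s t = (if t \<in> L then g' t else slope t)" for t
  \<comment> \<open>Every gap has at least one endpoint in \<open>K\<close>, because \<open>K\<close> is not empty.\<close>
  have gap: "lo t < t" "t < hi t" "norm (slope t) \<le> N" if t: "t \<in> {a..b}" "t \<notin> L" for t
  proof -
    show lt: "lo t < t" "t < hi t"
      using lo[of t] hi[of t] t by (auto simp: order_less_le)
    have "lo t \<in> K \<or> hi t \<in> K"
    proof (rule ccontr)
      assume "\<not> (lo t \<in> K \<or> hi t \<in> K)"
      then have "lo t = a" "hi t = b"
        using lo(1)[of t] hi(1)[of t] lt t by (auto simp: L_def)
      moreover obtain k where k: "k \<in> K" using K by blast
      moreover have "k \<in> L" "a \<le> k" "k \<le> b" using k K L by auto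
      ultimately have "k = lo t \<or> k = hi t"
        using lo(3)[of t k] hi(3)[of t k] t by (metis atLeastAtMost_iff linear order_antisym)
      then show False
        using k \<open>\<not> (lo t \<in> K \<or> hi t \<in> K)\<close> by blast
    qed
    then have "norm (g (hi t) - g (lo t)) \<le> N * (hi t - lo t)"
      using lip[of "lo t" "hi t"] lip[of "hi t" "lo t"] lt lo(1)[of t] hi(1)[of t] t L
      by (auto simp: norm_minus_commute)
    then show "norm (slope t) \<le> N"
      using lt by (simp add: slope_def divide_simps mult.commute)
  qed
  have same_gap: "lo y = lo t" "hi y = hi t" "y \<notin> L" if "t \<in> {a..b}" "t \<notin> L" "lo t < y" "y < hi t" for t y
  proof -
    have ty: "a \<le> y" "y \<le> b" "a \<le> t" "t \<le> b"
      using lo(1)[of t] hi(1)[of t] that L by auto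
    have none: "k \<notin> L" if "lo t < k" "k < hi t" for k
      using lo(3)[of t k] hi(3)[of t k] that ty by (metis linorder_not_le nle_le)
    show "y \<notin> L" using none that by blast
    show "lo y = lo t"
      using lo[of y] lo(1)[of t] lo(3)[of y "lo t"] none[of "lo y"] that ty by force
    show "hi y = hi t"
      using hi[of y] hi(1)[of t] hi(3)[of y "hi t"] none[of "hi y"] that ty by force
  qed
  have G_gap: "(G has_vector_derivative slope t) (at t)" if t: "t \<in> {a..b}" "t \<notin> L" for t
  proof (rule has_vector_derivative_transform_within_open)
    show "((\<lambda>y. g (lo t) + (y - lo t) *\<^sub>R slope t) has_vector_derivative slope t) (at t)"
      by (auto intro!: derivative_eq_intros)
    show "t \<in> {lo t<..<hi t}" using gap[OF t] by auto
    fix y assume "y \<in> {lo t<..<hi t}"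
    then show "g (lo t) + (y - lo t) *\<^sub>R slope t = G y"
      using same_gap[OF t, of y] by (simp add: G_def slope_def)
  qed auto
  \<comment> \<open>Affine functions are reproduced by interpolation, so a first order estimate at the ends of a gap holds inside it.\<close>
  have G_convex: "\<exists>l h \<theta>. l \<in> L \<and> h \<in> L \<and> l \<le> y \<and> y \<le> h \<and> 0 \<le> \<theta> \<and> \<theta> \<le> 1 \<and> y = (1 - \<theta>) * l + \<theta> * h \<and>
       G y = (1 - \<theta>) *\<^sub>R g l + \<theta> *\<^sub>R g h \<and> (\<forall>k\<in>L. k \<le> y \<longrightarrow> k \<le> l) \<and> (\<forall>k\<in>L. y \<le> k \<longrightarrow> h \<le> k)"
    if y: "y \<in> {a..b}" for y
  proof (cases "y \<in> L")
    case True
    then show ?thesis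
      by (intro exI[of _ y] exI[of _ y] exI[of _ 0]) (auto simp: G_def)
  next
    case False
    define \<theta> where "\<theta> = (y - lo y) / (hi y - lo y)"
    have lh: "lo y < y" "y < hi y" using gap[OF y False] by auto
    have 1: "y = (1 - \<theta>) * lo y + \<theta> * hi y"
    proof -
      have "(1 - \<theta>) * lo y + \<theta> * hi y = lo y + \<theta> * (hi y - lo y)" by algebra
      also have "\<dots> = y" using lh by (simp add: \<theta>_def)
      finally show ?thesis ..
    qed
    have 2: "G y = (1 - \<theta>) *\<^sub>R g (lo y) + \<theta> *\<^sub>R g (hi y)"
      using False by (simp add: G_def slope_def \<theta>_def scaleR_diff_right scaleR_diff_left)
    show ?thesis
      using lo[of y] hi[of y] y lh 1 2
      by (intro exI[of _ "lo y"] exI[of _ "hi y"] exI[of _ \<theta>]) (auto simp: \<theta>_def)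
  qed
  \<comment> \<open>The bound at \<open>y\<close> is the convex combination of the bounds at the ends of its gap; the weights reproduce \<open>\<bar>y - t\<bar>\<close> because both ends lie on the same side of \<open>t\<close>.\<close>
  have G_affine: "norm (G y - c - (y - t) *\<^sub>R m) \<le> e * \<bar>y - t\<bar> + e0"
    if y: "y \<in> {a..b}" and t: "t \<in> L" and e: "e \<ge> 0" "e0 \<ge> 0"
      and R: "\<And>k. k \<in> L \<Longrightarrow> t \<le> y \<Longrightarrow> t \<le> k \<Longrightarrow> k \<le> r \<Longrightarrow> norm (g k - c - (k - t) *\<^sub>R m) \<le> e * \<bar>k - t\<bar> + e0"
             "\<And>k. k \<in> L \<Longrightarrow> y \<le> t \<Longrightarrow> k \<le> t \<Longrightarrow> l \<le> k \<Longrightarrow> norm (g k - c - (k - t) *\<^sub>R m) \<le> e * \<bar>k - t\<bar> + e0"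
      and lr: "l \<in> L" "r \<in> L" "l \<le> y" "y \<le> r"
    for y t c m e e0 l r
  proof -
    obtain p q \<theta> where pq: "p \<in> L" "q \<in> L" "p \<le> y" "y \<le> q" "0 \<le> \<theta>" "\<theta> \<le> 1" "y = (1 - \<theta>) * p + \<theta> * q"
       "G y = (1 - \<theta>) *\<^sub>R g p + \<theta> *\<^sub>R g q" "\<forall>k\<in>L. k \<le> y \<longrightarrow> k \<le> p" "\<forall>k\<in>L. y \<le> k \<longrightarrow> q \<le> k"
      using G_convex[OF y] by blast
    define E where "E k = g k - c - (k - t) *\<^sub>R m" for k
    have EG: "G y - c - (y - t) *\<^sub>R m = (1 - \<theta>) *\<^sub>R E p + \<theta> *\<^sub>R E q"
    proof -
      have "(1 - \<theta>) *\<^sub>R E p + \<theta> *\<^sub>R E q = G y - ((1-\<theta>) + \<theta>) *\<^sub>R c - (((1 - \<theta>) * p + \<theta> * q) - ((1-\<theta>) + \<theta>) * t) *\<^sub>R m"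
        unfolding E_def pq(8) by (simp add: algebra_simps)
      then show ?thesis using pq(7) by simp
    qed
    have side: "(t \<le> p \<and> q \<le> r \<and> t \<le> y) \<or> (q \<le> t \<and> l \<le> p \<and> y \<le> t)"
      using pq(9,10) t lr by (metis linear)
    have Epq: "norm (E p) \<le> e * \<bar>p - t\<bar> + e0" "norm (E q) \<le> e * \<bar>q - t\<bar> + e0"
      using side R[OF pq(1)] R[OF pq(2)] pq(3,4) unfolding E_def by force+
    have "norm ((1 - \<theta>) *\<^sub>R E p + \<theta> *\<^sub>R E q) \<le> (1 - \<theta>) * norm (E p) + \<theta> * norm (E q)"
      using norm_triangle_ineq[of "(1 - \<theta>) *\<^sub>R E p" "\<theta> *\<^sub>R E q"] pq by simp
    also have "\<dots> \<le> (1 - \<theta>) * (e * \<bar>p - t\<bar> + e0) + \<theta> * (e * \<bar>q - t\<bar> + e0)"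
      using Epq pq by (intro add_mono mult_left_mono) auto
    also have "\<dots> = e * ((1 - \<theta>) * \<bar>p - t\<bar> + \<theta> * \<bar>q - t\<bar>) + e0" by algebra
    also have "(1 - \<theta>) * \<bar>p - t\<bar> + \<theta> * \<bar>q - t\<bar> = \<bar>y - t\<bar>"
    proof (cases "t \<le> p")
      case True
      then have "\<bar>p - t\<bar> = p - t" "\<bar>q - t\<bar> = q - t" "\<bar>y - t\<bar> = y - t" using pq by auto
      then show ?thesis using pq(7) by algebra
    next
      case False
      then have "\<bar>p - t\<bar> = t - p" "\<bar>q - t\<bar> = t - q" "\<bar>y - t\<bar> = t - y" using side pq by auto
      then show ?thesis using pq(7) by algebra
    qed
    finally show ?thesis unfolding EG .
  qed
  define T where "T = S \<union> {a, b} \<union> {t\<in>L. \<exists>d>0. \<forall>k\<in>L. k \<le> t \<or> t + d \<le> k} \<union> {t\<in>L. \<exists>d>0. \<forall>k\<in>L. t \<le> k \<or> k \<le> t - d}"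
  have T: "countable T"
    unfolding T_def by (intro countable_Un S countable_right_isolated countable_left_isolated) auto
  have G_deriv: "(G has_vector_derivative s t) (at t within {a..b})" if t: "t \<in> {a..b} - T" for t
  proof (cases "t \<in> L")
    case False
    then show ?thesis
      using G_gap[of t] t has_vector_derivative_at_within by (auto simp: s_def)
  next
    case True
    then have tK: "t \<in> K - S" using t by (auto simp: L_def T_def)
    show ?thesis
      unfolding has_vector_derivative_def has_derivative_within_alt
    proof (intro conjI allI impI)
      show "bounded_linear (\<lambda>x. x *\<^sub>R s t)" by (rule bounded_linear_scaleR_left)
      fix e :: real assume e: "e > 0"
      have "(g has_derivative (\<lambda>x. x *\<^sub>R g' t)) (at t)"
        using deriv[OF tK] by (simp add: has_vector_derivative_def)
      then obtain d where d: "d > 0" "\<And>y. norm (y - t) < d \<Longrightarrow> norm (g y - g t - (y - t) *\<^sub>R g' t) \<le> e * norm (y - t)"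
        unfolding has_derivative_within_alt using e by blast
      obtain r where r: "r \<in> L" "t < r" "r < t + d"
        using t True d(1) unfolding T_def by force
      obtain l where l: "l \<in> L" "l < t" "t - d < l"
        using t True d(1) unfolding T_def by force
      show "\<exists>d>0. \<forall>y\<in>{a..b}. norm (y - t) < d \<longrightarrow> norm (G y - G t - (y - t) *\<^sub>R s t) \<le> e * norm (y - t)"
      proof (rule exI[of _ "min (r - t) (t - l)"], intro conjI ballI impI)
        fix y assume y: "y \<in> {a..b}" "norm (y - t) < min (r - t) (t - l)"
        have "norm (G y - g t - (y - t) *\<^sub>R g' t) \<le> e * \<bar>y - t\<bar> + 0"
        proof (rule G_affine[where l=l and r=r])
          have near: "norm (g k - g t - (k - t) *\<^sub>R g' t) \<le> e * \<bar>k - t\<bar> + 0" if "\<bar>k - t\<bar> < d" for k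
            using d(2)[of k] that by simp
          show "norm (g k - g t - (k - t) *\<^sub>R g' t) \<le> e * \<bar>k - t\<bar> + 0" if "t \<le> k" "k \<le> r" for k
            using that r by (intro near) auto
          show "norm (g k - g t - (k - t) *\<^sub>R g' t) \<le> e * \<bar>k - t\<bar> + 0" if "k \<le> t" "l \<le> k" for k
            using that l by (intro near) auto
        qed (use y True e l r in auto)
        then show "norm (G y - G t - (y - t) *\<^sub>R s t) \<le> e * norm (y - t)"
          using True by (simp add: G_def s_def)
      qed (use r l in auto)
    qed
  qed
  have G_cont: "continuous_on {a..b} G"
    unfolding continuous_on_eq_continuous_within
  proof
    fix t assume t: "t \<in> {a..b}"
    show "continuous (at t within {a..b}) G"
    proof (cases "t \<in> L")
      case False
      then show ?thesis
        using G_gap[OF t] has_vector_derivative_continuous continuous_at_imp_continuous_at_within by blast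
    next
      case True
      show ?thesis
        unfolding continuous_within_eps_delta
      proof (intro allI impI)
        fix e :: real assume e: "e > 0"
        obtain d where d: "d > 0" "\<And>y. y \<in> {a..b} \<Longrightarrow> \<bar>y - t\<bar> < d \<Longrightarrow> norm (g y - g t) < e/2"
          using cont[unfolded continuous_on_iff dist_norm] t e half_gt_zero[OF e] unfolding real_norm_def by blast
        define \<delta> where "\<delta> = min d (e / (2 * (N + 1)))"
        have \<delta>: "\<delta> > 0" using d e N by (simp add: \<delta>_def)
        show "\<exists>d>0. \<forall>y\<in>{a..b}. dist y t < d \<longrightarrow> dist (G y) (G t) < e"
        proof (rule exI[of _ \<delta>], intro conjI ballI impI \<delta>)
          fix y assume y: "y \<in> {a..b}" "dist y t < \<delta>"
          have Gt: "G t = g t" using True by (simp add: G_def)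
          have close: "norm (g k - g t) < e / 2" if "k \<in> L" "\<bar>k - t\<bar> \<le> \<bar>y - t\<bar>" for k
            using d(2)[of k] that y L by (auto simp: dist_real_def \<delta>_def)
          show "dist (G y) (G t) < e"
          proof (cases "y \<in> L")
            case True
            then show ?thesis using close[of y] e unfolding dist_norm Gt by (simp add: G_def)
          next
            case False
            have lh: "lo y < y" "y < hi y" "norm (slope y) \<le> N" using gap[OF y(1) False] by auto
            have Gy: "G y = g (lo y) + (y - lo y) *\<^sub>R slope y"
                 "G y = g (hi y) - (hi y - y) *\<^sub>R slope y"
            proof -
              show 1: "G y = g (lo y) + (y - lo y) *\<^sub>R slope y" using False by (simp add: G_def)
              have "(hi y - lo y) *\<^sub>R slope y = g (hi y) - g (lo y)" using lh by (simp add: slope_def)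
              then show "G y = g (hi y) - (hi y - y) *\<^sub>R slope y" unfolding 1
                by (simp add: algebra_simps)
            qed
            obtain k c where k: "k \<in> L" "\<bar>k - t\<bar> \<le> \<bar>y - t\<bar>" "\<bar>c\<bar> \<le> \<bar>y - t\<bar>" "G y = g k + c *\<^sub>R slope y"
            proof (cases "t \<le> y")
              case True
              then have "t \<le> lo y" using lo(3)[of y t] \<open>t \<in> L\<close> y by auto
              then show ?thesis using lh Gy lo(1)[of y] y by (intro that[of "lo y" "y - lo y"]) auto
            next
              case False
              then have "hi y \<le> t" using hi(3)[of y t] \<open>t \<in> L\<close> y by auto
              moreover have "G y = g (hi y) + (-(hi y - y)) *\<^sub>R slope y"
                unfolding scaleR_minus_left using Gy(2) by simp
              ultimately show ?thesis
                using lh(2) hi(1)[of y] y by (intro that[of "hi y" "-(hi y - y)"]) auto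
            qed
            have "norm (G y - g t) \<le> norm (g k - g t) + \<bar>c\<bar> * norm (slope y)"
              using norm_triangle_ineq[of "g k - g t" "c *\<^sub>R slope y"] by (simp add: k(4) algebra_simps)
            also have "\<bar>c\<bar> * norm (slope y) \<le> \<delta> * N"
              using k(3) lh(3) y(2) N by (intro mult_mono) (auto simp: dist_real_def)
            also have "\<delta> * N \<le> e / (2 * (N + 1)) * N"
              using N by (intro mult_right_mono) (auto simp: \<delta>_def)
            also have "\<dots> \<le> e / 2" using N e by (simp add: divide_simps)
            also have "norm (g k - g t) < e / 2" by (rule close[OF k(1,2)])
            finally show ?thesis by (simp add: dist_norm Gt)
          qed
        qed
      qed
    qed
  qed
  have s_int: "(s has_integral (g b - g a)) {a..b}"
    using fundamental_theorem_of_calculus_countable[OF ab T G_cont G_deriv] L by (simp add: G_def)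
  have negl: "negligible T" 
    using T by (simp add: negligible_iff_null_sets countable_imp_null_set_lborel null_sets_completionI)
  have sN: "norm (s t) \<le> N" if "t \<in> {a..b} - T" for t
    using that gap(3)[of t] g'N[of t] by (auto simp: s_def L_def T_def)
  have Km[measurable]: "K \<in> sets borel" using K by simp
  define s0 where "s0 t = (if t \<in> T then 0 else s t)" for t
  have s0_int: "(s0 has_integral (g b - g a)) {a..b}"
    using has_integral_spike[OF negl _ s_int] by (simp add: s0_def)
  have s0N: "norm (s0 t) \<le> N" if "t \<in> {a..b}" for t
    using sN[of t] that N by (simp add: s0_def)
  have s0_abs: "s0 absolutely_integrable_on {a..b}"
  proof (rule measurable_bounded_by_integrable_imp_absolutely_integrable)
    show "s0 \<in> borel_measurable (lebesgue_on {a..b})"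
      using s0_int by (blast intro: integrable_imp_measurable)
  qed (use s0N in auto)
  have s0K: "s0 absolutely_integrable_on K" and s0D: "s0 absolutely_integrable_on ({a..b} - K)"
    using K by (auto intro!: set_integrable_subset[OF s0_abs])
  have fin: "{a..b} - K \<in> lmeasurable" 
    using Km by (intro lmeasurable_iff_integrable_on[THEN iffD2] fmeasurable_Diff[THEN lmeasurable_iff_integrable_on[THEN iffD1]]) auto
  have "g b - g a = integral {a..b} s0"
    using s0_int by (simp add: integral_unique)
  also have "\<dots> = integral (K \<union> ({a..b} - K)) s0"
    using K by (simp add: Un_absorb1)
  also have "\<dots> = integral K s0 + integral ({a..b} - K) s0"
    using s0K s0D by (intro integral_Un) (auto simp: set_lebesgue_integral_eq_integral(1))
  also have "integral K s0 = integral K g'"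
    by (rule integral_spike[OF negl]) (auto simp: s0_def s_def L_def)
  also have "integral K g' = (LINT t:K|lborel. g' t)"
  proof -
    have "g' absolutely_integrable_on K"
      by (rule absolutely_integrable_spike[OF s0K negl]) (auto simp: s0_def s_def L_def)
    then have "set_integrable lborel K g'"
      unfolding set_integrable_def using g'm 
      by (subst (asm) integrable_completion) (auto intro!: borel_measurable_scaleR)
    then show ?thesis by (rule set_borel_integral_eq_integral(2)[symmetric])
  qed
  finally have "g b - g a - (LINT t:K|lborel. g' t) = integral ({a..b} - K) s0" by simp
  also have "norm \<dots> \<le> integral ({a..b} - K) (\<lambda>t. N)"
    using s0D s0N fin by (intro integral_norm_bound_integral)
      (auto simp: set_lebesgue_integral_eq_integral(1) integrable_on_const)
  also have "\<dots> = N * measure lborel ({a..b} - K)"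
    using lmeasure_integral[OF fin] integral_mult_right[of "{a..b} - K" N "\<lambda>t. 1"]
    by (simp add: measure_completion)
  finally show ?thesis .
qed

section \<open>Functions on the plane with partial derivatives off a countable set\<close>

lemma has_vector_derivative_quotient:
  fixes g :: "real \<Rightarrow> 'a::real_normed_vector"
  assumes "(g has_vector_derivative D) (at t)"
  shows "((\<lambda>h. (g (t + h) - g t) /\<^sub>R h) \<longlongrightarrow> D) (at 0)"
proof -
  have "((\<lambda>h. norm (g (t + h) - g t - h *\<^sub>R D) / norm h) \<longlongrightarrow> 0) (at 0)"
    using assms unfolding has_vector_derivative_def has_derivative_at by simp
  then have "((\<lambda>h. norm ((g (t + h) - g t) /\<^sub>R h - D)) \<longlongrightarrow> 0) (at 0)"
  proof (rule Lim_transform_eventually)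
    show "\<forall>\<^sub>F h in at 0. norm (g (t + h) - g t - h *\<^sub>R D) / norm h = norm ((g (t + h) - g t) /\<^sub>R h - D)"
    proof (rule eventually_at_topological[THEN iffD2], intro exI[of _ UNIV] conjI ballI impI)
      fix h :: real assume h: "h \<noteq> 0"
      have "(g (t + h) - g t) /\<^sub>R h - D = (g (t + h) - g t - h *\<^sub>R D) /\<^sub>R h"
        using h by (simp add: scaleR_diff_right)
      then show "norm (g (t + h) - g t - h *\<^sub>R D) / norm h = norm ((g (t + h) - g t) /\<^sub>R h - D)"
        by (simp add: divide_inverse mult.commute)
    qed auto
  qed
  then show ?thesis
    using LIM_zero_cancel tendsto_norm_zero_iff by blast
qed

lemma norm_vector_derivative_le:
  fixes g :: "real \<Rightarrow> 'a::real_normed_vector"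
  assumes "(g has_vector_derivative D) (at t)" "r > 0"
    and le: "\<And>h. \<bar>h\<bar> \<le> r \<Longrightarrow> norm (g (t + h) - g t) \<le> N * \<bar>h\<bar>"
  shows "norm D \<le> N"
proof (rule tendsto_upperbound)
  show "((\<lambda>h. norm ((g (t + h) - g t) /\<^sub>R h)) \<longlongrightarrow> norm D) (at 0)"
    by (intro tendsto_norm has_vector_derivative_quotient assms)
  show "\<forall>\<^sub>F h in at 0. norm ((g (t + h) - g t) /\<^sub>R h) \<le> N"
    unfolding eventually_at
  proof (intro exI[of _ r] conjI ballI impI)
    fix h :: real assume "h \<noteq> 0 \<and> dist h 0 < r"
    then show "norm ((g (t + h) - g t) /\<^sub>R h) \<le> N"
      using le[of h] by (simp add: divide_simps mult.commute)
  qed (use assms in auto)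
qed auto

lemma lborel_prod_Fubini:
  fixes F :: "real \<times> real \<Rightarrow> 'b::{banach, second_countable_topology}"
  assumes F: "integrable lborel F"
  shows "(LINT p|lborel. F p) = (LINT x|lborel. LINT y|lborel. F (x, y))"
    and "integrable lborel (\<lambda>x. LINT y|lborel. F (x, y))"
    and "AE x in lborel. integrable lborel (\<lambda>y. F (x, y))"
proof -
  have I: "integrable (lborel \<Otimes>\<^sub>M lborel) F" using F by (simp add: lborel_prod)
  show "(LINT p|lborel. F p) = (LINT x|lborel. LINT y|lborel. F (x, y))"
    using lborel_pair.integral_fst'[OF I] by (simp add: lborel_prod)
  show "integrable lborel (\<lambda>x. LINT y|lborel. F (x, y))"
    by (rule lborel_pair.integrable_fst'[OF I])
  show "AE x in lborel. integrable lborel (\<lambda>y. F (x, y))"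
    by (rule lborel_pair.AE_integrable_fst'[OF I])
qed

lemma borel_measurable_swap[measurable]:
  "(prod.swap :: real \<times> real \<Rightarrow> real \<times> real) \<in> borel_measurable borel"
  by (intro borel_measurable_continuous_onI continuous_on_swap)

lemma lborel_prod_distr_swap: "distr lborel borel prod.swap = (lborel :: (real \<times> real) measure)"
proof -
  have "lborel \<Otimes>\<^sub>M lborel = distr (lborel \<Otimes>\<^sub>M lborel) (lborel \<Otimes>\<^sub>M lborel) (\<lambda>(x, y). (y, x::real) :: real \<times> real)"
    by (rule lborel_pair.distr_pair_swap)
  also have "\<dots> = distr lborel borel prod.swap"
  proof (rule distr_cong)
    show "lborel \<Otimes>\<^sub>M lborel = (lborel :: (real \<times> real) measure)" by (rule lborel_prod)
    show "sets (lborel \<Otimes>\<^sub>M lborel) = sets (borel :: (real \<times> real) measure)"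
      unfolding lborel_prod by simp
  qed auto
  finally show ?thesis by (simp add: lborel_prod)
qed

lemma lborel_prod_swap:
  fixes F :: "real \<times> real \<Rightarrow> 'b::{banach, second_countable_topology}"
  assumes "F \<in> borel_measurable borel"
  shows "(LINT p|lborel. F (prod.swap p)) = (LINT p|lborel. F p)"
    and "integrable lborel (\<lambda>p. F (prod.swap p)) \<longleftrightarrow> integrable lborel F"
proof -
  have m: "prod.swap \<in> (lborel :: (real \<times> real) measure) \<rightarrow>\<^sub>M borel"
    by simp
  show "(LINT p|lborel. F (prod.swap p)) = (LINT p|lborel. F p)"
    using integral_distr[OF m assms] by (simp add: lborel_prod_distr_swap)
  show "integrable lborel (\<lambda>p. F (prod.swap p)) \<longleftrightarrow> integrable lborel F"
    using integrable_distr_eq[OF m assms] by (simp add: lborel_prod_distr_swap)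
qed

text \<open>Condition \<open>(*)\<close> on the whole plane, for functions on pairs of reals, where iterated integration is
most convenient. The derivatives are carried as Borel functions \<open>fx\<close>, \<open>fy\<close> on the whole plane, to
which Fubini's theorem applies.\<close>

locale continuous_with_partials =
  fixes f fx fy :: "real \<times> real \<Rightarrow> complex" and Z :: "(real \<times> real) set"
  assumes f_cont: "continuous_on UNIV f" and Z: "countable Z"
    and fx: "\<And>x y. (x, y) \<notin> Z \<Longrightarrow> ((\<lambda>t. f (t, y)) has_vector_derivative fx (x, y)) (at x)"
    and fy: "\<And>x y. (x, y) \<notin> Z \<Longrightarrow> ((\<lambda>t. f (x, t)) has_vector_derivative fy (x, y)) (at y)"
    and fx_m[measurable]: "fx \<in> borel_measurable borel"
    and fy_m[measurable]: "fy \<in> borel_measurable borel"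
begin

lemma f_m[measurable]: "f \<in> borel_measurable borel"
  by (rule borel_measurable_continuous_onI[OF f_cont])

lemma swapped: "continuous_with_partials (f \<circ> prod.swap) (fy \<circ> prod.swap) (fx \<circ> prod.swap) (prod.swap ` Z)"
proof
  have "continuous_on UNIV (prod.swap :: real \<times> real \<Rightarrow> _)"
    by (intro continuous_intros)
  then show "continuous_on UNIV (f \<circ> prod.swap)"
    by (rule continuous_on_compose) (rule continuous_on_subset[OF f_cont], simp)
  fix x y assume "(x, y) \<notin> prod.swap ` Z"
  then have "(y, x) \<notin> Z" by (force simp: image_iff)
  then show "((\<lambda>t. (f \<circ> prod.swap) (t, y)) has_vector_derivative (fy \<circ> prod.swap) (x, y)) (at x)"
    "((\<lambda>t. (f \<circ> prod.swap) (x, t)) has_vector_derivative (fx \<circ> prod.swap) (x, y)) (at y)"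
    using fx fy by auto
qed (use Z in \<open>auto intro!: measurable_comp[OF borel_measurable_swap]\<close>)

lemma f_cont_comp: "continuous_on S g \<Longrightarrow> continuous_on S (\<lambda>x. f (g x))"
  using continuous_on_compose2[OF f_cont] by auto

lemma set_integrable_fy:
  assumes W: "closed W" "W \<subseteq> {a1..b1} \<times> {a2..b2}" and \<rho>: "\<rho> > 0"
    and lipy: "\<And>x y h. (x, y) \<in> W \<Longrightarrow> \<bar>h\<bar> \<le> \<rho> \<Longrightarrow> norm (f (x, y + h) - f (x, y)) \<le> N * \<bar>h\<bar>"
  shows "set_integrable lborel W fy"
proof -
  have [measurable]: "W \<in> sets borel" using W by simp
  define Q where "Q = {a1..b1} \<times> {a2..b2}"
  have Qcb: "Q = cbox (a1, a2) (b1, b2)" by (auto simp: Q_def)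
  have [measurable]: "Q \<in> sets borel" by (simp add: Qcb)
  have fin: "emeasure lborel Q < \<infinity>" unfolding Qcb by (rule emeasure_lborel_cbox_finite)
  have fyN: "norm (fy (x, y)) \<le> N" if "(x, y) \<in> W" "(x, y) \<notin> Z" for x y
    by (rule norm_vector_derivative_le[OF fy[OF that(2)] \<rho>]) (rule lipy[OF that(1)])
  have AE: "AE p in lborel. p \<notin> Z"
    using countable_imp_null_set_lborel[OF Z] by (rule AE_not_in)
  show ?thesis
    unfolding set_integrable_def
  proof (rule Bochner_Integration.integrable_bound)
    show "integrable lborel (\<lambda>p. indicator Q p *\<^sub>R N)"
      using fin by simp
    show "AE p in lborel. norm (indicator W p *\<^sub>R fy p) \<le> norm (indicator Q p *\<^sub>R N)"
      using AE
    proof eventually_elim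
      case (elim p)
      then show ?case using fyN[of "fst p" "snd p"] W(2) by (auto simp: indicator_def Q_def)
    qed
  qed measurable
qed

text \<open>The vertical increments of \<open>f\<close> across a rectangle, compared with the integral of \<open>fy\<close> over a
closed set \<open>W\<close> on which difference quotients are bounded. On a vertical line that meets \<open>W\<close> the
difference is bounded by the length of the line outside \<open>W\<close>. A line that misses \<open>W\<close> lies outside
\<open>W\<close> entirely; there the increment is compared, along the horizontal sides and one vertical
segment, with points of \<open>W\<close> on the bottom and on the top side. This is the point at which the
rectangle must be spanned by \<open>W\<close> and the ratio \<open>\<kappa>\<close> of its sides enters.\<close>

lemma vertical_increment:
  assumes W: "closed W" "W \<subseteq> {\<alpha>1..\<beta>1} \<times> {\<alpha>2..\<beta>2}"
    and sub: "a1 \<le> \<alpha>1" "\<beta>1 \<le> b1" "a2 \<le> \<alpha>2" "\<beta>2 \<le> b2"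
    and bottom: "(x1, \<alpha>2) \<in> W" and top: "(x2, \<beta>2) \<in> W"
    and lipx: "\<And>x y h. (x, y) \<in> W \<Longrightarrow> \<bar>h\<bar> \<le> \<rho> \<Longrightarrow> norm (f (x + h, y) - f (x, y)) \<le> N * \<bar>h\<bar>"
    and lipy: "\<And>x y h. (x, y) \<in> W \<Longrightarrow> \<bar>h\<bar> \<le> \<rho> \<Longrightarrow> norm (f (x, y + h) - f (x, y)) \<le> N * \<bar>h\<bar>"
    and \<rho>: "\<rho> > 0" "b1 - a1 \<le> \<rho>" "b2 - a2 \<le> \<rho>" and \<kappa>: "b1 - a1 \<le> \<kappa> * (b2 - a2)" "\<kappa> \<ge> 0" and N: "N \<ge> 0"
  shows "norm ((LINT x:{\<alpha>1..\<beta>1}|lborel. f (x, \<beta>2) - f (x, \<alpha>2)) - (LINT p:W|lborel. fy p))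
     \<le> (3 * \<kappa> + 1) * N * measure lborel ({a1..b1} \<times> {a2..b2} - W)"
proof -
  have ends: "\<alpha>1 \<le> x1" "x1 \<le> \<beta>1" "\<alpha>1 \<le> x2" "x2 \<le> \<beta>1" "\<alpha>2 \<le> \<beta>2"
    using W(2) bottom top by auto
  define C where "C = (3 * \<kappa> + 1) * N"
  have C: "C \<ge> N" "C \<ge> 0" using \<kappa> N by (auto simp: C_def algebra_simps)
  have [measurable]: "W \<in> sets borel" using W by simp
  define sl where "sl x = {y. (x, y) \<in> W}" for x
  define Q where "Q = {a1..b1} \<times> {a2..b2}"
  have Qcb: "Q = cbox (a1, a2) (b1, b2)" by (auto simp: Q_def)
  have [measurable]: "Q \<in> sets borel" by (simp add: Qcb)
  have WQ: "W \<subseteq> Q" using W(2) sub by (force simp: Q_def)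
  have fin: "emeasure lborel Q < \<infinity>" unfolding Qcb by (rule emeasure_lborel_cbox_finite)
  have sl_closed: "closed (sl x)" for x
  proof -
    have "closed ((\<lambda>y. (x, y)) -` W)"
      by (rule closed_vimage[OF W(1)]) (intro continuous_intros)
    then show ?thesis by (simp add: sl_def vimage_def)
  qed
  have fyN: "norm (fy (x, y)) \<le> N" if "(x, y) \<in> W" "(x, y) \<notin> Z" for x y
    by (rule norm_vector_derivative_le[OF fy[OF that(2)] \<rho>(1)]) (rule lipy[OF that(1)])
  define D where "D x = f (x, \<beta>2) - f (x, \<alpha>2) - (LINT y:sl x|lborel. fy (x, y))" for x
  define M where "M x = measure lborel ({a2..b2} - sl x)" for x
  have D_le: "norm (D x) \<le> C * M x" if x: "x \<in> {\<alpha>1..\<beta>1}" for x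
  proof (cases "sl x = {}")
    case False
    have "norm (f (x, \<beta>2) - f (x, \<alpha>2) - (LINT y:sl x|lborel. fy (x, y)))
          \<le> N * measure lborel ({\<alpha>2..\<beta>2} - sl x)"
    proof (rule increment_across_closed_set[where S = "{y. (x, y) \<in> Z}"])
      show "countable {y. (x, y) \<in> Z}"
        by (rule countable_subset[OF _ countable_image[OF Z, of snd]]) force
      show "sl x \<subseteq> {\<alpha>2..\<beta>2}" using W(2) by (auto simp: sl_def)
      show "continuous_on {\<alpha>2..\<beta>2} (\<lambda>y. f (x, y))"
        by (intro f_cont_comp continuous_intros)
      show "norm (f (x, y) - f (x, t)) \<le> N * \<bar>y - t\<bar>" if "t \<in> sl x" "y \<in> {\<alpha>2..\<beta>2}" for t y
      proof -
        have "t \<in> {\<alpha>2..\<beta>2}" using that W(2) by (auto simp: sl_def)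
        then show ?thesis
          using lipy[of x t "y - t"] that \<rho> sub by (auto simp: sl_def)
      qed
      show "(\<lambda>y. fy (x, y)) \<in> borel_measurable borel" by measurable
    qed (use ends False sl_closed fy fyN N in \<open>auto simp: sl_def\<close>)
    also have "\<dots> \<le> C * M x"
      unfolding M_def using sub sl_closed[of x, THEN borel_closed] C
      by (intro mult_mono measure_mono_fmeasurable fmeasurable_Diff)
        (auto simp: fmeasurable_def emeasure_lborel_cbox_finite[of a2 b2, simplified])
    finally show ?thesis by (simp add: D_def)
  next
    case True
    \<comment> \<open>From \<open>(x, \<beta>2)\<close> to \<open>(x, \<alpha>2)\<close> by way of \<open>(x2, \<beta>2)\<close>, \<open>(x2, \<alpha>2)\<close> and \<open>(x1, \<alpha>2)\<close>: each step starts or ends in \<open>W\<close>.\<close>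
    have 1: "norm (f (x, \<beta>2) - f (x2, \<beta>2)) \<le> N * (b1 - a1)"
      using lipx[OF top, of "x - x2"] x ends sub \<rho> N mult_left_mono[of "\<bar>x - x2\<bar>" "b1 - a1" N] by fastforce
    have 2: "norm (f (x2, \<alpha>2) - f (x2, \<beta>2)) \<le> N * (b2 - a2)"
      using lipy[OF top, of "\<alpha>2 - \<beta>2"] x ends sub \<rho> N mult_left_mono[of "\<bar>\<alpha>2 - \<beta>2\<bar>" "b2 - a2" N] by fastforce
    have 3: "norm (f (x2, \<alpha>2) - f (x1, \<alpha>2)) \<le> N * (b1 - a1)"
      using lipx[OF bottom, of "x2 - x1"] x ends sub \<rho> N mult_left_mono[of "\<bar>x2 - x1\<bar>" "b1 - a1" N] by fastforce
    have 4: "norm (f (x, \<alpha>2) - f (x1, \<alpha>2)) \<le> N * (b1 - a1)"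
      using lipx[OF bottom, of "x - x1"] x ends sub \<rho> N mult_left_mono[of "\<bar>x - x1\<bar>" "b1 - a1" N] by fastforce
    have "norm (f (x, \<beta>2) - f (x, \<alpha>2)) = norm ((f (x, \<beta>2) - f (x2, \<beta>2)) - (f (x2, \<alpha>2) - f (x2, \<beta>2))
       + (f (x2, \<alpha>2) - f (x1, \<alpha>2)) - (f (x, \<alpha>2) - f (x1, \<alpha>2)))" by simp
    also have "\<dots> \<le> N * (b1 - a1) + N * (b2 - a2) + N * (b1 - a1) + N * (b1 - a1)"
    proof -
      have "norm (a - b + c - d) \<le> norm a + norm b + norm c + norm d" for a b c d :: complex by norm
      from order_trans[OF this] show ?thesis using 1 2 3 4 by (meson add_mono)
    qed
    also have "\<dots> = N * (3 * (b1 - a1) + (b2 - a2))" by algebra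
    also have "\<dots> \<le> N * (3 * (\<kappa> * (b2 - a2)) + (b2 - a2))"
      using \<kappa> N by (intro mult_left_mono) auto
    also have "\<dots> = C * M x"
      using True sub ends by (simp add: C_def M_def algebra_simps)
    finally show ?thesis using True by (simp add: D_def set_lebesgue_integral_def)
  qed
  have W_int: "set_integrable lborel W fy"
    by (rule set_integrable_fy[OF W(1) WQ[unfolded Q_def] \<rho>(1) lipy])
  have slice: "indicator W (x, y) = (indicator (sl x) y :: real)" for x y
    by (simp add: indicator_def sl_def)
  have A: "(LINT p:W|lborel. fy p) = (LINT x|lborel. (LINT y:sl x|lborel. fy (x, y)))"
    and A_int: "integrable lborel (\<lambda>x. LINT y:sl x|lborel. fy (x, y))"
    using lborel_prod_Fubini(1,2)[OF W_int[unfolded set_integrable_def]]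
    by (simp_all add: set_lebesgue_integral_def slice)
  have B: "(LINT x|lborel. (LINT y:sl x|lborel. fy (x, y))) = (LINT x:{\<alpha>1..\<beta>1}|lborel. (LINT y:sl x|lborel. fy (x, y)))"
    unfolding set_lebesgue_integral_def[of lborel "{\<alpha>1..\<beta>1}"]
  proof (rule Bochner_Integration.integral_cong[OF refl])
    fix x
    have "sl x = {}" if "x \<notin> {\<alpha>1..\<beta>1}" using that W(2) by (auto simp: sl_def)
    then show "(LINT y:sl x|lborel. fy (x, y)) = indicator {\<alpha>1..\<beta>1} x *\<^sub>R (LINT y:sl x|lborel. fy (x, y))"
      by (cases "x \<in> {\<alpha>1..\<beta>1}") (auto simp: set_lebesgue_integral_def)
  qed
  have f_int: "set_integrable lborel {\<alpha>1..\<beta>1} (\<lambda>x. f (x, \<beta>2) - f (x, \<alpha>2))"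
    by (intro borel_integrable_atLeastAtMost' f_cont_comp continuous_intros)
  have A_int': "set_integrable lborel {\<alpha>1..\<beta>1} (\<lambda>x. LINT y:sl x|lborel. fy (x, y))"
    unfolding set_integrable_def by (intro integrable_mult_indicator A_int) simp
  have eq: "(LINT x:{\<alpha>1..\<beta>1}|lborel. f (x, \<beta>2) - f (x, \<alpha>2)) - (LINT p:W|lborel. fy p) = (LINT x:{\<alpha>1..\<beta>1}|lborel. D x)"
    unfolding A B D_def by (rule set_integral_diff(2)[OF f_int A_int', symmetric])
  have finD: "emeasure lborel (Q - W) < \<infinity>"
    using fin emeasure_mono[of "Q - W" Q lborel] by (auto simp: less_top intro: le_less_trans)
  have QW: "integrable lborel (\<lambda>p. indicator (Q - W) p :: real)"
    using finD by simp
  have QW_slice: "(LINT y|lborel. indicator (Q - W) (x, y)) = indicator {a1..b1} x * M x" for x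
  proof -
    have [measurable]: "sl x \<in> sets borel" using sl_closed[of x] by simp
    have "(\<lambda>y. indicator (Q - W) (x, y)) = (\<lambda>y. indicator {a1..b1} x * indicator ({a2..b2} - sl x) y :: real)"
      by (auto simp: indicator_def Q_def sl_def fun_eq_iff)
    then show ?thesis by (simp add: M_def)
  qed
  have M: "measure lborel (Q - W) = (LINT x|lborel. indicator {a1..b1} x * M x)"
    and M_int: "integrable lborel (\<lambda>x. indicator {a1..b1} x * M x)"
    using lborel_prod_Fubini(1,2)[OF QW] finD by (simp_all add: QW_slice)
  have "norm (LINT x:{\<alpha>1..\<beta>1}|lborel. D x) \<le> (LINT x|lborel. C * (indicator {a1..b1} x * M x))"
    unfolding set_lebesgue_integral_def
  proof (rule Bochner_Integration.integral_norm_bound_integral)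
    show "integrable lborel (\<lambda>x. indicator {\<alpha>1..\<beta>1} x *\<^sub>R D x)"
      using set_integral_diff(1)[OF f_int A_int'] by (simp add: D_def set_integrable_def)
    show "integrable lborel (\<lambda>x. C * (indicator {a1..b1} x * M x))"
      by (intro integrable_mult_right M_int)
    show "norm (indicator {\<alpha>1..\<beta>1} x *\<^sub>R D x) \<le> C * (indicator {a1..b1} x * M x)" for x
      using D_le[of x] sub C by (auto simp: indicator_def M_def)
  qed
  also have "\<dots> = C * measure lborel (Q - W)" by (simp add: M)
  finally show ?thesis unfolding eq C_def Q_def .
qed

end

section \<open>Integrals over rectangles and their subdivision\<close>

abbreviation rect :: "real \<Rightarrow> real \<Rightarrow> real \<Rightarrow> real \<Rightarrow> (real \<times> real) set" where
  "rect a1 b1 a2 b2 \<equiv> {a1..b1} \<times> {a2..b2}"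

lemma rect_eq_cbox: "rect a1 b1 a2 b2 = cbox (a1, a2) (b1, b2)"
  by auto

lemma rect_borel[measurable]: "rect a1 b1 a2 b2 \<in> sets borel"
  unfolding rect_eq_cbox by simp

lemma emeasure_rect_finite: "emeasure lborel (rect a1 b1 a2 b2) < \<infinity>"
  unfolding rect_eq_cbox by (rule emeasure_lborel_cbox_finite)

lemma AE_lborel_fst_neq: "AE p in lborel. fst (p :: real \<times> real) \<noteq> c"
  and AE_lborel_snd_neq: "AE p in lborel. snd (p :: real \<times> real) \<noteq> c"
proof -
  have null: "{p. p \<bullet> k = c} \<in> null_sets lborel" if "k \<in> Basis" for k :: "real \<times> real"
    using negligible_standard_hyperplane[OF that, of c]
    by (simp add: negligible_iff_null_sets null_sets_completion_iff)
  show "AE p in lborel. fst (p :: real \<times> real) \<noteq> c"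
    using AE_not_in[OF null[of "(1, 0)"]] by (simp add: Basis_prod_def inner_prod_def)
  show "AE p in lborel. snd (p :: real \<times> real) \<noteq> c"
    using AE_not_in[OF null[of "(0, 1)"]] by (simp add: Basis_prod_def inner_prod_def)
qed

lemma rect_integral_split:
  fixes g :: "real \<times> real \<Rightarrow> 'b::{banach, second_countable_topology}"
  assumes g: "integrable lborel g"
  shows "a1 \<le> c \<Longrightarrow> c \<le> b1 \<Longrightarrow>
     (LINT p:rect a1 b1 a2 b2|lborel. g p) = (LINT p:rect a1 c a2 b2|lborel. g p) + (LINT p:rect c b1 a2 b2|lborel. g p)"
   and "a2 \<le> c \<Longrightarrow> c \<le> b2 \<Longrightarrow>
     (LINT p:rect a1 b1 a2 b2|lborel. g p) = (LINT p:rect a1 b1 a2 c|lborel. g p) + (LINT p:rect a1 b1 c b2|lborel. g p)"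
proof -
  have I: "set_integrable lborel (rect a b c d) g" for a b c d
    unfolding set_integrable_def by (intro integrable_mult_indicator g) simp
  show "(LINT p:rect a1 b1 a2 b2|lborel. g p) = (LINT p:rect a1 c a2 b2|lborel. g p) + (LINT p:rect c b1 a2 b2|lborel. g p)"
    if "a1 \<le> c" "c \<le> b1"
  proof -
    have "AE p in lborel. \<not> (p \<in> rect a1 c a2 b2 \<and> p \<in> rect c b1 a2 b2)"
      using AE_lborel_fst_neq[of c] by eventually_elim auto
    moreover have "rect a1 b1 a2 b2 = rect a1 c a2 b2 \<union> rect c b1 a2 b2" using that by auto
    ultimately show ?thesis using set_integral_Un_AE[OF _ _ _ I I] by simp
  qed
  show "(LINT p:rect a1 b1 a2 b2|lborel. g p) = (LINT p:rect a1 b1 a2 c|lborel. g p) + (LINT p:rect a1 b1 c b2|lborel. g p)"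
    if "a2 \<le> c" "c \<le> b2"
  proof -
    have "AE p in lborel. \<not> (p \<in> rect a1 b1 a2 c \<and> p \<in> rect a1 b1 c b2)"
      using AE_lborel_snd_neq[of c] by eventually_elim auto
    moreover have "rect a1 b1 a2 b2 = rect a1 b1 a2 c \<union> rect a1 b1 c b2" using that by auto
    ultimately show ?thesis using set_integral_Un_AE[OF _ _ _ I I] by simp
  qed
qed

lemma interval_integral_split:
  fixes g :: "real \<Rightarrow> complex"
  assumes g: "continuous_on UNIV g" and "a \<le> c" "c \<le> b"
  shows "(LINT x:{a..b}|lborel. g x) = (LINT x:{a..c}|lborel. g x) + (LINT x:{c..b}|lborel. g x)"
proof -
  have I: "set_integrable lborel {a..b} g" for a b
    by (intro borel_integrable_atLeastAtMost' continuous_on_subset[OF g]) simp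
  have "AE x in lborel. \<not> (x \<in> {a..c} \<and> x \<in> {c..b})"
    using AE_lborel_singleton[of c] by eventually_elim auto
  moreover have "{a..b} = {a..c} \<union> {c..b}" using assms by auto
  ultimately show ?thesis using set_integral_Un_AE[OF _ _ _ I I] by simp
qed

text \<open>Up to the factor \<open>\<i>\<close> this is the integral of \<open>f dz\<close> along the positively oriented boundary.\<close>

definition edge_sum :: "(real \<times> real \<Rightarrow> complex) \<Rightarrow> real \<Rightarrow> real \<Rightarrow> real \<Rightarrow> real \<Rightarrow> complex" where
  "edge_sum f a1 b1 a2 b2 = (LINT y:{a2..b2}|lborel. f (b1, y) - f (a1, y))
     + \<i> * (LINT x:{a1..b1}|lborel. f (x, b2) - f (x, a2))"

lemma edge_sum_split:
  assumes f: "continuous_on UNIV f"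
  shows "a1 \<le> c \<Longrightarrow> c \<le> b1 \<Longrightarrow> edge_sum f a1 b1 a2 b2 = edge_sum f a1 c a2 b2 + edge_sum f c b1 a2 b2"
    and "a2 \<le> c \<Longrightarrow> c \<le> b2 \<Longrightarrow> edge_sum f a1 b1 a2 b2 = edge_sum f a1 b1 a2 c + edge_sum f a1 b1 c b2"
proof -
  have c: "continuous_on S (\<lambda>x. f (x, y))" "continuous_on S (\<lambda>y. f (x, y))" for S x y
    by (auto intro!: continuous_on_compose2[OF f] continuous_intros)
  have I: "set_integrable lborel {a..b} (\<lambda>y. f (u, y) - f (v, y))" 
          "set_integrable lborel {a..b} (\<lambda>x. f (x, u) - f (x, v))" for a b u v
    by (intro borel_integrable_atLeastAtMost' continuous_intros c)+
  have 1: "(LINT y:{a2..b2}|lborel. f (b1, y) - f (a1, y)) =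
      (LINT y:{a2..b2}|lborel. f (c, y) - f (a1, y)) + (LINT y:{a2..b2}|lborel. f (b1, y) - f (c, y))" for c
    by (subst set_integral_add(2)[symmetric, OF I(1) I(1)]) simp
  have 2: "(LINT x:{a1..b1}|lborel. f (x, b2) - f (x, a2)) =
      (LINT x:{a1..b1}|lborel. f (x, c) - f (x, a2)) + (LINT x:{a1..b1}|lborel. f (x, b2) - f (x, c))" for c
    by (subst set_integral_add(2)[symmetric, OF I(2) I(2)]) simp
  show "edge_sum f a1 b1 a2 b2 = edge_sum f a1 c a2 b2 + edge_sum f c b1 a2 b2" if "a1 \<le> c" "c \<le> b1"
    unfolding edge_sum_def 1[of c]
    by (subst interval_integral_split[OF _ that]) (auto intro!: continuous_intros c simp: algebra_simps)
  show "edge_sum f a1 b1 a2 b2 = edge_sum f a1 b1 a2 c + edge_sum f a1 b1 c b2" if "a2 \<le> c" "c \<le> b2"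
    unfolding edge_sum_def 2[of c]
    by (subst interval_integral_split[OF _ that]) (auto intro!: continuous_intros c simp: algebra_simps)
qed

text \<open>Bisecting both sides preserves the ratio of the sides, so a bound for additive rectangle functions
has to be verified only on small rectangles of one shape.\<close>

lemma dyadic_subdivision:
  fixes E :: "real \<Rightarrow> real \<Rightarrow> real \<Rightarrow> real \<Rightarrow> complex" and H :: "real \<Rightarrow> real \<Rightarrow> real \<Rightarrow> real \<Rightarrow> real"
  assumes E1: "\<And>a1 c b1 a2 b2. a1 \<le> c \<Longrightarrow> c \<le> b1 \<Longrightarrow> E a1 b1 a2 b2 = E a1 c a2 b2 + E c b1 a2 b2"
    and E2: "\<And>a1 b1 a2 c b2. a2 \<le> c \<Longrightarrow> c \<le> b2 \<Longrightarrow> E a1 b1 a2 b2 = E a1 b1 a2 c + E a1 b1 c b2"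
    and H1: "\<And>a1 c b1 a2 b2. a1 \<le> c \<Longrightarrow> c \<le> b1 \<Longrightarrow> H a1 b1 a2 b2 = H a1 c a2 b2 + H c b1 a2 b2"
    and H2: "\<And>a1 b1 a2 c b2. a2 \<le> c \<Longrightarrow> c \<le> b2 \<Longrightarrow> H a1 b1 a2 b2 = H a1 b1 a2 c + H a1 b1 c b2"
    and "w \<ge> 0" "h \<ge> 0"
    and "\<And>c1 c2. a1 \<le> c1 \<Longrightarrow> c1 + w/2^m \<le> a1 + w \<Longrightarrow> a2 \<le> c2 \<Longrightarrow> c2 + h/2^m \<le> a2 + h \<Longrightarrow>
        norm (E c1 (c1 + w/2^m) c2 (c2 + h/2^m)) \<le> H c1 (c1 + w/2^m) c2 (c2 + h/2^m)"
  shows "norm (E a1 (a1 + w) a2 (a2 + h)) \<le> H a1 (a1 + w) a2 (a2 + h)"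
  using assms(5-)
proof (induction m arbitrary: a1 w a2 h)
  case 0
  then show ?case by simp
next
  case (Suc m)
  have quarter: "norm (E c1 (c1 + w/2) c2 (c2 + h/2)) \<le> H c1 (c1 + w/2) c2 (c2 + h/2)"
    if "a1 \<le> c1" "c1 + w/2 \<le> a1 + w" "a2 \<le> c2" "c2 + h/2 \<le> a2 + h" for c1 c2
  proof (rule Suc.IH)
    fix d1 d2 assume "c1 \<le> d1" "d1 + w/2/2^m \<le> c1 + w/2" "c2 \<le> d2" "d2 + h/2/2^m \<le> c2 + h/2"
    then show "norm (E d1 (d1 + w/2/2^m) d2 (d2 + h/2/2^m)) \<le> H d1 (d1 + w/2/2^m) d2 (d2 + h/2/2^m)"
    proof -
      have eq: "w/2/2^m = w/2^Suc m" "h/2/2^m = h/2^Suc m" by simp_all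
      show ?thesis if "c1 \<le> d1" "d1 + w/2/2^m \<le> c1 + w/2" "c2 \<le> d2" "d2 + h/2/2^m \<le> c2 + h/2"
        using that \<open>a1 \<le> c1\<close> \<open>c1 + w/2 \<le> a1 + w\<close> \<open>a2 \<le> c2\<close> \<open>c2 + h/2 \<le> a2 + h\<close>
        unfolding eq by (intro Suc.prems(3)) linarith+
    qed
  qed (use Suc.prems in auto)
  have eq: "a1 + w/2 + w/2 = a1 + w" "a2 + h/2 + h/2 = a2 + h" by simp_all
  have split: "F a1 (a1 + w) a2 (a2 + h) = (F a1 (a1 + w/2) a2 (a2 + h/2) + F a1 (a1 + w/2) (a2 + h/2) (a2 + h))
     + (F (a1 + w/2) (a1 + w) a2 (a2 + h/2) + F (a1 + w/2) (a1 + w) (a2 + h/2) (a2 + h))"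
    if "\<And>a1 c b1 a2 b2. a1 \<le> c \<Longrightarrow> c \<le> b1 \<Longrightarrow> F a1 b1 a2 b2 = F a1 c a2 b2 + F c b1 a2 b2"
       "\<And>a1 b1 a2 c b2. a2 \<le> c \<Longrightarrow> c \<le> b2 \<Longrightarrow> F a1 b1 a2 b2 = F a1 b1 a2 c + F a1 b1 c b2"
    for F :: "real \<Rightarrow> real \<Rightarrow> real \<Rightarrow> real \<Rightarrow> 'c::ab_group_add"
    using that(1)[of a1 "a1 + w/2" "a1 + w" a2 "a2 + h"]
      that(2)[of a2 "a2 + h/2" "a2 + h" a1 "a1 + w/2"] that(2)[of a2 "a2 + h/2" "a2 + h" "a1 + w/2" "a1 + w"] Suc.prems(1,2)
    by simp
  let ?w = "a1 + w/2" and ?h = "a2 + h/2"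
  have "norm (E a1 (a1 + w) a2 (a2 + h)) = norm ((E a1 ?w a2 ?h + E a1 ?w ?h (a2 + h)) + (E ?w (a1 + w) a2 ?h + E ?w (a1 + w) ?h (a2 + h)))"
    by (rule arg_cong[where f=norm], rule split) (fact E1, fact E2)
  also have "\<dots> \<le> (norm (E a1 ?w a2 ?h) + norm (E a1 ?w ?h (a2 + h))) + (norm (E ?w (a1 + w) a2 ?h) + norm (E ?w (a1 + w) ?h (a2 + h)))"
    by (intro order_trans[OF norm_triangle_ineq] add_mono norm_triangle_ineq)
  also have "\<dots> \<le> (H a1 ?w a2 ?h + H a1 ?w ?h (a2 + h)) + (H ?w (a1 + w) a2 ?h + H ?w (a1 + w) ?h (a2 + h))"
    using quarter[of a1 a2] quarter[of ?w a2] quarter[of a1 ?h] quarter[of ?w ?h] Suc.prems(1,2)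
    unfolding eq by (intro add_mono) auto
  also have "\<dots> = H a1 (a1 + w) a2 (a2 + h)"
    by (rule sym, rule split) (fact H1, fact H2)
  finally show ?case .
qed

lemma tendsto_interval_integral:
  fixes F :: "real \<times> real \<Rightarrow> complex"
  assumes F: "continuous_on UNIV F" and c: "c \<longlonglongrightarrow> c0" and e: "e \<longlonglongrightarrow> 0" "\<And>n. e n \<ge> 0"
  shows "(\<lambda>n. LINT y:{a + e n..b - e n}|lborel. F (c n, y)) \<longlonglongrightarrow> (LINT y:{a..b}|lborel. F (c0, y))"
proof -
  have [measurable]: "F \<in> borel_measurable borel" by (rule borel_measurable_continuous_onI[OF F])
  obtain M where M: "\<And>n. \<bar>c n\<bar> \<le> M"
    using Bseq_def[of c] convergent_imp_Bseq[of c] c unfolding convergent_def by auto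
  have "compact (F ` ({-M..M} \<times> {a..b}))"
    by (intro compact_continuous_image continuous_on_subset[OF F] compact_Times) auto
  then obtain B where B: "\<And>x y. \<bar>x\<bar> \<le> M \<Longrightarrow> y \<in> {a..b} \<Longrightarrow> norm (F (x, y)) \<le> B"
  proof -
    obtain B where "\<forall>z\<in>F ` ({-M..M} \<times> {a..b}). norm z \<le> B"
      using \<open>compact _\<close> compact_imp_bounded bounded_iff by blast
    then show ?thesis by (intro that[of B]) (force simp: abs_le_iff)
  qed
  show ?thesis
    unfolding set_lebesgue_integral_def
  proof (rule integral_dominated_convergence[where w="\<lambda>y. indicator {a..b} y * B"])
    show "AE y in lborel. (\<lambda>n. indicator {a + e n..b - e n} y *\<^sub>R F (c n, y)) \<longlonglongrightarrow> indicator {a..b} y *\<^sub>R F (c0, y)"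
      using AE_lborel_singleton[of a] AE_lborel_singleton[of b]
    proof eventually_elim
      case (elim y)
      have "(\<lambda>n. F (c n, y)) \<longlonglongrightarrow> F (c0, y)"
        using F c by (intro continuous_on_tendsto_compose[OF F] tendsto_Pair tendsto_const) auto
      moreover have "(\<lambda>n. indicator {a + e n..b - e n} y) \<longlonglongrightarrow> (indicator {a..b} y :: real)"
      proof (cases "y \<in> {a<..<b}")
        case True
        then have "\<forall>\<^sub>F n in sequentially. e n < y - a" "\<forall>\<^sub>F n in sequentially. e n < b - y"
          using order_tendstoD(2)[OF e(1)] by auto
        then have "\<forall>\<^sub>F n in sequentially. indicator {a + e n..b - e n} y = (indicator {a..b} y :: real)"
          by eventually_elim (use True in \<open>auto simp: indicator_def\<close>)
        then show ?thesis by (rule tendsto_eventually)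
      next
        case False
        then have "y \<notin> {a..b}" using elim by auto
        then have "indicator {a + e n..b - e n} y = (0::real)" for n
          using e(2)[of n] by (auto simp: indicator_def)
        then show ?thesis using \<open>y \<notin> {a..b}\<close> by simp
      qed
      ultimately show ?case by (intro tendsto_scaleR)
    qed
    show "AE y in lborel. norm (indicator {a + e n..b - e n} y *\<^sub>R F (c n, y)) \<le> indicator {a..b} y * B" for n
    proof (rule AE_I2)
      fix y
      have "B \<ge> 0" if "y \<in> {a..b}" using B[OF M[of n] that] norm_ge_zero order_trans by blast
      then show "norm (indicator {a + e n..b - e n} y *\<^sub>R F (c n, y)) \<le> indicator {a..b} y * B"
        using B[OF M[of n], of y] e(2)[of n] by (auto simp: indicator_def)
    qed
  qed (use emeasure_lborel_cbox_finite[of a b] in \<open>auto intro!: integrable_mult_left integrable_real_indicator\<close>)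
qed

lemma tendsto_rect_integral:
  fixes g :: "real \<times> real \<Rightarrow> complex"
  assumes g: "integrable lborel g" and e: "e \<longlonglongrightarrow> 0" "\<And>n. e n \<ge> 0"
  shows "(\<lambda>n. LINT p:rect (a1 + e n) (b1 - e n) (a2 + e n) (b2 - e n)|lborel. g p) \<longlonglongrightarrow> (LINT p:rect a1 b1 a2 b2|lborel. g p)"
  unfolding set_lebesgue_integral_def
proof (rule integral_dominated_convergence[where w="\<lambda>p. norm (g p)"])
  have [measurable]: "g \<in> borel_measurable borel" using borel_measurable_integrable[OF g] by simp
  show "(\<lambda>p. indicator (rect a1 b1 a2 b2) p *\<^sub>R g p) \<in> borel_measurable lborel" by measurable
  show "(\<lambda>p. indicator (rect (a1 + e n) (b1 - e n) (a2 + e n) (b2 - e n)) p *\<^sub>R g p) \<in> borel_measurable lborel" for n by measurable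
  show "AE p in lborel. (\<lambda>n. indicator (rect (a1 + e n) (b1 - e n) (a2 + e n) (b2 - e n)) p *\<^sub>R g p) \<longlonglongrightarrow> indicator (rect a1 b1 a2 b2) p *\<^sub>R g p"
    using AE_lborel_fst_neq[of a1] AE_lborel_fst_neq[of b1] AE_lborel_snd_neq[of a2] AE_lborel_snd_neq[of b2]
  proof eventually_elim
    case (elim p)
    obtain x y where p: "p = (x, y)" by (cases p)
    have "(\<lambda>n. indicator (rect (a1 + e n) (b1 - e n) (a2 + e n) (b2 - e n)) p) \<longlonglongrightarrow> (indicator (rect a1 b1 a2 b2) p :: real)"
    proof (cases "p \<in> {a1<..<b1} \<times> {a2<..<b2}")
      case True
      then have "\<forall>\<^sub>F n in sequentially. e n < x - a1" "\<forall>\<^sub>F n in sequentially. e n < b1 - x"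
         "\<forall>\<^sub>F n in sequentially. e n < y - a2" "\<forall>\<^sub>F n in sequentially. e n < b2 - y"
        using order_tendstoD(2)[OF e(1)] p by auto
      then have "\<forall>\<^sub>F n in sequentially. indicator (rect (a1 + e n) (b1 - e n) (a2 + e n) (b2 - e n)) p = (indicator (rect a1 b1 a2 b2) p :: real)"
        by eventually_elim (use True p in \<open>auto simp: indicator_def\<close>)
      then show ?thesis by (rule tendsto_eventually)
    next
      case False
      then have "p \<notin> rect a1 b1 a2 b2" using elim p by auto
      then have "indicator (rect (a1 + e n) (b1 - e n) (a2 + e n) (b2 - e n)) p = (0::real)" for n
        using e(2)[of n] p by (auto simp: indicator_def)
      then show ?thesis using \<open>p \<notin> rect a1 b1 a2 b2\<close> by simp
    qed
    then show ?case by (intro tendsto_scaleR tendsto_const)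
  qed
  show "integrable lborel (\<lambda>p. norm (g p))" using g by simp
qed (auto simp: indicator_def)

section \<open>Green's formula under the hypotheses of Looman and Menchoff\<close>

lemma mem_swap_image: "(x, y) \<in> prod.swap ` W \<longleftrightarrow> (y, x) \<in> W"
  by force

lemma measure_lborel_swap:
  assumes [measurable]: "A \<in> sets (borel :: (real \<times> real) measure)"
  shows "measure lborel (prod.swap ` A) = measure lborel A"
proof -
  have "prod.swap ` A = prod.swap -` A \<inter> space lborel" by (force simp: image_iff)
  then have "measure lborel (prod.swap ` A) = measure (distr lborel borel prod.swap) A"
    by (simp add: measure_distr)
  then show ?thesis by (simp add: lborel_prod_distr_swap)
qed

lemma set_integral_swap_image:
  fixes g :: "real \<times> real \<Rightarrow> complex"
  assumes [measurable]: "g \<in> borel_measurable borel" "W \<in> sets borel"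
  shows "(LINT p:prod.swap ` W|lborel. (g \<circ> prod.swap) p) = (LINT p:W|lborel. g p)"
    and "set_integrable lborel (prod.swap ` W) (g \<circ> prod.swap) \<longleftrightarrow> set_integrable lborel W g"
proof -
  have ind: "indicator (prod.swap ` W) p *\<^sub>R (g \<circ> prod.swap) p = (\<lambda>q. indicator W q *\<^sub>R g q) (prod.swap p)" for p
    by (cases p) (simp add: indicator_def mem_swap_image)
  show "(LINT p:prod.swap ` W|lborel. (g \<circ> prod.swap) p) = (LINT p:W|lborel. g p)"
    unfolding set_lebesgue_integral_def ind by (rule lborel_prod_swap(1)) measurable
  show "set_integrable lborel (prod.swap ` W) (g \<circ> prod.swap) \<longleftrightarrow> set_integrable lborel W g"
    unfolding set_integrable_def ind by (rule lborel_prod_swap(2)) measurable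
qed

lemma closed_swap_image:
  assumes "closed W"
  shows "closed (prod.swap ` (W :: (real \<times> real) set))"
proof -
  have "closed (prod.swap -` W)" by (rule closed_vimage[OF assms]) (intro continuous_intros)
  moreover have "prod.swap ` W = prod.swap -` W" by (force simp: image_iff)
  ultimately show ?thesis by simp
qed

lemma vector_derivative_imp_Lipschitz_at:
  fixes g :: "real \<Rightarrow> 'a::real_normed_vector"
  assumes "(g has_vector_derivative D) (at t)"
  obtains d where "d > 0" "\<And>h. \<bar>h\<bar> < d \<Longrightarrow> norm (g (t + h) - g t) \<le> (norm D + 1) * \<bar>h\<bar>"
proof -
  have "((\<lambda>h. norm ((g (t + h) - g t) /\<^sub>R h)) \<longlongrightarrow> norm D) (at 0)"
    by (intro tendsto_norm has_vector_derivative_quotient assms)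
  then have "\<forall>\<^sub>F h in at 0. norm ((g (t + h) - g t) /\<^sub>R h) < norm D + 1"
    by (rule order_tendstoD) simp
  then obtain d where d: "d > 0" "\<And>h. h \<noteq> 0 \<Longrightarrow> \<bar>h\<bar> < d \<Longrightarrow> norm ((g (t + h) - g t) /\<^sub>R h) < norm D + 1"
    unfolding eventually_at by auto
  show ?thesis
  proof (rule that[OF d(1)])
    fix h assume "\<bar>h\<bar> < d"
    then show "norm (g (t + h) - g t) \<le> (norm D + 1) * \<bar>h\<bar>"
      using d(2)[of h] by (cases "h = 0") (auto simp: divide_simps mult.commute)
  qed
qed

context continuous_with_partials
begin

lemma set_integrable_fx:
  assumes W: "closed W" "W \<subseteq> {a1..b1} \<times> {a2..b2}" and \<rho>: "\<rho> > 0"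
    and lipx: "\<And>x y h. (x, y) \<in> W \<Longrightarrow> \<bar>h\<bar> \<le> \<rho> \<Longrightarrow> norm (f (x + h, y) - f (x, y)) \<le> N * \<bar>h\<bar>"
  shows "set_integrable lborel W fx"
proof -
  interpret sw: continuous_with_partials "f \<circ> prod.swap" "fy \<circ> prod.swap" "fx \<circ> prod.swap" "prod.swap ` Z"
    by (rule swapped)
  have [measurable]: "W \<in> sets borel" using W by simp
  have "set_integrable lborel (prod.swap ` W) (fx \<circ> prod.swap)"
    by (rule sw.set_integrable_fy[OF closed_swap_image[OF W(1)] _ \<rho>, where N=N]) (use W lipx in \<open>auto simp: mem_swap_image\<close>)
  then show ?thesis by (subst (asm) set_integral_swap_image) auto
qed

lemma horizontal_increment:
  assumes W: "closed W" "W \<subseteq> {\<alpha>1..\<beta>1} \<times> {\<alpha>2..\<beta>2}"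
    and sub: "a1 \<le> \<alpha>1" "\<beta>1 \<le> b1" "a2 \<le> \<alpha>2" "\<beta>2 \<le> b2"
    and left: "(\<alpha>1, y1) \<in> W" and right: "(\<beta>1, y2) \<in> W"
    and lipx: "\<And>x y h. (x, y) \<in> W \<Longrightarrow> \<bar>h\<bar> \<le> \<rho> \<Longrightarrow> norm (f (x + h, y) - f (x, y)) \<le> N * \<bar>h\<bar>"
    and lipy: "\<And>x y h. (x, y) \<in> W \<Longrightarrow> \<bar>h\<bar> \<le> \<rho> \<Longrightarrow> norm (f (x, y + h) - f (x, y)) \<le> N * \<bar>h\<bar>"
    and \<rho>: "\<rho> > 0" "b1 - a1 \<le> \<rho>" "b2 - a2 \<le> \<rho>" and \<kappa>: "b2 - a2 \<le> \<kappa> * (b1 - a1)" "\<kappa> \<ge> 0" and N: "N \<ge> 0"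
  shows "norm ((LINT y:{\<alpha>2..\<beta>2}|lborel. f (\<beta>1, y) - f (\<alpha>1, y)) - (LINT p:W|lborel. fx p))
     \<le> (3 * \<kappa> + 1) * N * measure lborel ({a1..b1} \<times> {a2..b2} - W)"
proof -
  interpret sw: continuous_with_partials "f \<circ> prod.swap" "fy \<circ> prod.swap" "fx \<circ> prod.swap" "prod.swap ` Z"
    by (rule swapped)
  have [measurable]: "W \<in> sets borel" using W by simp
  have W': "prod.swap ` W \<subseteq> {\<alpha>2..\<beta>2} \<times> {\<alpha>1..\<beta>1}" using W(2) by force
  have "norm ((LINT y:{\<alpha>2..\<beta>2}|lborel. (f \<circ> prod.swap) (y, \<beta>1) - (f \<circ> prod.swap) (y, \<alpha>1))
          - (LINT p:prod.swap ` W|lborel. (fx \<circ> prod.swap) p))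
     \<le> (3 * \<kappa> + 1) * N * measure lborel ({a2..b2} \<times> {a1..b1} - prod.swap ` W)"
    by (rule sw.vertical_increment[where \<rho> = \<rho> and ?x1.0 = y1 and ?x2.0 = y2])
      (use closed_swap_image[OF W(1)] W' sub left right lipx lipy \<rho> \<kappa> N in \<open>auto simp: mem_swap_image\<close>)
  moreover have "{a2..b2} \<times> {a1..b1} - prod.swap ` W = prod.swap ` ({a1..b1} \<times> {a2..b2} - W)"
    by (auto simp: mem_swap_image)
  ultimately show ?thesis
    by (simp add: set_integral_swap_image(1) measure_lborel_swap del: comp_apply)
      (simp add: comp_def)
qed

end

text \<open>Only the combination \<open>fx + \<i> fy\<close>, twice the derivative with respect to the conjugate variable, is
under control; \<open>fx\<close> and \<open>fy\<close> may fail to be integrable one by one.\<close>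

locale integrable_dbar = continuous_with_partials +
  assumes D_int: "integrable lborel (\<lambda>p. fx p + \<i> * fy p)"
begin

abbreviation D :: "real \<times> real \<Rightarrow> complex" where "D p \<equiv> fx p + \<i> * fy p"

definition defect :: "real \<Rightarrow> real \<Rightarrow> real \<Rightarrow> real \<Rightarrow> complex" where
  "defect a1 b1 a2 b2 = edge_sum f a1 b1 a2 b2 - (LINT p:rect a1 b1 a2 b2|lborel. D p)"

text \<open>Green's formula holds on all rectangles in the disc. The aim is to show that every point has such
a disc; the exceptional points form the closed set \<open>singular\<close>.\<close>

definition regular_at :: "real \<times> real \<Rightarrow> real \<Rightarrow> bool" where
  "regular_at z r \<longleftrightarrow> (\<forall>a1 b1 a2 b2. a1 \<le> b1 \<longrightarrow> a2 \<le> b2 \<longrightarrow> rect a1 b1 a2 b2 \<subseteq> ball z r \<longrightarrow> defect a1 b1 a2 b2 = 0)"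

lemma regular_atD: "regular_at z r \<Longrightarrow> a1 \<le> b1 \<Longrightarrow> a2 \<le> b2 \<Longrightarrow> rect a1 b1 a2 b2 \<subseteq> ball z r \<Longrightarrow> defect a1 b1 a2 b2 = 0"
  unfolding regular_at_def by blast

definition singular :: "(real \<times> real) set" where
  "singular = {z. \<not> (\<exists>r>0. regular_at z r)}"

lemma D_set_int: "A \<in> sets borel \<Longrightarrow> set_integrable lborel A D"
  unfolding set_integrable_def by (intro integrable_mult_indicator D_int) simp

lemma defect_split:
  shows "a1 \<le> c \<Longrightarrow> c \<le> b1 \<Longrightarrow> defect a1 b1 a2 b2 = defect a1 c a2 b2 + defect c b1 a2 b2"
    and "a2 \<le> c \<Longrightarrow> c \<le> b2 \<Longrightarrow> defect a1 b1 a2 b2 = defect a1 b1 a2 c + defect a1 b1 c b2"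
  using edge_sum_split(1)[OF f_cont, of a1 c b1 a2 b2] rect_integral_split(1)[OF D_int, of a1 c b1 a2 b2]
    edge_sum_split(2)[OF f_cont, of a2 c b2 a1 b1] rect_integral_split(2)[OF D_int, of a2 c b2 a1 b1]
  by (simp_all add: defect_def)

lemma defect_degenerate: "defect a a c d = 0" "defect a b c c = 0"
  using defect_split(1)[of a a a c d] defect_split(2)[of c c c a b] by simp_all

lemma closed_singular: "closed singular"
  unfolding closed_def open_contains_ball
proof
  fix z assume "z \<in> - singular"
  then obtain r where r: "r > 0" "regular_at z r"
    unfolding singular_def by blast
  have "w \<in> - singular" if "w \<in> ball z (r/2)" for w
  proof -
    have "ball w (r/2) \<subseteq> ball z r"
      using that by (intro ball_subset_ball_iff[THEN iffD2]) (auto simp: dist_commute)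
    then have "regular_at w (r/2)"
      using regular_atD[OF r(2)] unfolding regular_at_def by (meson order_trans)
    moreover have "r/2 > 0" using r(1) by simp
    ultimately have "\<exists>r>0. regular_at w r" by blast
    then show ?thesis unfolding singular_def by blast
  qed
  then show "\<exists>e>0. ball z e \<subseteq> - singular" using r(1) by (intro exI[of _ "r/2"]) auto
qed

text \<open>A rectangle without singular points is covered by discs in which the formula holds; its small
subrectangles each lie in one of them, and the defect is additive.\<close>

lemma defect_zero_compact:
  assumes "a1 \<le> b1" "a2 \<le> b2" and disj: "rect a1 b1 a2 b2 \<inter> singular = {}"
  shows "defect a1 b1 a2 b2 = 0"
proof -
  have "\<forall>z\<in>rect a1 b1 a2 b2. \<exists>r>0. regular_at z r"
    using disj unfolding singular_def by blast
  from bchoice[OF this] obtain r where "\<forall>z\<in>rect a1 b1 a2 b2. 0 < r z \<and> regular_at z (r z)" ..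
  then have r: "r z > 0" "regular_at z (r z)" if "z \<in> rect a1 b1 a2 b2" for z
    using that by (simp_all only: Ball_def)
  have ne: "rect a1 b1 a2 b2 \<noteq> {}" using assms by auto
  obtain \<delta> where \<delta>: "\<delta> > 0" "\<And>T. T \<subseteq> rect a1 b1 a2 b2 \<Longrightarrow> diameter T < \<delta> \<Longrightarrow> \<exists>B\<in>(\<lambda>z. ball z (r z)) ` rect a1 b1 a2 b2. T \<subseteq> B"
  proof (rule Lebesgue_number_lemma[of "rect a1 b1 a2 b2" "(\<lambda>z. ball z (r z)) ` rect a1 b1 a2 b2"])
    show "compact (rect a1 b1 a2 b2)" unfolding rect_eq_cbox by (rule compact_cbox)
    show "rect a1 b1 a2 b2 \<subseteq> \<Union> ((\<lambda>z. ball z (r z)) ` rect a1 b1 a2 b2)"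
    proof
      fix z assume z: "z \<in> rect a1 b1 a2 b2"
      then have "z \<in> ball z (r z)" using r(1) by simp
      then show "z \<in> \<Union> ((\<lambda>z. ball z (r z)) ` rect a1 b1 a2 b2)" using z by blast
    qed
  qed (use ne in auto)
  define w h where "w = b1 - a1" and "h = b2 - a2"
  have wh: "w \<ge> 0" "h \<ge> 0" using assms by (auto simp: w_def h_def)
  obtain m where m: "(w + h) / 2^m < \<delta>"
  proof -
    obtain m where "(1/2)^m < \<delta> / (w + h + 1)"
      using real_arch_pow_inv[of "\<delta> / (w + h + 1)" "1/2"] \<delta>(1) wh by auto
    then have "(w + h + 1) / 2^m < \<delta>" using wh by (simp add: field_simps)
    moreover have "(w + h) / 2^m \<le> (w + h + 1) / 2^m" by (simp add: divide_right_mono)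
    ultimately show ?thesis by (intro that[of m]) linarith
  qed
  have "norm (defect a1 (a1 + w) a2 (a2 + h)) \<le> (\<lambda>_ _ _ _. 0) a1 (a1 + w) a2 (a2 + h)"
  proof (rule dyadic_subdivision[where m=m and E=defect and H="\<lambda>_ _ _ _. 0"])
    fix c1 c2 assume c: "a1 \<le> c1" "c1 + w/2^m \<le> a1 + w" "a2 \<le> c2" "c2 + h/2^m \<le> a2 + h"
    let ?T = "rect c1 (c1 + w/2^m) c2 (c2 + h/2^m)"
    have sub: "?T \<subseteq> rect a1 b1 a2 b2" using c by (auto simp: w_def h_def)
    have "diameter ?T \<le> (w + h)/2^m"
    proof (rule diameter_le)
      show "?T \<noteq> {} \<or> 0 \<le> (w + h)/2^m" using wh by simp
      fix p q assume "p \<in> ?T" "q \<in> ?T"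
      then have "\<bar>fst p - fst q\<bar> \<le> w/2^m" "\<bar>snd p - snd q\<bar> \<le> h/2^m" by (auto simp: abs_le_iff)
      then show "norm (p - q) \<le> (w + h)/2^m"
        using norm_Pair_le[of "fst p - fst q" "snd p - snd q"] by (cases p; cases q) (auto simp: add_divide_distrib)
    qed
    then obtain z where "z \<in> rect a1 b1 a2 b2" "?T \<subseteq> ball z (r z)" using \<delta>(2)[OF sub] m by auto
    then show "norm (defect c1 (c1 + w/2^m) c2 (c2 + h/2^m)) \<le> 0"
      using regular_atD[OF r(2)] wh by simp
  qed (rule defect_split; assumption | simp add: wh)+
  then show ?thesis by (simp add: w_def h_def)
qed

text \<open>Both sides of Green's formula depend continuously on the rectangle, so it
can be exhausted by rectangles in its interior.\<close>

lemma defect_zero_open: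
  assumes "a1 \<le> b1" "a2 \<le> b2" and disj: "({a1<..<b1} \<times> {a2<..<b2}) \<inter> singular = {}"
  shows "defect a1 b1 a2 b2 = 0"
proof (cases "a1 = b1 \<or> a2 = b2")
  case True
  then show ?thesis using defect_degenerate by auto
next
  case False
  define \<delta> where "\<delta> = min ((b1 - a1) / 2) ((b2 - a2) / 2)"
  have \<delta>: "\<delta> > 0" using assms False by (auto simp: \<delta>_def)
  define e where "e n = \<delta> / real (Suc n)" for n
  have e0: "e \<longlonglongrightarrow> 0" 
    using tendsto_mult_right_zero[OF LIMSEQ_inverse_real_of_nat, of \<delta>]
    by (simp add: e_def[abs_def] divide_inverse)
  have e: "e n > 0" "e n \<le> \<delta>" for n using \<delta> by (auto simp: e_def divide_simps)
  have z: "defect (a1 + e n) (b1 - e n) (a2 + e n) (b2 - e n) = 0" for n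
  proof (rule defect_zero_compact)
    show "a1 + e n \<le> b1 - e n" "a2 + e n \<le> b2 - e n" using e[of n] by (auto simp: \<delta>_def min_def split: if_splits)
    have "rect (a1 + e n) (b1 - e n) (a2 + e n) (b2 - e n) \<subseteq> {a1<..<b1} \<times> {a2<..<b2}" using e[of n] by auto
    then show "rect (a1 + e n) (b1 - e n) (a2 + e n) (b2 - e n) \<inter> singular = {}" using disj by blast
  qed
  have c: "continuous_on UNIV (f \<circ> prod.swap)"
    using swapped by (simp add: continuous_with_partials_def)
  have I: "set_integrable lborel {a..b} (\<lambda>y. f (u, y))" "set_integrable lborel {a..b} (\<lambda>x. f (x, u))" for a b u
    by (intro borel_integrable_atLeastAtMost' f_cont_comp continuous_intros)+
  have es: "edge_sum f a1 b1 a2 b2 = ((LINT y:{a2..b2}|lborel. f (b1, y)) - (LINT y:{a2..b2}|lborel. f (a1, y)))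
     + \<i> * ((LINT x:{a1..b1}|lborel. (f \<circ> prod.swap) (b2, x)) - (LINT x:{a1..b1}|lborel. (f \<circ> prod.swap) (a2, x)))" for a1 b1 a2 b2
    unfolding edge_sum_def by (simp add: set_integral_diff(2)[OF I(1) I(1)] set_integral_diff(2)[OF I(2) I(2)])
  have "(\<lambda>n. defect (a1 + e n) (b1 - e n) (a2 + e n) (b2 - e n)) \<longlonglongrightarrow> defect a1 b1 a2 b2"
    unfolding defect_def es
    using e(1)[THEN less_imp_le]
    by (intro tendsto_intros tendsto_interval_integral f_cont c e0 tendsto_rect_integral D_int
         tendsto_eq_rhs[OF tendsto_add[OF tendsto_const e0]] tendsto_eq_rhs[OF tendsto_diff[OF tendsto_const e0]]) auto
  then show ?thesis unfolding z by (simp add: LIMSEQ_const_iff)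
qed

end

context integrable_dbar
begin

text \<open>Only the bounding rectangle of the singular points matters, since the formula holds on the
rectangles around it. That rectangle is spanned by \<open>W\<close>, so the increment lemmas apply in both
directions, and what they leave of the defect is supported outside the singular set.\<close>

lemma defect_bound:
  assumes ab: "a1 \<le> b1" "a2 \<le> b2" and W_def: "W = rect a1 b1 a2 b2 \<inter> singular" and ne: "W \<noteq> {}"
    and lipx: "\<And>x y h. (x, y) \<in> W \<Longrightarrow> \<bar>h\<bar> \<le> \<rho> \<Longrightarrow> norm (f (x + h, y) - f (x, y)) \<le> N * \<bar>h\<bar>"
    and lipy: "\<And>x y h. (x, y) \<in> W \<Longrightarrow> \<bar>h\<bar> \<le> \<rho> \<Longrightarrow> norm (f (x, y + h) - f (x, y)) \<le> N * \<bar>h\<bar>"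
    and \<rho>: "\<rho> > 0" "b1 - a1 \<le> \<rho>" "b2 - a2 \<le> \<rho>"
    and \<kappa>: "b1 - a1 \<le> \<kappa> * (b2 - a2)" "b2 - a2 \<le> \<kappa> * (b1 - a1)" "\<kappa> \<ge> 0" and N: "N \<ge> 0"
  shows "norm (defect a1 b1 a2 b2) \<le> (LINT p:rect a1 b1 a2 b2 - singular|lborel. 2 * ((3 * \<kappa> + 1) * N) + norm (D p))"
proof -
  define C where "C = (3 * \<kappa> + 1) * N"
  have C: "C \<ge> 0" using \<kappa> N by (simp add: C_def)
  have sing[measurable]: "singular \<in> sets borel" using closed_singular by simp
  have "compact (rect a1 b1 a2 b2)" unfolding rect_eq_cbox by (rule compact_cbox)
  then have compW: "compact W" unfolding W_def using closed_singular by (rule compact_Int_closed)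
  then have W: "closed W" by (rule compact_imp_closed)
  then have [measurable]: "W \<in> sets borel" by simp
  obtain l where l: "l \<in> W" "\<And>p. p \<in> W \<Longrightarrow> fst l \<le> fst p"
    using continuous_attains_inf[OF compW ne continuous_on_fst[OF continuous_on_id]] by auto
  obtain r where r: "r \<in> W" "\<And>p. p \<in> W \<Longrightarrow> fst p \<le> fst r"
    using continuous_attains_sup[OF compW ne continuous_on_fst[OF continuous_on_id]] by auto
  obtain b where b: "b \<in> W" "\<And>p. p \<in> W \<Longrightarrow> snd b \<le> snd p"
    using continuous_attains_inf[OF compW ne continuous_on_snd[OF continuous_on_id]] by auto
  obtain t where t: "t \<in> W" "\<And>p. p \<in> W \<Longrightarrow> snd p \<le> snd t"
    using continuous_attains_sup[OF compW ne continuous_on_snd[OF continuous_on_id]] by auto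
  define \<alpha>1 \<beta>1 \<alpha>2 \<beta>2 where "\<alpha>1 = fst l" and "\<beta>1 = fst r" and "\<alpha>2 = snd b" and "\<beta>2 = snd t"
  have WJ: "W \<subseteq> rect \<alpha>1 \<beta>1 \<alpha>2 \<beta>2"
    using l r b t by (auto simp: \<alpha>1_def \<beta>1_def \<alpha>2_def \<beta>2_def)
  have ord: "a1 \<le> \<alpha>1" "\<alpha>1 \<le> \<beta>1" "\<beta>1 \<le> b1" "a2 \<le> \<alpha>2" "\<alpha>2 \<le> \<beta>2" "\<beta>2 \<le> b2"
    using l r b t W_def by (auto simp: \<alpha>1_def \<beta>1_def \<alpha>2_def \<beta>2_def)
  have WJ': "p \<in> rect \<alpha>1 \<beta>1 \<alpha>2 \<beta>2" if "p \<in> singular" "p \<in> rect a1 b1 a2 b2" for p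
    using WJ that by (auto simp: W_def)
  \<comment> \<open>Outside the bounding rectangle of \<open>W\<close> nothing is singular.\<close>
  have z1: "defect a1 \<alpha>1 a2 b2 = 0"
    by (rule defect_zero_open) (use ord ab WJ' in force)+
  have z2: "defect \<beta>1 b1 a2 b2 = 0"
    by (rule defect_zero_open) (use ord ab WJ' in force)+
  have z3: "defect \<alpha>1 \<beta>1 a2 \<alpha>2 = 0"
    by (rule defect_zero_open) (use ord ab WJ' in force)+
  have z4: "defect \<alpha>1 \<beta>1 \<beta>2 b2 = 0"
    by (rule defect_zero_open) (use ord ab WJ' in force)+
  have eqJ: "defect a1 b1 a2 b2 = defect \<alpha>1 \<beta>1 \<alpha>2 \<beta>2"
    using defect_split(1)[of a1 \<alpha>1 b1 a2 b2] defect_split(1)[of \<alpha>1 \<beta>1 b1 a2 b2]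
      defect_split(2)[of a2 \<alpha>2 b2 \<alpha>1 \<beta>1] defect_split(2)[of \<alpha>2 \<beta>2 b2 \<alpha>1 \<beta>1] ord z1 z2 z3 z4 by simp
  define X where "X = (LINT y:{\<alpha>2..\<beta>2}|lborel. f (\<beta>1, y) - f (\<alpha>1, y))"
  define Y where "Y = (LINT x:{\<alpha>1..\<beta>1}|lborel. f (x, \<beta>2) - f (x, \<alpha>2))"
  have Q: "rect a1 b1 a2 b2 - W = rect a1 b1 a2 b2 - singular" by (auto simp: W_def)
  let ?m = "measure lborel (rect a1 b1 a2 b2 - singular)"
  have bX: "norm (X - (LINT p:W|lborel. fx p)) \<le> C * ?m"
    unfolding X_def C_def Q[symmetric]
  proof (rule horizontal_increment[OF W WJ])
    show "(\<alpha>1, snd l) \<in> W" "(\<beta>1, snd r) \<in> W" using l r by (auto simp: \<alpha>1_def \<beta>1_def)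
  qed (fact ord lipx lipy \<rho> \<kappa> N)+
  have bY: "norm (Y - (LINT p:W|lborel. fy p)) \<le> C * ?m"
    unfolding Y_def C_def Q[symmetric]
  proof (rule vertical_increment[OF W WJ])
    show "(fst b, \<alpha>2) \<in> W" "(fst t, \<beta>2) \<in> W" using b t by (auto simp: \<alpha>2_def \<beta>2_def)
  qed (fact ord lipx lipy \<rho> \<kappa> N)+
  have Wfx: "set_integrable lborel W fx" and Wfy: "set_integrable lborel W fy"
    by (rule set_integrable_fx[OF W WJ \<rho>(1) lipx], assumption+)
       (rule set_integrable_fy[OF W WJ \<rho>(1) lipy], assumption+)
  define J where "J = rect \<alpha>1 \<beta>1 \<alpha>2 \<beta>2"
  have [measurable]: "J \<in> sets borel" by (simp add: J_def)
  have "(LINT p:J|lborel. D p) = (LINT p:W \<union> (J - W)|lborel. D p)"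
    using WJ by (simp add: J_def Un_absorb1)
  also have "\<dots> = (LINT p:W|lborel. D p) + (LINT p:J - W|lborel. D p)"
    by (intro set_integral_Un D_set_int) auto
  also have "(LINT p:W|lborel. D p) = (LINT p:W|lborel. fx p) + \<i> * (LINT p:W|lborel. fy p)"
    using Wfx Wfy by (simp add: set_integral_add)
  finally have "defect a1 b1 a2 b2 = (X - (LINT p:W|lborel. fx p)) + \<i> * (Y - (LINT p:W|lborel. fy p)) - (LINT p:J - W|lborel. D p)"
    unfolding eqJ unfolding defect_def edge_sum_def X_def Y_def J_def by (simp add: algebra_simps)
  then have "norm (defect a1 b1 a2 b2) \<le> norm (X - (LINT p:W|lborel. fx p)) + norm (Y - (LINT p:W|lborel. fy p)) + norm (LINT p:J - W|lborel. D p)"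
  proof -
    have "norm (x + \<i> * y - z) \<le> norm x + norm y + norm z" for x y z :: complex
      using norm_triangle_ineq4[of "x + \<i> * y" z] norm_triangle_ineq[of x "\<i> * y"] by (simp add: norm_mult)
    then show ?thesis
      using \<open>defect a1 b1 a2 b2 = _ - (LINT p:J - W|lborel. D p)\<close> by simp
  qed
  also have "norm (LINT p:J - W|lborel. D p) \<le> (LINT p:J - W|lborel. norm (D p))"
    by (rule set_integral_norm_bound) (intro D_set_int, measurable)
  also have "\<dots> \<le> (LINT p:rect a1 b1 a2 b2 - singular|lborel. norm (D p))"
    unfolding set_lebesgue_integral_def
  proof (rule integral_mono)
    have "integrable lborel (\<lambda>p. indicator A p *\<^sub>R norm (D p))" if "A \<in> sets borel" for A
      by (rule set_integrable_norm[OF D_set_int[OF that], unfolded set_integrable_def])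
    from this[of "J - W"] this[of "rect a1 b1 a2 b2 - singular"]
    show "integrable lborel (\<lambda>p. indicator (J - W) p *\<^sub>R norm (D p))"
      "integrable lborel (\<lambda>p. indicator (rect a1 b1 a2 b2 - singular) p *\<^sub>R norm (D p))"
      by simp_all
    show "indicator (J - W) p *\<^sub>R norm (D p) \<le> indicator (rect a1 b1 a2 b2 - singular) p *\<^sub>R norm (D p)" for p
      using ord by (cases p) (auto simp: J_def W_def indicator_def)
  qed
  finally have "norm (defect a1 b1 a2 b2) \<le> 2 * C * ?m + (LINT p:rect a1 b1 a2 b2 - singular|lborel. norm (D p))"
    using bX bY by simp
  also have "\<dots> = (LINT p:rect a1 b1 a2 b2 - singular|lborel. 2 * C + norm (D p))"
  proof -
    have "emeasure lborel (rect a1 b1 a2 b2 - singular) < \<infinity>"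
      using emeasure_mono[of "rect a1 b1 a2 b2 - singular" "rect a1 b1 a2 b2" lborel] emeasure_rect_finite[of a1 b1 a2 b2]
      by (auto intro: le_less_trans)
    then have I1: "set_integrable lborel (rect a1 b1 a2 b2 - singular) (\<lambda>p. 2 * C)"
      by (auto simp: set_integrable_def)
    have I2: "set_integrable lborel (rect a1 b1 a2 b2 - singular) (\<lambda>p. norm (D p))"
      by (intro set_integrable_norm D_set_int) measurable
    show ?thesis
      by (subst set_integral_add(2)[OF I1 I2]) (simp add: set_lebesgue_integral_def mult.commute)
  qed
  finally show ?thesis by (simp add: C_def)
qed

text \<open>Uniform bounds for the horizontal and vertical difference quotients at a point, at all scales up to
\<open>1 / (n + 1)\<close>. These closed sets exhaust the points at which both partial derivatives exist.\<close>

definition lip_set :: "nat \<Rightarrow> (real \<times> real) set" where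
  "lip_set n = {z. \<forall>h. \<bar>h\<bar> \<le> 1 / real (Suc n) \<longrightarrow>
     norm (f (z + (h, 0)) - f z) \<le> real (Suc n) * \<bar>h\<bar> \<and> norm (f (z + (0, h)) - f z) \<le> real (Suc n) * \<bar>h\<bar>}"

lemma closed_lip_set: "closed (lip_set n)"
proof -
  have "closed {z. norm (f (z + (h, 0)) - f z) \<le> real (Suc n) * \<bar>h\<bar> \<and> norm (f (z + (0, h)) - f z) \<le> real (Suc n) * \<bar>h\<bar>}" for h
    by (intro closed_Collect_conj closed_Collect_le continuous_intros f_cont_comp)
  then show ?thesis
    unfolding lip_set_def by (intro closed_Collect_all closed_Collect_imp) auto
qed

lemma lip_set_cover: "z \<notin> Z \<Longrightarrow> \<exists>n. z \<in> lip_set n"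
proof -
  assume z: "z \<notin> Z"
  obtain x y where xy: "z = (x, y)" by (cases z)
  obtain d1 where d1: "d1 > 0" "\<And>h. \<bar>h\<bar> < d1 \<Longrightarrow> norm (f (x + h, y) - f (x, y)) \<le> (norm (fx (x, y)) + 1) * \<bar>h\<bar>"
    using vector_derivative_imp_Lipschitz_at[OF fx] z xy by metis
  obtain d2 where d2: "d2 > 0" "\<And>h. \<bar>h\<bar> < d2 \<Longrightarrow> norm (f (x, y + h) - f (x, y)) \<le> (norm (fy (x, y)) + 1) * \<bar>h\<bar>"
    using vector_derivative_imp_Lipschitz_at[OF fy] z xy by metis
  obtain n :: nat where n: "real n \<ge> max (max (1 / d1) (1 / d2)) (max (norm (fx (x, y)) + 1) (norm (fy (x, y)) + 1))"
    using real_arch_simple by blast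
  have 1: "1 / real (Suc n) < d" if "1 / d \<le> real n" "d > 0" for d
    using that by (simp add: divide_simps) (simp add: algebra_simps)
  have "z \<in> lip_set n"
    unfolding lip_set_def
  proof (intro CollectI allI impI conjI)
    fix h assume h: "\<bar>h\<bar> \<le> 1 / real (Suc n)"
    have "norm (f (x + h, y) - f (x, y)) \<le> (norm (fx (x, y)) + 1) * \<bar>h\<bar>"
      using h 1[of d1] n d1(1) by (intro d1(2)) auto
    also have "\<dots> \<le> real (Suc n) * \<bar>h\<bar>" using n by (intro mult_right_mono) auto
    finally show "norm (f (z + (h, 0)) - f z) \<le> real (Suc n) * \<bar>h\<bar>" by (simp add: xy)
    have "norm (f (x, y + h) - f (x, y)) \<le> (norm (fy (x, y)) + 1) * \<bar>h\<bar>"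
      using h 1[of d2] n d2(1) by (intro d2(2)) auto
    also have "\<dots> \<le> real (Suc n) * \<bar>h\<bar>" using n by (intro mult_right_mono) auto
    finally show "norm (f (z + (0, h)) - f z) \<le> real (Suc n) * \<bar>h\<bar>" by (simp add: xy)
  qed
  then show ?thesis ..
qed

text \<open>Baire's theorem for the closed set \<open>singular\<close>, which is covered by the countably many closed sets
\<open>lip_set n\<close> and the singletons of exceptional points.\<close>

lemma singular_portion:
  assumes "singular \<noteq> {}"
  obtains c r K where "c \<in> singular" "r > 0" "ball c r \<inter> singular \<subseteq> K" "(\<exists>n. K = lip_set n) \<or> (\<exists>z. K = {z})"
proof -
  define \<K> where "\<K> = range lip_set \<union> (\<lambda>z. {z}) ` Z"
  have \<K>: "closed K" "(\<exists>n. K = lip_set n) \<or> (\<exists>z. K = {z})" if "K \<in> \<K>" for K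
    using that closed_lip_set by (auto simp: \<K>_def)
  have cover: "\<Inter> ((\<lambda>K. singular - K) ` \<K>) = {}"
  proof -
    have "\<exists>K\<in>\<K>. z \<in> K" for z
      using lip_set_cover[of z] by (cases "z \<in> Z") (auto simp: \<K>_def)
    then show ?thesis by blast
  qed
  have "\<exists>K\<in>\<K>. \<not> singular \<subseteq> closure (singular - K)"
  proof (rule ccontr)
    assume no: "\<not> (\<exists>K\<in>\<K>. \<not> singular \<subseteq> closure (singular - K))"
    have "singular \<subseteq> closure (\<Inter> ((\<lambda>K. singular - K) ` \<K>))"
    proof (rule Baire[OF closed_singular])
      show "countable ((\<lambda>K. singular - K) ` \<K>)"
        unfolding \<K>_def by (intro countable_image countable_Un Z) auto
      fix T assume "T \<in> (\<lambda>K. singular - K) ` \<K>"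
      then obtain K where K: "K \<in> \<K>" "T = singular - K" by blast
      have "openin (top_of_set singular) (singular \<inter> - K)"
        using \<K>(1)[OF K(1)] by (intro openin_open_Int) auto
      then show "openin (top_of_set singular) T \<and> singular \<subseteq> closure T"
        using no K by (auto simp: Diff_eq)
    qed
    then show False using cover assms by simp
  qed
  then obtain K c where K: "K \<in> \<K>" "c \<in> singular" "c \<notin> closure (singular - K)" by blast
  then obtain r where r: "r > 0" "\<forall>y\<in>singular - K. \<not> dist y c < r"
    unfolding closure_approachable by blast
  have "ball c r \<inter> singular \<subseteq> K"
  proof
    fix y assume "y \<in> ball c r \<inter> singular"
    then have "y \<in> singular" "dist y c < r" by (simp_all add: dist_commute)
    then show "y \<in> K" using r(2) by blast
  qed
  then show ?thesis using that[of c r K] K r(1) \<K>(2) by blast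
qed

text \<open>A rectangle that contains the only singular point is cut into four, which have it as a corner or on
a side.\<close>

lemma regular_at_isolated:
  assumes only: "ball c r \<inter> singular \<subseteq> {c}"
  shows "regular_at c r"
  unfolding regular_at_def
proof (intro allI impI)
  fix a1 b1 a2 b2 assume ab: "a1 \<le> b1" "a2 \<le> b2" and sub: "rect a1 b1 a2 b2 \<subseteq> ball c r"
  have sing: "p = c" if "p \<in> rect a1 b1 a2 b2" "p \<in> singular" for p using that only sub by blast
  obtain x y where xy: "c = (x, y)" by (cases c)
  show "defect a1 b1 a2 b2 = 0"
  proof (cases "c \<in> rect a1 b1 a2 b2")
    case False
    then have "rect a1 b1 a2 b2 \<inter> singular = {}" using sing by blast
    then show ?thesis by (rule defect_zero_compact[OF ab])
  next
    case True
    then have o: "a1 \<le> x" "x \<le> b1" "a2 \<le> y" "y \<le> b2" using xy by auto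
    have z: "defect s t u v = 0" if "s \<le> t" "u \<le> v" "rect s t u v \<subseteq> rect a1 b1 a2 b2" "c \<notin> {s<..<t} \<times> {u<..<v}" for s t u v
    proof (rule defect_zero_open[OF that(1,2)])
      have "{s<..<t} \<times> {u<..<v} \<subseteq> rect s t u v" by auto
      then show "{s<..<t} \<times> {u<..<v} \<inter> singular = {}" using that sing by blast
    qed
    have "defect a1 x a2 y = 0" "defect a1 x y b2 = 0" "defect x b1 a2 y = 0" "defect x b1 y b2 = 0"
      using o xy by (intro z; auto)+
    then show ?thesis
      using defect_split(1)[of a1 x b1 a2 b2] defect_split(2)[of a2 y b2 a1 x] defect_split(2)[of a2 y b2 x b1] o
      by simp
  qed
qed

text \<open>Divide a rectangle into small ones. Those without singular points have no defect, and the defect of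
the others is bounded by an integral over their regular points, all of which are close to the
singular set. Hence the whole defect is bounded by the integral of a fixed function over the regular
points at distance less than \<open>1 / (m + 1)\<close> from the singular set, for every \<open>m\<close>. These sets have
empty intersection, because the singular set is closed.\<close>

lemma regular_at_Lipschitz_portion:
  assumes portion: "ball c r \<inter> singular \<subseteq> lip_set n" and r: "r > 0"
  shows "\<exists>r>0. regular_at c r"
proof -
  define \<rho> where "\<rho> = 1 / real (Suc n)"
  define N where "N = real (Suc n)"
  have \<rho>: "\<rho> > 0" by (simp add: \<rho>_def)
  have N: "N \<ge> 0" by (simp add: N_def)
  define r' where "r' = min r (\<rho> / 2)"
  have "regular_at c r'"
    unfolding regular_at_def
  proof (intro allI impI)
    fix a1 b1 a2 b2 assume ab: "a1 \<le> b1" "a2 \<le> b2" and sub: "rect a1 b1 a2 b2 \<subseteq> ball c r'"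
    show "defect a1 b1 a2 b2 = 0"
    proof (cases "a1 = b1 \<or> a2 = b2")
      case True
      then show ?thesis using defect_degenerate by auto
    next
      case False
      define w h where "w = b1 - a1" and "h = b2 - a2"
      have wh: "w > 0" "h > 0" using False ab by (auto simp: w_def h_def)
      have inball: "(a1, a2) \<in> ball c r'" "(b1, a2) \<in> ball c r'" "(a1, b2) \<in> ball c r'"
        by (rule subsetD[OF sub], use ab in simp)+
      have le\<rho>: "w \<le> \<rho>" "h \<le> \<rho>"
        using dist_triangle2[of "(b1, a2)" "(a1, a2)" c] dist_triangle2[of "(a1, b2)" "(a1, a2)" c] inball wh
        by (auto simp: dist_commute dist_Pair_Pair dist_real_def w_def h_def r'_def)
      define \<kappa> where "\<kappa> = max (w / h) (h / w)"
      have \<kappa>: "w \<le> \<kappa> * h" "h \<le> \<kappa> * w" "\<kappa> \<ge> 0"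
        using wh by (auto simp: \<kappa>_def le_max_iff_disj simp flip: pos_divide_le_eq)
      have lip: "norm (f (x + t, y) - f (x, y)) \<le> N * \<bar>t\<bar>" "norm (f (x, y + t) - f (x, y)) \<le> N * \<bar>t\<bar>"
        if "(x, y) \<in> rect a1 b1 a2 b2" "(x, y) \<in> singular" "\<bar>t\<bar> \<le> \<rho>" for x y t
      proof -
        have "(x, y) \<in> ball c r" using subsetD[OF sub that(1)] by (simp add: r'_def)
        then have "(x, y) \<in> lip_set n" using that(2) portion by blast
        then show "norm (f (x + t, y) - f (x, y)) \<le> N * \<bar>t\<bar>" "norm (f (x, y + t) - f (x, y)) \<le> N * \<bar>t\<bar>"
          using that(3) by (auto simp: lip_set_def N_def \<rho>_def)
      qed
      define k where "k p = 2 * ((3 * \<kappa> + 1) * N) + norm (D p)" for p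
      have k0: "k p \<ge> 0" for p using \<kappa> N by (simp add: k_def)
      define V where "V m = (\<Union>q\<in>singular. ball q (1 / real (Suc m))) - singular" for m
      define Q where "Q = rect a1 b1 a2 b2"
      define g where "g m p = indicator (Q \<inter> V m) p * k p" for m p
      have [measurable]: "Q \<in> sets borel" by (simp add: Q_def)
      have sing[measurable]: "singular \<in> sets borel" using closed_singular by simp
      have "open (\<Union>q\<in>singular. ball q (1 / real (Suc m)))" for m by blast
      then have Vm[measurable]: "V m \<in> sets borel" for m unfolding V_def by auto
      have k_int: "set_integrable lborel Q k"
      proof -
        have I1: "set_integrable lborel Q (\<lambda>p. 2 * ((3 * \<kappa> + 1) * N))"
          using emeasure_rect_finite[of a1 b1 a2 b2] by (auto simp: set_integrable_def Q_def)
        have I2: "set_integrable lborel Q (\<lambda>p. norm (D p))"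
          by (intro set_integrable_norm D_set_int) measurable
        show ?thesis using set_integral_add(1)[OF I1 I2] by (simp add: k_def[abs_def])
      qed
      have g_int: "integrable lborel (g m)" for m
      proof -
        have "set_integrable lborel (Q \<inter> V m) k"
          by (rule set_integrable_subset[OF k_int]) auto
        then show ?thesis by (simp add: set_integrable_def g_def[abs_def])
      qed
      have bound: "norm (defect a1 (a1 + w) a2 (a2 + h)) \<le> (LINT p:rect a1 (a1 + w) a2 (a2 + h)|lborel. g m p)" for m
      proof -
        obtain j where j: "(w + h) / 2^j < 1 / real (Suc m)"
        proof -
          obtain j where "(1/2)^j < 1 / real (Suc m) / (w + h)"
            using real_arch_pow_inv[of "1 / real (Suc m) / (w + h)" "1/2"] wh by auto
          then have "(1/2)^j * (w + h) < 1 / real (Suc m)" using wh by (subst (asm) pos_less_divide_eq) auto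
          then have "(w + h) / 2^j < 1 / real (Suc m)" by (simp add: power_divide)
          then show ?thesis using that by simp
        qed
        show ?thesis
        proof (rule dyadic_subdivision[where m=j and E=defect and H="\<lambda>a1 b1 a2 b2. (LINT p:rect a1 b1 a2 b2|lborel. g m p)"])
          fix c1 c2 assume c: "a1 \<le> c1" "c1 + w/2^j \<le> a1 + w" "a2 \<le> c2" "c2 + h/2^j \<le> a2 + h"
          define w' h' where "w' = w/2^j" and "h' = h/2^j"
          have w'h': "w' > 0" "h' > 0" "w' \<le> w" "h' \<le> h" "w' \<le> \<kappa> * h'" "h' \<le> \<kappa> * w'"
            using wh \<kappa> by (auto simp: w'_def h'_def divide_simps)
          let ?T = "rect c1 (c1 + w') c2 (c2 + h')"
          have TQ: "?T \<subseteq> Q" using c by (auto simp: Q_def w_def h_def w'_def h'_def)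
          show "norm (defect c1 (c1 + w/2^j) c2 (c2 + h/2^j)) \<le> (LINT p:rect c1 (c1 + w/2^j) c2 (c2 + h/2^j)|lborel. g m p)"
          proof (cases "?T \<inter> singular = {}")
            case True
            then have "defect c1 (c1 + w') c2 (c2 + h') = 0" using w'h' by (intro defect_zero_compact) auto
            moreover have "(LINT p:?T|lborel. g m p) \<ge> 0"
              unfolding set_lebesgue_integral_def by (intro integral_nonneg_AE AE_I2) (auto simp: g_def k0 indicator_def)
            ultimately show ?thesis by (simp add: w'_def h'_def)
          next
            case False
            then obtain q where q: "q \<in> ?T" "q \<in> singular" by blast
            have "norm (defect c1 (c1 + w') c2 (c2 + h')) \<le> (LINT p:?T - singular|lborel. k p)"
              unfolding k_def
            proof (rule defect_bound[OF _ _ refl False, where \<rho>=\<rho>])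
              fix x y t assume "(x, y) \<in> ?T \<inter> singular" "\<bar>t\<bar> \<le> \<rho>"
              moreover from this have "(x, y) \<in> rect a1 b1 a2 b2" using TQ unfolding Q_def by blast
              ultimately show "norm (f (x + t, y) - f (x, y)) \<le> N * \<bar>t\<bar>" "norm (f (x, y + t) - f (x, y)) \<le> N * \<bar>t\<bar>"
                using lip by blast+
            qed (use w'h' \<kappa> \<rho> N le\<rho> in auto)
            also have "\<dots> = (LINT p:?T|lborel. g m p)"
              unfolding set_lebesgue_integral_def
            proof (rule Bochner_Integration.integral_cong[OF refl])
              fix p
              have "p \<in> V m" if p: "p \<in> ?T" "p \<notin> singular"
              proof -
                have "\<bar>fst p - fst q\<bar> \<le> w'" "\<bar>snd p - snd q\<bar> \<le> h'" using p q by (auto simp: abs_le_iff)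
                then have "norm (p - q) \<le> w' + h'"
                  using norm_Pair_le[of "fst p - fst q" "snd p - snd q"] by (cases p; cases q) auto
                then have "dist q p < 1 / real (Suc m)"
                  using j by (simp add: dist_norm norm_minus_commute w'_def h'_def add_divide_distrib)
                then show ?thesis using p q by (auto simp: V_def)
              qed
              moreover have "p \<notin> V m" if "p \<in> singular" using that by (simp add: V_def)
              ultimately show "indicator (?T - singular) p *\<^sub>R k p = indicator ?T p *\<^sub>R g m p"
                using TQ by (auto simp: g_def indicator_def)
            qed
            finally show ?thesis by (simp add: w'_def h'_def)
          qed
        qed (rule defect_split; assumption | rule rect_integral_split[OF g_int]; assumption | use wh in simp)+
      qed
      have "(\<lambda>m. LINT p:Q|lborel. g m p) \<longlonglongrightarrow> (LINT p:Q|lborel. 0)"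
        unfolding set_lebesgue_integral_def
      proof (rule integral_dominated_convergence[where w="\<lambda>p. indicator Q p *\<^sub>R k p"])
        show "integrable lborel (\<lambda>p. indicator Q p *\<^sub>R k p)" using k_int by (simp add: set_integrable_def)
        show "AE p in lborel. (\<lambda>m. indicator Q p *\<^sub>R g m p) \<longlonglongrightarrow> indicator Q p *\<^sub>R 0"
        proof (rule AE_I2)
          fix p
          have "\<forall>\<^sub>F m in sequentially. p \<notin> V m"
          proof (cases "p \<in> singular")
            case True
            then show ?thesis by (simp add: V_def)
          next
            case False
            then obtain e where e: "e > 0" "ball p e \<subseteq> - singular"
              using closed_singular unfolding closed_def open_contains_ball by blast
            have "\<forall>\<^sub>F m in sequentially. 1 / real (Suc m) < e"
              using order_tendstoD(2)[OF LIMSEQ_inverse_real_of_nat e(1)] by (simp add: divide_inverse)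
            then show ?thesis
            proof eventually_elim
              case (elim m)
              have "q \<notin> singular" if "dist q p < 1 / real (Suc m)" for q
              proof -
                have "q \<in> ball p e" using that elim by (simp add: dist_commute)
                then show ?thesis using e(2) by blast
              qed
              then show ?case by (auto simp: V_def)
            qed
          qed
          then have "\<forall>\<^sub>F m in sequentially. indicator Q p *\<^sub>R g m p = indicator Q p *\<^sub>R 0"
            by eventually_elim (simp add: g_def)
          then show "(\<lambda>m. indicator Q p *\<^sub>R g m p) \<longlonglongrightarrow> indicator Q p *\<^sub>R 0" by (rule tendsto_eventually)
        qed
        show "AE p in lborel. norm (indicator Q p *\<^sub>R g m p) \<le> indicator Q p *\<^sub>R k p" for m
          using k0 by (intro AE_I2) (auto simp: g_def indicator_def)
      qed (use g_int in auto)
      then have "(\<lambda>m. LINT p:Q|lborel. g m p) \<longlonglongrightarrow> 0" by (simp add: set_lebesgue_integral_def)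
      then have "norm (defect a1 (a1 + w) a2 (a2 + h)) \<le> 0"
        by (rule LIMSEQ_le_const) (use bound in \<open>auto simp: Q_def w_def h_def\<close>)
      then show ?thesis by (simp add: w_def h_def)
    qed
  qed
  moreover have "r' > 0" using r \<rho> by (simp add: r'_def)
  ultimately show ?thesis by blast
qed

lemma singular_empty: "singular = {}"
proof (rule ccontr)
  assume ne: "singular \<noteq> {}"
  obtain c r K where c: "c \<in> singular" "r > 0" "ball c r \<inter> singular \<subseteq> K" and K: "(\<exists>n. K = lip_set n) \<or> (\<exists>z. K = {z})"
    using singular_portion[OF ne] by blast
  have "\<exists>r>0. regular_at c r"
    using K
  proof
    assume "\<exists>z. K = {z}"
    then obtain z where "K = {z}" ..
    moreover have "c \<in> ball c r \<inter> singular" using c by simp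
    ultimately have "ball c r \<inter> singular \<subseteq> {c}" using c(3) by blast
    then show ?thesis using regular_at_isolated c(2) by blast
  next
    assume "\<exists>n. K = lip_set n"
    then show ?thesis using regular_at_Lipschitz_portion c by blast
  qed
  then show False using c(1) unfolding singular_def by blast
qed

text \<open>The Looman-Menchoff theorem in inhomogeneous form: for \<open>fx + \<i> fy = 0\<close> almost everywhere it says that
the integral of \<open>f dz\<close> along the boundary of every rectangle vanishes.\<close>

theorem Green_rectangle:
  assumes "a1 \<le> b1" "a2 \<le> b2"
  shows "(LINT y:{a2..b2}|lborel. f (b1, y) - f (a1, y)) + \<i> * (LINT x:{a1..b1}|lborel. f (x, b2) - f (x, a2))
     = (LINT p:rect a1 b1 a2 b2|lborel. D p)"
  using defect_zero_compact[OF assms] by (simp add: singular_empty defect_def edge_sum_def)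

end

section \<open>Square integrability of the partial derivatives\<close>

lemma lborel_translate:
  fixes g :: "'a::euclidean_space \<Rightarrow> 'b::{banach, second_countable_topology}"
  assumes [measurable]: "g \<in> borel_measurable borel"
  shows "(LINT p|lborel. g (a + p)) = (LINT p|lborel. g p)"
    and "integrable lborel (\<lambda>p. g (a + p)) \<longleftrightarrow> integrable lborel g"
proof -
  show "(LINT p|lborel. g (a + p)) = (LINT p|lborel. g p)"
    using integral_distr[of "(+) a" lborel borel g] by (simp add: lborel_distr_plus)
  show "integrable lborel (\<lambda>p. g (a + p)) \<longleftrightarrow> integrable lborel g"
    using integrable_distr_eq[of "(+) a" lborel borel g] by (simp add: lborel_distr_plus)
qed

lemma lborel_integral_affine:
  fixes g :: "'a::euclidean_space \<Rightarrow> 'b::{banach, second_countable_topology}"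
  assumes [measurable]: "g \<in> borel_measurable borel" and c: "c \<noteq> 0"
  shows "(LINT p|lborel. g p) = \<bar>c\<bar> ^ DIM('a) *\<^sub>R (LINT p|lborel. g (t + c *\<^sub>R p))"
proof -
  have "(LINT p|lborel. g p) = (LINT p|density (distr lborel borel (\<lambda>x. t + c *\<^sub>R x)) (\<lambda>_. ennreal (\<bar>c\<bar> ^ DIM('a))). g p)"
    using lborel_affine[OF c, of t] by simp
  also have "\<dots> = (LINT p|distr lborel borel (\<lambda>x. t + c *\<^sub>R x). \<bar>c\<bar> ^ DIM('a) *\<^sub>R g p)"
    by (rule integral_density) auto
  also have "\<dots> = (LINT p|lborel. \<bar>c\<bar> ^ DIM('a) *\<^sub>R g (t + c *\<^sub>R p))"
    by (rule integral_distr) auto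
  finally show ?thesis by simp
qed

lemma nn_integral_lborel_translate:
  fixes g :: "'a::euclidean_space \<Rightarrow> ennreal"
  assumes [measurable]: "g \<in> borel_measurable borel"
  shows "(\<integral>\<^sup>+p. g (a + p) \<partial>lborel) = (\<integral>\<^sup>+p. g p \<partial>lborel)"
  using nn_integral_distr[of "(+) a" lborel borel g] by (simp add: lborel_distr_plus)

lemma norm_set_integral_square_le:
  fixes g :: "'a \<Rightarrow> complex"
  assumes g: "set_integrable M A g" and A[measurable]: "A \<in> sets M" and fin: "emeasure M A < \<infinity>"
  shows "ennreal ((norm (LINT x:A|M. g x))\<^sup>2) \<le> ennreal (measure M A) * (\<integral>\<^sup>+x. indicator A x * ennreal ((norm (g x))\<^sup>2) \<partial>M)"
proof -
  have m: "(\<lambda>x. indicator A x *\<^sub>R g x) \<in> borel_measurable M"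
    using g by (auto simp: set_integrable_def)
  then have m': "(\<lambda>x. ennreal (norm (indicator A x *\<^sub>R g x))) \<in> borel_measurable M" by measurable
  have "ennreal (norm (LINT x:A|M. g x)) \<le> (\<integral>\<^sup>+x. ennreal (norm (indicator A x *\<^sub>R g x)) \<partial>M)"
    unfolding set_lebesgue_integral_def by (rule integral_norm_bound_ennreal) (use g in \<open>simp add: set_integrable_def\<close>)
  also have "\<dots> = (\<integral>\<^sup>+x. indicator A x * ennreal (norm (indicator A x *\<^sub>R g x)) \<partial>M)"
    by (intro nn_integral_cong) (auto simp: indicator_def)
  finally have "(ennreal (norm (LINT x:A|M. g x)))\<^sup>2 \<le> (\<integral>\<^sup>+x. indicator A x * ennreal (norm (indicator A x *\<^sub>R g x)) \<partial>M)\<^sup>2"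
    by (intro power_mono) auto
  also have "\<dots> \<le> (\<integral>\<^sup>+x. (indicator A x)\<^sup>2 \<partial>M) * (\<integral>\<^sup>+x. (ennreal (norm (indicator A x *\<^sub>R g x)))\<^sup>2 \<partial>M)"
    by (rule Cauchy_Schwarz_nn_integral) (use m' in auto)
  also have "(\<integral>\<^sup>+x. (indicator A x)\<^sup>2 \<partial>M) = ennreal (measure M A)"
  proof -
    have "(\<integral>\<^sup>+x. (indicator A x)\<^sup>2 \<partial>M) = (\<integral>\<^sup>+x. indicator A x \<partial>M)"
      by (intro nn_integral_cong) (auto simp: indicator_def)
    then show ?thesis using fin by (simp add: emeasure_eq_ennreal_measure less_top)
  qed
  also have "(\<integral>\<^sup>+x. (ennreal (norm (indicator A x *\<^sub>R g x)))\<^sup>2 \<partial>M) = (\<integral>\<^sup>+x. indicator A x * ennreal ((norm (g x))\<^sup>2) \<partial>M)"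
    by (intro nn_integral_cong) (auto simp: indicator_def ennreal_power)
  finally show ?thesis by (simp add: ennreal_power)
qed

lemma Fatou_norm_square:
  fixes g :: "nat \<Rightarrow> 'a \<Rightarrow> complex"
  assumes g: "\<And>n. g n \<in> borel_measurable M" and lim: "AE x in M. (\<lambda>n. g n x) \<longlonglongrightarrow> l x"
    and le: "\<And>n. (\<integral>\<^sup>+x. ennreal ((norm (g n x))\<^sup>2) \<partial>M) \<le> I"
  shows "(\<integral>\<^sup>+x. ennreal ((norm (l x))\<^sup>2) \<partial>M) \<le> I"
proof -
  have "(\<integral>\<^sup>+x. ennreal ((norm (l x))\<^sup>2) \<partial>M) = (\<integral>\<^sup>+x. liminf (\<lambda>n. ennreal ((norm (g n x))\<^sup>2)) \<partial>M)"
  proof (rule nn_integral_cong_AE)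
    show "AE x in M. ennreal ((norm (l x))\<^sup>2) = liminf (\<lambda>n. ennreal ((norm (g n x))\<^sup>2))"
      using lim
    proof eventually_elim
      case (elim x)
      have "(\<lambda>n. ennreal ((norm (g n x))\<^sup>2)) \<longlonglongrightarrow> ennreal ((norm (l x))\<^sup>2)"
        by (intro tendsto_ennrealI tendsto_intros elim)
      then show ?case by (rule lim_imp_Liminf[OF sequentially_bot, symmetric])
    qed
  qed
  also have "\<dots> \<le> liminf (\<lambda>n. \<integral>\<^sup>+x. ennreal ((norm (g n x))\<^sup>2) \<partial>M)"
    by (rule nn_integral_liminf) (use g in measurable)
  also have "\<dots> \<le> I" by (rule Liminf_le) (use le in auto)
  finally show ?thesis .
qed

lemma interval_average_tendsto:
  fixes g :: "real \<Rightarrow> complex"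
  assumes g: "continuous_on UNIV g" and h: "h \<longlonglongrightarrow> 0" "\<And>n. h n > 0"
  shows "(\<lambda>n. (LINT t:{- h n..h n}|lborel. g t) /\<^sub>R (2 * h n)) \<longlonglongrightarrow> g 0"
proof (rule LIMSEQ_I)
  fix e :: real assume e: "e > 0"
  have "isCont g 0" using g by (simp add: continuous_on_eq_continuous_at)
  then obtain d where d: "d > 0" "\<And>t. \<bar>t\<bar> < d \<Longrightarrow> norm (g t - g 0) < e/2"
    unfolding continuous_at_eps_delta dist_norm using half_gt_zero[OF e] by (metis diff_zero real_norm_def)
  obtain n0 where n0: "\<And>n. n \<ge> n0 \<Longrightarrow> h n < d"
    using order_tendstoD(2)[OF h(1) d(1)] unfolding eventually_sequentially by blast
  show "\<exists>n0. \<forall>n\<ge>n0. norm ((LINT t:{- h n..h n}|lborel. g t) /\<^sub>R (2 * h n) - g 0) < e"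
  proof (intro exI[of _ n0] allI impI)
    fix n assume n: "n \<ge> n0"
    have I: "set_integrable lborel {- h n..h n} k" if "continuous_on UNIV k" for k :: "real \<Rightarrow> complex"
      by (intro borel_integrable_atLeastAtMost' continuous_on_subset[OF that]) simp
    have c: "(LINT t:{- h n..h n}|lborel. c) = (2 * h n) *\<^sub>R c" for c :: "'b::{banach,second_countable_topology}"
      using h(2)[of n] by (simp add: set_lebesgue_integral_def scaleR_left_distrib)
    have "(LINT t:{- h n..h n}|lborel. g t) - (2 * h n) *\<^sub>R g 0 = (LINT t:{- h n..h n}|lborel. g t - g 0)"
      unfolding c[symmetric] by (rule set_integral_diff(2)[symmetric]) (intro I g continuous_intros)+
    also have "norm \<dots> \<le> (LINT t:{- h n..h n}|lborel. e/2)"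
      unfolding set_lebesgue_integral_def
    proof (rule Bochner_Integration.integral_norm_bound_integral)
      show "integrable lborel (\<lambda>t. indicator {- h n..h n} t *\<^sub>R (g t - g 0))"
        using I[of "\<lambda>t. g t - g 0"] g by (simp add: set_integrable_def continuous_intros)
      show "norm (indicator {- h n..h n} t *\<^sub>R (g t - g 0)) \<le> indicator {- h n..h n} t *\<^sub>R (e/2)" for t
        using d(2)[of t] n0[OF n] by (auto simp: indicator_def abs_le_iff abs_less_iff)
    qed (use h(2)[of n] in auto)
    also have "\<dots> = h n * e" unfolding c by simp
    finally have 1: "norm ((LINT t:{- h n..h n}|lborel. g t) - (2 * h n) *\<^sub>R g 0) \<le> h n * e" .
    have "(LINT t:{- h n..h n}|lborel. g t) /\<^sub>R (2 * h n) - g 0 = ((LINT t:{- h n..h n}|lborel. g t) - (2 * h n) *\<^sub>R g 0) /\<^sub>R (2 * h n)"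
      using h(2)[of n] by (simp add: scaleR_diff_right)
    then have "norm ((LINT t:{- h n..h n}|lborel. g t) /\<^sub>R (2 * h n) - g 0) \<le> (h n * e) / (2 * h n)"
      using 1 h(2)[of n] by (simp add: divide_simps mult.commute)
    also have "\<dots> < e" using h(2)[of n] e by simp
    finally show "norm ((LINT t:{- h n..h n}|lborel. g t) /\<^sub>R (2 * h n) - g 0) < e" .
  qed
qed

lemma symmetric_quotient_tendsto:
  fixes g :: "real \<Rightarrow> complex"
  assumes g: "(g has_vector_derivative d) (at t)" and k: "k \<longlonglongrightarrow> 0" "\<And>n. k n > 0"
  shows "(\<lambda>n. (g (t + k n) - g (t - k n)) /\<^sub>R (2 * k n)) \<longlonglongrightarrow> d"
proof -
  have q: "((\<lambda>h. (g (t + h) - g t) /\<^sub>R h) \<longlongrightarrow> d) (at 0)"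
    by (rule has_vector_derivative_quotient[OF g])
  have 1: "filterlim k (at 0) sequentially"
    using k by (intro filterlim_atI) (auto simp: less_imp_neq[symmetric])
  have 2: "filterlim (\<lambda>n. - k n) (at 0) sequentially"
    using tendsto_minus[OF k(1)] k(2) by (intro filterlim_atI) (auto simp: less_imp_neq[symmetric])
  have "(\<lambda>n. ((g (t + k n) - g t) /\<^sub>R k n + (g (t + - k n) - g t) /\<^sub>R (- k n)) /\<^sub>R 2) \<longlonglongrightarrow> (d + d) /\<^sub>R 2"
    by (intro tendsto_intros filterlim_compose[OF q 1] filterlim_compose[OF q 2])
  moreover have "((g (t + k n) - g t) /\<^sub>R k n + (g (t + - k n) - g t) /\<^sub>R (- k n)) /\<^sub>R 2 = (g (t + k n) - g (t - k n)) /\<^sub>R (2 * k n)" for n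
    using k(2)[of n] by (simp add: algebra_simps)
  moreover have "(d + d) /\<^sub>R 2 = d" by (simp add: scaleR_2[symmetric])
  ultimately show ?thesis by simp
qed

lemma measure_rect: "k > 0 \<Longrightarrow> h > 0 \<Longrightarrow> measure lborel (rect (-k) k (-h) h) = 4 * k * h"
proof -
  assume "k > 0" "h > 0"
  then have "measure lborel (cbox (-k, -h) (k, h)) = (\<Prod>b\<in>Basis. ((k, h) - (-k, -h)) \<bullet> b)"
    by (subst measure_lborel_cbox_eq) (auto simp: Basis_prod_def)
  also have "\<dots> = (2 * k) * (2 * h)"
  proof -
    have "Basis = {(1::real, 0::real), (0, 1)}" by (auto simp: Basis_prod_def)
    then show ?thesis unfolding \<open>Basis = _\<close> by (simp add: inner_prod_def)
  qed
  finally show ?thesis by (simp add: rect_eq_cbox)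
qed

lemma integrable_bounded_support:
  fixes g :: "'a::euclidean_space \<Rightarrow> complex"
  assumes g: "g \<in> borel_measurable borel" and "bounded S" and "S \<in> sets borel"
    and "\<And>p. p \<notin> S \<Longrightarrow> g p = 0" and "\<And>p. norm (g p) \<le> C"
  shows "integrable lborel g"
proof (rule Bochner_Integration.integrable_bound)
  show "integrable lborel (\<lambda>p. indicator S p *\<^sub>R C)"
    using emeasure_bounded_finite[OF assms(2)] assms(3) by simp
  show "AE p in lborel. norm (g p) \<le> norm (indicator S p *\<^sub>R C)"
    using assms(4,5) by (intro AE_I2) (force simp: indicator_def intro: order_trans)
qed (use g in simp)

locale compactly_supported_dbar = integrable_dbar +
  fixes B :: real
  assumes supp: "\<And>p. p \<notin> rect (-B) B (-B) B \<Longrightarrow> f p = 0"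
begin

lemma f_bounded: obtains M where "\<And>p. norm (f p) \<le> M" "M \<ge> 0"
proof -
  have "compact (f ` rect (-B) B (-B) B)"
    unfolding rect_eq_cbox by (intro compact_continuous_image continuous_on_subset[OF f_cont] compact_cbox) auto
  then obtain M where "\<forall>z\<in>f ` rect (-B) B (-B) B. norm z \<le> M"
    using compact_imp_bounded bounded_iff by blast
  then have "norm (f p) \<le> max M 0" for p
    using supp[of p] by (cases "p \<in> rect (-B) B (-B) B") (auto simp: le_max_iff_disj)
  then show ?thesis using that[of "max M 0"] by simp
qed

text \<open>Increments averaged over the sides of a rectangle: \<open>incr_x k h\<close> is convolution with an
odd kernel that approximates \<open>4 k h\<close> times the horizontal derivative, and likewise for \<open>incr_y\<close>. They
replace the partial derivatives, about which nothing is known separately, and Green's formula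
evaluates exactly the combination that is known.\<close>

definition incr_x :: "real \<Rightarrow> real \<Rightarrow> real \<times> real \<Rightarrow> complex" where
  "incr_x k h p = (LINT t:{-h..h}|lborel. f (p + (k, t)) - f (p + (-k, t)))"

definition incr_y :: "real \<Rightarrow> real \<Rightarrow> real \<times> real \<Rightarrow> complex" where
  "incr_y k h p = (LINT s:{-k..k}|lborel. f (p + (s, h)) - f (p + (s, -h)))"

lemma incr_dbar:
  assumes "k > 0" "h > 0"
  shows "incr_x k h p + \<i> * incr_y k h p = (LINT q:rect (-k) k (-h) h|lborel. D (p + q))"
proof -
  obtain x y where p: "p = (x, y)" by (cases p)
  have x_eq: "incr_x k h p = (LINT y':{y-h..y+h}|lborel. f (x + k, y') - f (x - k, y'))"
    unfolding set_lebesgue_integral_def incr_x_def p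
    by (subst lborel_integral_real_affine[of 1 _ y])
       (auto intro!: Bochner_Integration.integral_cong simp: indicator_def)
  have y_eq: "incr_y k h p = (LINT x':{x-k..x+k}|lborel. f (x', y + h) - f (x', y - h))"
    unfolding set_lebesgue_integral_def incr_y_def p
    by (subst lborel_integral_real_affine[of 1 _ x])
       (auto intro!: Bochner_Integration.integral_cong simp: indicator_def)
  have "incr_x k h p + \<i> * incr_y k h p = (LINT q:rect (x - k) (x + k) (y - h) (y + h)|lborel. D q)"
    unfolding x_eq y_eq by (rule Green_rectangle) (use assms in auto)
  also have "\<dots> = (LINT q|lborel. indicator (rect (x - k) (x + k) (y - h) (y + h)) (p + q) *\<^sub>R D (p + q))"
    unfolding set_lebesgue_integral_def by (subst lborel_translate(1)[of _ p]) simp_all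
  also have "\<dots> = (LINT q:rect (-k) k (-h) h|lborel. D (p + q))"
    unfolding set_lebesgue_integral_def
    by (rule Bochner_Integration.integral_cong[OF refl]) (auto simp: indicator_def p)
  finally show ?thesis .
qed

text \<open>By Green's formula the left hand side averages \<open>fx + \<i> fy\<close> over translates of a rectangle, and
averaging does not increase the norm of \<open>L\<^sup>2\<close>.\<close>

lemma nn_integral_incr_dbar_le:
  assumes "k > 0" "h > 0"
  shows "(\<integral>\<^sup>+p. ennreal ((norm (incr_x k h p + \<i> * incr_y k h p))\<^sup>2) \<partial>lborel)
    \<le> ennreal ((4 * k * h)\<^sup>2) * (\<integral>\<^sup>+p. ennreal ((norm (D p))\<^sup>2) \<partial>lborel)"
proof -
  define R where "R = rect (-k) k (-h) h"
  have [measurable]: "R \<in> sets borel" by (simp add: R_def)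
  have mR: "measure lborel R = 4 * k * h" using measure_rect assms by (simp add: R_def)
  have fR: "emeasure lborel R < \<infinity>" unfolding R_def by (rule emeasure_rect_finite)
  have 1: "ennreal ((norm (incr_x k h p + \<i> * incr_y k h p))\<^sup>2) \<le> ennreal (4 * k * h) * (\<integral>\<^sup>+q. indicator R q * ennreal ((norm (D (p + q)))\<^sup>2) \<partial>lborel)" for p
    unfolding incr_dbar[OF assms] R_def[symmetric] mR[symmetric]
  proof (rule norm_set_integral_square_le)
    show "set_integrable lborel R (\<lambda>q. D (p + q))"
      unfolding set_integrable_def using D_int lborel_translate(2)[of D p]
      by (intro integrable_mult_indicator) auto
  qed (use fR in auto)
  have "(\<integral>\<^sup>+p. ennreal ((norm (incr_x k h p + \<i> * incr_y k h p))\<^sup>2) \<partial>lborel)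
     \<le> (\<integral>\<^sup>+p. ennreal (4 * k * h) * (\<integral>\<^sup>+q. indicator R q * ennreal ((norm (D (p + q)))\<^sup>2) \<partial>lborel) \<partial>lborel)"
    by (intro nn_integral_mono 1)
  also have "\<dots> = ennreal (4 * k * h) * (\<integral>\<^sup>+p. (\<integral>\<^sup>+q. indicator R q * ennreal ((norm (D (p + q)))\<^sup>2) \<partial>lborel) \<partial>lborel)"
    by (rule nn_integral_cmult) measurable
  also have "(\<integral>\<^sup>+p. (\<integral>\<^sup>+q. indicator R q * ennreal ((norm (D (p + q)))\<^sup>2) \<partial>lborel) \<partial>lborel)
     = (\<integral>\<^sup>+q. (\<integral>\<^sup>+p. indicator R q * ennreal ((norm (D (p + q)))\<^sup>2) \<partial>lborel) \<partial>lborel)"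
    by (rule lborel_pair.Fubini'[symmetric]) measurable
  also have "\<dots> = (\<integral>\<^sup>+q. indicator R q * (\<integral>\<^sup>+p. ennreal ((norm (D p))\<^sup>2) \<partial>lborel) \<partial>lborel)"
  proof (rule nn_integral_cong)
    fix q
    have "(\<integral>\<^sup>+p. ennreal ((norm (D (p + q)))\<^sup>2) \<partial>lborel) = (\<integral>\<^sup>+p. ennreal ((norm (D p))\<^sup>2) \<partial>lborel)"
      using nn_integral_lborel_translate[of "\<lambda>p. ennreal ((norm (D p))\<^sup>2)" q] by (simp add: add.commute)
    then show "(\<integral>\<^sup>+p. indicator R q * ennreal ((norm (D (p + q)))\<^sup>2) \<partial>lborel) = indicator R q * (\<integral>\<^sup>+p. ennreal ((norm (D p))\<^sup>2) \<partial>lborel)"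
      by (subst nn_integral_cmult) auto
  qed
  also have "\<dots> = emeasure lborel R * (\<integral>\<^sup>+p. ennreal ((norm (D p))\<^sup>2) \<partial>lborel)"
    by (subst nn_integral_multc) auto
  also have "emeasure lborel R = ennreal (4 * k * h)"
    using fR mR by (simp add: emeasure_eq_ennreal_measure less_top)
  finally have le: "(\<integral>\<^sup>+p. ennreal ((norm (incr_x k h p + \<i> * incr_y k h p))\<^sup>2) \<partial>lborel)
     \<le> ennreal (4 * k * h) * (ennreal (4 * k * h) * (\<integral>\<^sup>+p. ennreal ((norm (D p))\<^sup>2) \<partial>lborel))" .
  show ?thesis
  proof -
    have "ennreal ((4 * k * h)\<^sup>2) = ennreal (4 * k * h) * ennreal (4 * k * h)"
      unfolding power2_eq_square using assms by (intro ennreal_mult) auto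
    then show ?thesis
      using le by (simp only: mult.assoc)
  qed
qed

definition corr :: "real \<times> real \<Rightarrow> complex" where
  "corr w = (LINT p|lborel. f p * cnj (f (p + w)))"

lemma integrable_shift_product: "integrable lborel (\<lambda>p. f (p + a) * cnj (f (p + b)))"
proof -
  obtain M where M: "\<And>p. norm (f p) \<le> M" "M \<ge> 0" using f_bounded by blast
  show ?thesis
  proof (rule integrable_bounded_support)
    show "bounded (cbox ((-B, -B) - a) ((B, B) - a))" by simp
    show "f (p + a) * cnj (f (p + b)) = 0" if "p \<notin> cbox ((-B, -B) - a) ((B, B) - a)" for p
    proof -
      have "p + a \<notin> rect (-B) B (-B) B"
        using that by (cases p; cases a) (auto simp: cbox_Pair_eq algebra_simps)
      then show ?thesis using supp by simp
    qed
    show "norm (f (p + a) * cnj (f (p + b))) \<le> M * M" for p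
      using M by (simp add: norm_mult mult_mono)
    show "(\<lambda>p. f (p + a) * cnj (f (p + b))) \<in> borel_measurable borel"
      by (intro borel_measurable_continuous_onI continuous_intros f_cont_comp)
  qed simp
qed

lemma corr_shift: "(LINT p|lborel. f (p + a) * cnj (f (p + b))) = corr (b - a)"
proof -
  have "(LINT p|lborel. f (p + a) * cnj (f (p + b))) = (LINT p|lborel. (\<lambda>q. f q * cnj (f (q + (b - a)))) (a + p))"
    by (rule Bochner_Integration.integral_cong[OF refl]) (simp add: algebra_simps)
  also have "\<dots> = corr (b - a)"
    unfolding corr_def
    by (rule lborel_translate(1)) (intro borel_measurable_continuous_onI continuous_intros f_cont_comp)
  finally show ?thesis .
qed

lemma cnj_corr: "cnj (corr w) = corr (- w)"
proof -
  have "cnj (corr w) = (LINT p|lborel. cnj (f p * cnj (f (p + w))))"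
    unfolding corr_def
    by (rule integral_bounded_linear[OF bounded_linear_cnj, symmetric])
       (use integrable_shift_product[of 0 w] in simp)
  also have "\<dots> = (LINT p|lborel. f (p + w) * cnj (f (p + 0)))"
    by (simp add: mult.commute)
  also have "\<dots> = corr (- w)" by (subst corr_shift) simp
  finally show ?thesis .
qed

text \<open>This is the discrete form of the fact that the Jacobian determinant of a compactly supported
function has integral zero. Averaging operators with odd kernels are antisymmetric and commute, so
the inner product of the two increments of \<open>f\<close> equals its own conjugate. Written out, it is the
integral of \<open>G (t, s)\<close>, the inner product of a horizontal and a vertical difference; expressed by
the correlation function of \<open>f\<close>, the reflection \<open>(t, s) \<mapsto> (-t, -s)\<close> turns \<open>G\<close> into its conjugate.\<close>

lemma inner_product_incr_real:
  assumes "k > 0" "h > 0"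
  shows "integrable lborel (\<lambda>p. incr_x k h p * cnj (incr_y k h p))"
    and "Im (LINT p|lborel. incr_x k h p * cnj (incr_y k h p)) = 0"
proof -
  obtain M where M: "\<And>p. norm (f p) \<le> M" "M \<ge> 0" using f_bounded by blast
  define R where "R = rect (-h) h (-k) k"
  have [measurable]: "R \<in> sets borel" by (simp add: R_def)
  define x where "x t p = f (p + (k, t)) - f (p + (-k, t))" for t p
  define y where "y s p = f (p + (s, h)) - f (p + (s, -h))" for s p
  have xc: "continuous_on S (\<lambda>z. x (g1 z) (g2 z))" and yc: "continuous_on S (\<lambda>z. y (g1 z) (g2 z))"
    if "continuous_on S g1" "continuous_on S g2" for S and g1 :: "'c::topological_space \<Rightarrow> real" and g2
    unfolding x_def y_def by (intro continuous_intros f_cont_comp that)+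
  define K where "K z = indicator R (snd z) *\<^sub>R (x (fst (snd z)) (fst z) * cnj (y (snd (snd z)) (fst z)))" for z :: "(real \<times> real) \<times> (real \<times> real)"
  have x_le: "norm (x t p) \<le> 2 * M" and y_le: "norm (y t p) \<le> 2 * M" for t p
    unfolding x_def y_def using norm_triangle_ineq4 M(1) by (metis add_mono mult_2 order_trans)+
  have K_le: "norm (K z) \<le> (2 * M) * (2 * M)" for z
  proof -
    have "norm (x (fst (snd z)) (fst z)) * norm (y (snd (snd z)) (fst z)) \<le> (2 * M) * (2 * M)"
      using M(2) by (intro mult_mono x_le y_le) auto
    moreover have "0 \<le> (2 * M) * (2 * M)" using M(2) by simp
    ultimately show ?thesis unfolding K_def norm_scaleR norm_mult complex_mod_cnj
      by (cases "snd z \<in> R") (simp_all del: mult.assoc)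
  qed
  define L where "L = B + k + h"
  have K_int: "integrable lborel K"
  proof (rule integrable_bounded_support)
    have [measurable]: "(snd :: (real \<times> real) \<times> (real \<times> real) \<Rightarrow> _) \<in> borel_measurable borel"
      by (intro borel_measurable_continuous_onI continuous_intros)
    have [measurable]: "(\<lambda>z. x (fst (snd z)) (fst z) * cnj (y (snd (snd z)) (fst z))) \<in> borel_measurable borel"
      by (intro borel_measurable_continuous_onI continuous_intros xc yc)
    show "K \<in> borel_measurable borel" unfolding K_def by measurable
    show "bounded (rect (-L) L (-L) L \<times> R)"
      unfolding R_def rect_eq_cbox by (intro bounded_Times bounded_cbox)
    show "rect (-L) L (-L) L \<times> R \<in> sets borel"
      unfolding R_def rect_eq_cbox by (intro borel_closed closed_Times closed_cbox)
    show "K z = 0" if "z \<notin> rect (-L) L (-L) L \<times> R" for z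
    proof (cases "snd z \<in> R")
      case True
      obtain p1 p2 t s where z: "z = ((p1, p2), (t, s))" by (metis surj_pair)
      have "x t (p1, p2) = 0"
        using True that z assms unfolding x_def by (subst (1 2) supp) (auto simp: R_def L_def)
      then show ?thesis by (simp add: K_def z)
    qed (simp add: K_def)
    show "norm (K z) \<le> (2 * M) * (2 * M)" for z by (rule K_le)
  qed
  have K_int': "integrable (lborel \<Otimes>\<^sub>M lborel) (\<lambda>(p, w). K (p, w))"
    using K_int by (simp add: lborel_prod)
  have slice: "(LINT w|lborel. K (p, w)) = incr_x k h p * cnj (incr_y k h p)" for p
  proof -
    have "integrable lborel (\<lambda>w. K (p, w))"
    proof (rule integrable_bounded_support)
      have [measurable]: "(\<lambda>w. x (fst w) p * cnj (y (snd w) p)) \<in> borel_measurable borel"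
        by (intro borel_measurable_continuous_onI continuous_intros xc yc)
      show "(\<lambda>w. K (p, w)) \<in> borel_measurable borel"
        unfolding K_def by simp
      show "bounded R" "R \<in> sets borel" unfolding R_def rect_eq_cbox by auto
      show "norm (K (p, w)) \<le> (2 * M) * (2 * M)" for w by (rule K_le)
    qed (simp add: K_def)
    then have "(LINT w|lborel. K (p, w)) = (LINT t|lborel. LINT s|lborel. K (p, (t, s)))"
      by (rule lborel_prod_Fubini(1))
    also have "\<dots> = (LINT t|lborel. LINT s|lborel. (indicator {-h..h} t *\<^sub>R x t p) * (indicator {-k..k} s *\<^sub>R cnj (y s p)))"
      by (intro Bochner_Integration.integral_cong refl) (auto simp: K_def R_def indicator_def)
    also have "\<dots> = (LINT t|lborel. (indicator {-h..h} t *\<^sub>R x t p) * (LINT s|lborel. indicator {-k..k} s *\<^sub>R cnj (y s p)))"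
      by (simp only: integral_mult_right_zero)
    also have "\<dots> = (LINT t|lborel. indicator {-h..h} t *\<^sub>R x t p) * (LINT s|lborel. indicator {-k..k} s *\<^sub>R cnj (y s p))"
      by (rule integral_mult_left_zero)
    also have "\<dots> = incr_x k h p * (LINT s:{-k..k}|lborel. cnj (y s p))"
      by (simp add: incr_x_def x_def set_lebesgue_integral_def)
    also have "(LINT s:{-k..k}|lborel. cnj (y s p)) = cnj (incr_y k h p)"
    proof -
      have "set_integrable lborel {-k..k} (\<lambda>s. y s p)"
        by (intro borel_integrable_atLeastAtMost' yc continuous_intros)
      from integral_bounded_linear[OF bounded_linear_cnj this[unfolded set_integrable_def]]
      show ?thesis by (simp add: incr_y_def y_def set_lebesgue_integral_def)
    qed
    finally show ?thesis .
  qed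
  show "integrable lborel (\<lambda>p. incr_x k h p * cnj (incr_y k h p))"
    using lborel_pair.integrable_fst'[of K] K_int' by (simp add: slice)
  define G where "G w = (LINT p|lborel. x (fst w) p * cnj (y (snd w) p))" for w
  have G_eq: "G (t, s) = corr (s - k, h - t) - corr (s - k, - h - t) - corr (s + k, h - t) + corr (s + k, - h - t)" for t s
  proof -
    have "G (t, s) = (LINT p|lborel. ((f (p + (k, t)) * cnj (f (p + (s, h))) - f (p + (k, t)) * cnj (f (p + (s, -h))))
       - f (p + (-k, t)) * cnj (f (p + (s, h)))) + f (p + (-k, t)) * cnj (f (p + (s, -h))))"
      unfolding G_def x_def y_def by (rule Bochner_Integration.integral_cong[OF refl]) (simp add: algebra_simps)
    also have "\<dots> = corr ((s, h) - (k, t)) - corr ((s, -h) - (k, t)) - corr ((s, h) - (-k, t)) + corr ((s, -h) - (-k, t))"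
      unfolding corr_shift[symmetric]
      by (subst Bochner_Integration.integral_add Bochner_Integration.integral_diff, (intro integrable_shift_product Bochner_Integration.integrable_diff)+)+ (rule refl)
    finally show ?thesis by simp
  qed
  have G_sym: "cnj (G w) = G (- w)" for w
    by (cases w) (simp add: G_eq cnj_corr algebra_simps)
  define T where "T = (LINT p|lborel. incr_x k h p * cnj (incr_y k h p))"
  have "T = (LINT p|lborel. LINT w|lborel. K (p, w))" by (simp add: T_def slice)
  also have "\<dots> = (LINT w|lborel. LINT p|lborel. K (p, w))"
    by (rule lborel_pair.Fubini_integral[symmetric]) (use K_int' in simp)
  also have "\<dots> = (LINT w|lborel. indicator R w *\<^sub>R G w)"
    by (intro Bochner_Integration.integral_cong refl) (simp add: K_def G_def)
  finally have T: "T = (LINT w|lborel. indicator R w *\<^sub>R G w)" .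
  have G_int: "integrable lborel (\<lambda>w. indicator R w *\<^sub>R G w)"
  proof -
    have "integrable lborel (\<lambda>w. LINT p|lborel. K (p, w))"
      using lborel_pair.integrable_snd[of "\<lambda>p w. K (p, w)"] K_int' by simp
    then show ?thesis by (simp add: K_def G_def)
  qed
  have "cnj T = (LINT w|lborel. indicator R w *\<^sub>R G (- w))"
    unfolding T using integral_bounded_linear[OF bounded_linear_cnj G_int] by (simp add: G_sym)
  also have "\<dots> = (LINT w|lborel. (\<lambda>w. indicator R w *\<^sub>R G w) (0 + (-1) *\<^sub>R w))"
    by (intro Bochner_Integration.integral_cong refl) (auto simp: indicator_def R_def)
  also have "\<dots> = T"
    using lborel_integral_affine[OF borel_measurable_integrable[OF G_int, simplified], of "-1" 0] unfolding T by simp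
  finally have "cnj T = T" .
  then show "Im (LINT p|lborel. incr_x k h p * cnj (incr_y k h p)) = 0"
    unfolding T_def[symmetric] by (metis complex_cnj_cancel_iff Reals_cnj_iff complex_is_Real_iff)
qed

end

context compactly_supported_dbar
begin

lemma incr_x_measurable[measurable]: "incr_x k h \<in> borel_measurable borel"
  unfolding incr_x_def[abs_def] set_lebesgue_integral_def by measurable

lemma incr_y_measurable[measurable]: "incr_y k h \<in> borel_measurable borel"
  unfolding incr_y_def[abs_def] set_lebesgue_integral_def by measurable

lemma increment_integral_square_integrable:
  fixes W :: "real \<times> real \<Rightarrow> complex" and l :: real
  assumes W: "W \<in> borel_measurable borel" and a: "\<And>t. t \<in> {-l..l} \<Longrightarrow> norm (a t) \<le> L" "\<And>t. t \<in> {-l..l} \<Longrightarrow> norm (b t) \<le> L"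
    and W_eq: "\<And>p. W p = (LINT t:{-l..l}|lborel. f (p + a t) - f (p + b t))"
  shows "integrable lborel (\<lambda>p. W p * cnj (W p))"
proof -
  obtain M where M: "\<And>p. norm (f p) \<le> M" "M \<ge> 0" using f_bounded by blast
  have W_le: "norm (W p) \<le> 2 * M * measure lborel {-l..l}" for p
  proof (cases "set_integrable lborel {-l..l} (\<lambda>t. f (p + a t) - f (p + b t))")
    case True
    have "norm (W p) \<le> (LINT t|lborel. indicator {-l..l} t * (2 * M))"
      unfolding W_eq set_lebesgue_integral_def
    proof (rule Bochner_Integration.integral_norm_bound_integral)
      show "norm (indicator {-l..l} t *\<^sub>R (f (p + a t) - f (p + b t))) \<le> indicator {-l..l} t * (2 * M)" for t
        using norm_triangle_ineq4[of "f (p + a t)" "f (p + b t)"] M(1)[of "p + a t"] M(1)[of "p + b t"] by (auto simp: indicator_def)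
    qed (use True emeasure_lborel_cbox_finite[of "-l" l] in
        \<open>auto simp: set_integrable_def intro!: integrable_mult_left integrable_real_indicator\<close>)
    then show ?thesis by (auto simp: algebra_simps split: if_splits)
  next
    case False
    then show ?thesis using M(2) by (simp add: W_eq set_lebesgue_integral_def set_integrable_def not_integrable_integral_eq)
  qed
  define S where "S = cball (0 :: real \<times> real) (2 * \<bar>B\<bar> + L)"
  have W_supp: "W p = 0" if "p \<notin> S" for p
  proof -
    have "f (p + a t) = 0 \<and> f (p + b t) = 0" if t: "t \<in> {-l..l}" for t
    proof -
      have "p + q \<notin> rect (-B) B (-B) B" if "norm q \<le> L" for q
      proof
        assume "p + q \<in> rect (-B) B (-B) B"
        then have "\<bar>fst (p + q)\<bar> \<le> \<bar>B\<bar>" "\<bar>snd (p + q)\<bar> \<le> \<bar>B\<bar>" by (auto simp: mem_Times_iff)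
        then have "norm (p + q) \<le> 2 * \<bar>B\<bar>"
          using norm_Pair_le[of "fst (p + q)" "snd (p + q)"]
            by (simp del: fst_add snd_add)
        then have "norm p \<le> 2 * \<bar>B\<bar> + L"
          using norm_triangle_ineq4[of "p + q" q] that by simp
        then show False using \<open>p \<notin> S\<close> by (simp add: S_def)
      qed
      then show ?thesis using supp a[OF t] by blast
    qed
    then have "indicator {-l..l} t *\<^sub>R (f (p + a t) - f (p + b t)) = 0" for t by (simp add: indicator_def)
    then have "(\<lambda>t. indicator {-l..l} t *\<^sub>R (f (p + a t) - f (p + b t))) = (\<lambda>t. 0)" by (intro ext)
    then show ?thesis by (simp only: W_eq set_lebesgue_integral_def Bochner_Integration.integral_zero)
  qed
  show ?thesis
  proof (rule integrable_bounded_support)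
    show "bounded S" "S \<in> sets borel" by (auto simp: S_def)
    show "norm (W p * cnj (W p)) \<le> (2 * M * measure lborel {-l..l}) * (2 * M * measure lborel {-l..l})" for p
      unfolding norm_mult complex_mod_cnj using M(2) by (intro mult_mono W_le) auto
    show "(\<lambda>p. W p * cnj (W p)) \<in> borel_measurable borel"
    proof -
      have "cnj \<in> borel_measurable borel" by (intro borel_measurable_continuous_onI continuous_intros)
      from measurable_compose[OF W this] show ?thesis using W by measurable
    qed
  qed (use W_supp in simp)
qed

lemma square_integrable_incr:
  shows "integrable lborel (\<lambda>p. (norm (incr_x k h p))\<^sup>2)" and "integrable lborel (\<lambda>p. (norm (incr_y k h p))\<^sup>2)"
proof -
  have "integrable lborel (\<lambda>p. incr_x k h p * cnj (incr_x k h p))"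
  proof (rule increment_integral_square_integrable)
    show "norm (k, t) \<le> \<bar>k\<bar> + \<bar>h\<bar>" "norm (-k, t) \<le> \<bar>k\<bar> + \<bar>h\<bar>" if "t \<in> {-h..h}" for t
      using norm_Pair_le[of k t] norm_Pair_le[of "-k" t] that by auto
  qed (rule incr_x_measurable, rule incr_x_def)
  then show "integrable lborel (\<lambda>p. (norm (incr_x k h p))\<^sup>2)"
    by (drule_tac integrable_norm) (simp add: norm_mult power2_eq_square)
  have "integrable lborel (\<lambda>p. incr_y k h p * cnj (incr_y k h p))"
  proof (rule increment_integral_square_integrable)
    show "norm (s, h) \<le> \<bar>k\<bar> + \<bar>h\<bar>" "norm (s, -h) \<le> \<bar>k\<bar> + \<bar>h\<bar>" if "s \<in> {-k..k}" for s
      using norm_Pair_le[of s h] norm_Pair_le[of s "-h"] that by auto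
  qed (rule incr_y_measurable, rule incr_y_def)
  then show "integrable lborel (\<lambda>p. (norm (incr_y k h p))\<^sup>2)"
    by (drule_tac integrable_norm) (simp add: norm_mult power2_eq_square)
qed

text \<open>Since the mixed term vanishes, \<open>incr_x + \<i> incr_y\<close> has the squared norm of \<open>incr_x\<close> plus that of
\<open>incr_y\<close>.\<close>

lemma nn_integral_incr_le:
  assumes "k > 0" "h > 0"
  shows "(\<integral>\<^sup>+p. ennreal ((norm (incr_x k h p /\<^sub>R (4 * k * h)))\<^sup>2) \<partial>lborel) \<le> (\<integral>\<^sup>+p. ennreal ((norm (D p))\<^sup>2) \<partial>lborel)" (is "?X \<le> ?I")
    and "(\<integral>\<^sup>+p. ennreal ((norm (incr_y k h p /\<^sub>R (4 * k * h)))\<^sup>2) \<partial>lborel) \<le> (\<integral>\<^sup>+p. ennreal ((norm (D p))\<^sup>2) \<partial>lborel)" (is "?Y \<le> _")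
proof -
  define c where "c = 4 * k * h"
  have c: "c > 0" using assms by (simp add: c_def)
  have expand: "(norm (x + \<i> * y))\<^sup>2 = (norm x)\<^sup>2 + (norm y)\<^sup>2 + 2 * Im (x * cnj y)" for x y
    unfolding cmod_power2 by (simp add: power2_eq_square algebra_simps)
  define J where "J p = Im (incr_x k h p * cnj (incr_y k h p))" for p
  have J_int: "integrable lborel J"
    unfolding J_def[abs_def] using inner_product_incr_real(1)[OF assms] by (rule integrable_Im)
  have "(LINT p|lborel. J p) = 0"
    unfolding J_def
    using integral_bounded_linear[OF bounded_linear_Im inner_product_incr_real(1)[OF assms]]
      inner_product_incr_real(2)[OF assms] by (simp only:)
  then have iso: "(LINT p|lborel. (norm (incr_x k h p + \<i> * incr_y k h p))\<^sup>2) = (LINT p|lborel. (norm (incr_x k h p))\<^sup>2) + (LINT p|lborel. (norm (incr_y k h p))\<^sup>2)"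
    and int: "integrable lborel (\<lambda>p. (norm (incr_x k h p + \<i> * incr_y k h p))\<^sup>2)"
    unfolding expand J_def[symmetric] using square_integrable_incr[of k h] J_int by simp_all
  have scale: "(\<integral>\<^sup>+p. ennreal ((norm (W p /\<^sub>R c))\<^sup>2) \<partial>lborel) \<le> ?I"
    if W: "integrable lborel (\<lambda>p. (norm (W p))\<^sup>2)"
      and le: "(LINT p|lborel. (norm (W p))\<^sup>2) \<le> (LINT p|lborel. (norm (incr_x k h p + \<i> * incr_y k h p))\<^sup>2)" for W :: "real \<times> real \<Rightarrow> complex"
  proof -
    have m: "(\<lambda>p. ennreal ((norm (W p))\<^sup>2)) \<in> borel_measurable lborel"
      using borel_measurable_integrable[OF W] by measurable
    have "(\<integral>\<^sup>+p. ennreal ((norm (W p))\<^sup>2) \<partial>lborel) = ennreal (LINT p|lborel. (norm (W p))\<^sup>2)"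
      by (rule nn_integral_eq_integral[OF W]) simp
    also have "\<dots> \<le> ennreal (LINT p|lborel. (norm (incr_x k h p + \<i> * incr_y k h p))\<^sup>2)" by (intro ennreal_leI le)
    also have "\<dots> = (\<integral>\<^sup>+p. ennreal ((norm (incr_x k h p + \<i> * incr_y k h p))\<^sup>2) \<partial>lborel)"
      by (rule nn_integral_eq_integral[OF int, symmetric]) simp
    also have "\<dots> \<le> ennreal (c\<^sup>2) * ?I" unfolding c_def by (rule nn_integral_incr_dbar_le[OF assms])
    finally have 1: "(\<integral>\<^sup>+p. ennreal ((norm (W p))\<^sup>2) \<partial>lborel) \<le> ennreal (c\<^sup>2) * ?I" .
    have "(\<integral>\<^sup>+p. ennreal ((norm (W p /\<^sub>R c))\<^sup>2) \<partial>lborel) = (\<integral>\<^sup>+p. ennreal (1 / c\<^sup>2) * ennreal ((norm (W p))\<^sup>2) \<partial>lborel)"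
    proof (rule nn_integral_cong)
      fix p
      have "(norm (W p /\<^sub>R c))\<^sup>2 = 1 / c\<^sup>2 * (norm (W p))\<^sup>2"
        using c by (simp add: power_mult_distrib power_inverse divide_inverse)
      then show "ennreal ((norm (W p /\<^sub>R c))\<^sup>2) = ennreal (1 / c\<^sup>2) * ennreal ((norm (W p))\<^sup>2)"
        by (simp only: ennreal_mult zero_le_power2 zero_le_divide_1_iff)
    qed
    also have "\<dots> = ennreal (1 / c\<^sup>2) * (\<integral>\<^sup>+p. ennreal ((norm (W p))\<^sup>2) \<partial>lborel)"
      by (rule nn_integral_cmult[OF m])
    also have "\<dots> \<le> ennreal (1 / c\<^sup>2) * (ennreal (c\<^sup>2) * ?I)"
      by (intro mult_left_mono 1) simp
    also have "\<dots> = ennreal (1 / c\<^sup>2 * c\<^sup>2) * ?I"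
      by (subst ennreal_mult) (auto simp: mult.assoc)
    also have "\<dots> = ?I" using c by simp
    finally show ?thesis .
  qed
  have "(LINT p|lborel. (norm (incr_x k h p))\<^sup>2) \<ge> 0" "(LINT p|lborel. (norm (incr_y k h p))\<^sup>2) \<ge> 0"
    by (simp_all add: integral_nonneg_AE)
  then show "?X \<le> ?I" "?Y \<le> ?I"
    unfolding c_def[symmetric] using iso square_integrable_incr[of k h] by (intro scale; simp)+
qed

text \<open>Divided by \<open>4 k h\<close>, the averaged increments converge to the partial derivatives at every point that
is not exceptional, provided that the length of the averaging segment tends to zero first.
Fatou's lemma is applied to the two limits one after the other.\<close>

theorem partials_square_integrable:
  shows "(\<integral>\<^sup>+p. ennreal ((norm (fx p))\<^sup>2) \<partial>lborel) \<le> (\<integral>\<^sup>+p. ennreal ((norm (D p))\<^sup>2) \<partial>lborel)"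
    and "(\<integral>\<^sup>+p. ennreal ((norm (fy p))\<^sup>2) \<partial>lborel) \<le> (\<integral>\<^sup>+p. ennreal ((norm (D p))\<^sup>2) \<partial>lborel)"
proof -
  define e where "e n = 1 / real (Suc n)" for n
  have e: "e \<longlonglongrightarrow> 0" "e n > 0" for n
    using LIMSEQ_inverse_real_of_nat by (auto simp: e_def[abs_def] divide_inverse)
  have AE: "AE p in lborel. p \<notin> Z"
    using countable_imp_null_set_lborel[OF Z] by (rule AE_not_in)
  let ?I = "\<integral>\<^sup>+p. ennreal ((norm (D p))\<^sup>2) \<partial>lborel"
  have X1: "(\<integral>\<^sup>+p. ennreal ((norm ((f (p + (k, 0)) - f (p + (-k, 0))) /\<^sub>R (2 * k)))\<^sup>2) \<partial>lborel) \<le> ?I" if k: "k > 0" for k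
  proof (rule Fatou_norm_square[where g="\<lambda>n p. incr_x k (e n) p /\<^sub>R (4 * k * e n)"])
    show "AE p in lborel. (\<lambda>n. incr_x k (e n) p /\<^sub>R (4 * k * e n)) \<longlonglongrightarrow> (f (p + (k, 0)) - f (p + (-k, 0))) /\<^sub>R (2 * k)"
    proof (rule AE_I2)
      fix p
      have "(\<lambda>n. (LINT t:{- e n..e n}|lborel. f (p + (k, t)) - f (p + (-k, t))) /\<^sub>R (2 * e n)) \<longlonglongrightarrow> f (p + (k, 0)) - f (p + (-k, 0))"
        by (rule interval_average_tendsto[OF _ e]) (intro continuous_intros f_cont_comp)
      from tendsto_scaleR[OF tendsto_const[of "inverse (2 * k)"] this]
      show "(\<lambda>n. incr_x k (e n) p /\<^sub>R (4 * k * e n)) \<longlonglongrightarrow> (f (p + (k, 0)) - f (p + (-k, 0))) /\<^sub>R (2 * k)"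
        by (simp add: incr_x_def mult_ac)
    qed
  qed (use nn_integral_incr_le(1)[OF k e(2)] in auto)
  have Y1: "(\<integral>\<^sup>+p. ennreal ((norm ((f (p + (0, h)) - f (p + (0, -h))) /\<^sub>R (2 * h)))\<^sup>2) \<partial>lborel) \<le> ?I" if h: "h > 0" for h
  proof (rule Fatou_norm_square[where g="\<lambda>n p. incr_y (e n) h p /\<^sub>R (4 * e n * h)"])
    show "AE p in lborel. (\<lambda>n. incr_y (e n) h p /\<^sub>R (4 * e n * h)) \<longlonglongrightarrow> (f (p + (0, h)) - f (p + (0, -h))) /\<^sub>R (2 * h)"
    proof (rule AE_I2)
      fix p
      have "(\<lambda>n. (LINT t:{- e n..e n}|lborel. f (p + (t, h)) - f (p + (t, -h))) /\<^sub>R (2 * e n)) \<longlonglongrightarrow> f (p + (0, h)) - f (p + (0, -h))"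
        by (rule interval_average_tendsto[OF _ e]) (intro continuous_intros f_cont_comp)
      from tendsto_scaleR[OF tendsto_const[of "inverse (2 * h)"] this]
      show "(\<lambda>n. incr_y (e n) h p /\<^sub>R (4 * e n * h)) \<longlonglongrightarrow> (f (p + (0, h)) - f (p + (0, -h))) /\<^sub>R (2 * h)"
        by (simp add: incr_y_def mult_ac)
    qed
  qed (use nn_integral_incr_le(2)[OF e(2) h] in auto)
  show "(\<integral>\<^sup>+p. ennreal ((norm (fx p))\<^sup>2) \<partial>lborel) \<le> ?I"
  proof (rule Fatou_norm_square[where g="\<lambda>n p. (f (p + (e n, 0)) - f (p + (- e n, 0))) /\<^sub>R (2 * e n)"])
    show "AE p in lborel. (\<lambda>n. (f (p + (e n, 0)) - f (p + (- e n, 0))) /\<^sub>R (2 * e n)) \<longlonglongrightarrow> fx p"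
      using AE
    proof eventually_elim
      case (elim p)
      then show ?case
        using symmetric_quotient_tendsto[OF fx[of "fst p" "snd p"] e] by (cases p) simp
    qed
  qed (use X1[OF e(2)] in auto)
  show "(\<integral>\<^sup>+p. ennreal ((norm (fy p))\<^sup>2) \<partial>lborel) \<le> ?I"
  proof (rule Fatou_norm_square[where g="\<lambda>n p. (f (p + (0, e n)) - f (p + (0, - e n))) /\<^sub>R (2 * e n)"])
    show "AE p in lborel. (\<lambda>n. (f (p + (0, e n)) - f (p + (0, - e n))) /\<^sub>R (2 * e n)) \<longlonglongrightarrow> fy p"
      using AE
    proof eventually_elim
      case (elim p)
      then show ?case
        using symmetric_quotient_tendsto[OF fy[of "fst p" "snd p"] e] by (cases p) simp
    qed
  qed (use Y1[OF e(2)] in auto)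
qed

end

section \<open>Integration by parts\<close>

context continuous_with_partials
begin

lemma partials_zero_off_support:
  assumes supp: "\<And>p. p \<notin> rect (-B) B (-B) B \<Longrightarrow> f p = 0" and p: "p \<notin> rect (-B) B (-B) B" "p \<notin> Z"
  shows "fx p = 0" "fy p = 0"
proof -
  obtain x y where xy: "p = (x, y)" by (cases p)
  have opn: "open (- rect (-B) B (-B) B)"
    unfolding rect_eq_cbox by (intro open_Compl closed_cbox)
  show "fx p = 0"
  proof -
    have "((\<lambda>t. f (t, y)) has_vector_derivative 0) (at x)"
    proof (rule has_vector_derivative_transform_within_open)
      show "open ((\<lambda>t. (t, y)) -` (- rect (-B) B (-B) B))"
        by (rule open_vimage[OF opn]) (intro continuous_intros)
      show "0 = f (t, y)" if "t \<in> (\<lambda>t. (t, y)) -` (- rect (-B) B (-B) B)" for t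
        using that supp by (simp add: supp)
    qed (use p in \<open>auto simp: xy\<close>)
    then show ?thesis using fx[of x y] p(2) xy vector_derivative_unique_at by blast
  qed
  show "fy p = 0"
  proof -
    have "((\<lambda>t. f (x, t)) has_vector_derivative 0) (at y)"
    proof (rule has_vector_derivative_transform_within_open)
      show "open ((\<lambda>t. (x, t)) -` (- rect (-B) B (-B) B))"
        by (rule open_vimage[OF opn]) (intro continuous_intros)
      show "0 = f (x, t)" if "t \<in> (\<lambda>t. (x, t)) -` (- rect (-B) B (-B) B)" for t
        using that supp by (simp add: supp)
    qed (use p in \<open>auto simp: xy\<close>)
    then show ?thesis using fy[of x y] p(2) xy vector_derivative_unique_at by blast
  qed
qed

text \<open>On almost every vertical line the derivative is integrable, and the fundamental theorem for
countable exceptional sets shows that its integral vanishes.\<close>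

lemma integral_fy_eq_0:
  assumes supp: "\<And>p. p \<notin> rect (-B) B (-B) B \<Longrightarrow> f p = 0" and int: "integrable lborel fy"
  shows "(LINT p|lborel. fy p) = 0"
proof -
  define C where "C = \<bar>B\<bar> + 1"
  have line: "(LINT y|lborel. fy (x, y)) = 0" if I: "integrable lborel (\<lambda>y. fy (x, y))" for x
  proof -
    define S where "S = {y. (x, y) \<in> Z}"
    have S: "countable S"
      unfolding S_def by (rule countable_subset[OF _ countable_image[OF Z, of snd]]) force
    have "((\<lambda>y. fy (x, y)) has_integral (f (x, C) - f (x, -C))) {-C..C}"
    proof (rule fundamental_theorem_of_calculus_countable[OF _ S])
      show "continuous_on {-C..C} (\<lambda>y. f (x, y))" by (intro f_cont_comp continuous_intros)
      show "((\<lambda>y. f (x, y)) has_vector_derivative fy (x, y)) (at y within {-C..C})" if "y \<in> {-C..C} - S" for y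
        using fy[of x y] that by (auto simp: S_def intro: has_vector_derivative_at_within)
    qed (simp add: C_def)
    moreover have "f (x, C) = 0" "f (x, -C) = 0" by (auto intro!: supp simp: C_def)
    ultimately have HK: "integral {-C..C} (\<lambda>y. fy (x, y)) = 0" by (simp add: integral_unique)
    have "set_integrable lborel {-C..C} (\<lambda>y. fy (x, y))"
      unfolding set_integrable_def by (intro integrable_mult_indicator I) simp
    then have zero: "(LINT y:{-C..C}|lborel. fy (x, y)) = 0"
      using HK by (simp add: set_borel_integral_eq_integral(2))
    have "(LINT y|lborel. fy (x, y)) = (LINT y:{-C..C}|lborel. fy (x, y))"
      unfolding set_lebesgue_integral_def
    proof (rule integral_cong_AE)
      show "AE y in lborel. fy (x, y) = indicator {-C..C} y *\<^sub>R fy (x, y)"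
        using AE_not_in[OF countable_imp_null_set_lborel[OF S]]
      proof eventually_elim
        case (elim y)
        have "fy (x, y) = 0" if "y \<notin> {-C..C}"
          using elim that by (intro partials_zero_off_support(2)[of B] supp) (auto simp: S_def C_def)
        then show ?case by (auto simp: indicator_def)
      qed
    qed (measurable)
    then show ?thesis using zero by simp
  qed
  have "(LINT p|lborel. fy p) = (LINT x|lborel. LINT y|lborel. fy (x, y))"
    by (rule lborel_prod_Fubini(1)[OF int])
  also have "\<dots> = (LINT x|(lborel :: real measure). 0)"
  proof (rule integral_cong_AE)
    show "AE x in lborel. (LINT y|lborel. fy (x, y)) = 0"
      using lborel_prod_Fubini(3)[OF int] by eventually_elim (rule line)
  qed (use borel_measurable_integrable[OF lborel_prod_Fubini(2)[OF int]] in auto)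
  finally show ?thesis by simp
qed

lemma integral_fx_eq_0:
  assumes supp: "\<And>p. p \<notin> rect (-B) B (-B) B \<Longrightarrow> f p = 0" and int: "integrable lborel fx"
  shows "(LINT p|lborel. fx p) = 0"
proof -
  interpret sw: continuous_with_partials "f \<circ> prod.swap" "fy \<circ> prod.swap" "fx \<circ> prod.swap" "prod.swap ` Z"
    by (rule swapped)
  have "(LINT p|lborel. (fx \<circ> prod.swap) p) = 0"
  proof (rule sw.integral_fy_eq_0)
    show "(f \<circ> prod.swap) p = 0" if "p \<notin> rect (-B) B (-B) B" for p
      using that by (cases p) (auto intro!: supp)
    show "integrable lborel (fx \<circ> prod.swap)"
      using lborel_prod_swap(2)[of fx] int by (simp add: o_def)
  qed
  then show ?thesis using lborel_prod_swap(1)[of fx] by simp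
qed

lemma times:
  assumes g: "continuous_with_partials g gx gy Z'"
  shows "continuous_with_partials (\<lambda>p. f p * g p) (\<lambda>p. fx p * g p + f p * gx p) (\<lambda>p. fy p * g p + f p * gy p) (Z \<union> Z')"
proof -
  interpret g: continuous_with_partials g gx gy Z' by (rule g)
  show ?thesis
  proof
    show "continuous_on UNIV (\<lambda>p. f p * g p)" by (intro continuous_intros f_cont g.f_cont)
    show "countable (Z \<union> Z')" using Z g.Z by simp
    show "((\<lambda>t. f (t, y) * g (t, y)) has_vector_derivative fx (x, y) * g (x, y) + f (x, y) * gx (x, y)) (at x)"
      if "(x, y) \<notin> Z \<union> Z'" for x y
      using has_vector_derivative_mult[OF fx g.fx, of x y] that by (simp add: add.commute)
    show "((\<lambda>t. f (x, t) * g (x, t)) has_vector_derivative fy (x, y) * g (x, y) + f (x, y) * gy (x, y)) (at y)"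
      if "(x, y) \<notin> Z \<union> Z'" for x y
      using has_vector_derivative_mult[OF fy g.fy, of x y] that by (simp add: add.commute)
    show "(\<lambda>p. fx p * g p + f p * gx p) \<in> borel_measurable borel"
      "(\<lambda>p. fy p * g p + f p * gy p) \<in> borel_measurable borel" by measurable
  qed
qed

end

section \<open>Integrals of powers of the distance\<close>

lemma borel_measurable_fst_snd[measurable]:
  "(fst :: real \<times> real \<Rightarrow> real) \<in> borel_measurable borel" "(snd :: real \<times> real \<Rightarrow> real) \<in> borel_measurable borel"
  by (intro borel_measurable_continuous_onI continuous_intros)+

lemma nn_integral_even_le:
  assumes [measurable]: "F \<in> borel_measurable (borel :: real measure)"
  shows "(\<integral>\<^sup>+x. F \<bar>x\<bar> \<partial>lborel) \<le> 2 * (\<integral>\<^sup>+x. indicator {0..} x * F x \<partial>lborel)"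
proof -
  let ?G = "\<lambda>x. indicator {0..} x * F x"
  have "(\<integral>\<^sup>+x. F \<bar>x\<bar> \<partial>lborel) \<le> (\<integral>\<^sup>+x. ?G x + ?G (0 + (-1) * x) \<partial>lborel)"
    by (intro nn_integral_mono) (auto simp: indicator_def abs_if)
  also have "\<dots> = (\<integral>\<^sup>+x. ?G x \<partial>lborel) + (\<integral>\<^sup>+x. ?G (0 + (-1) * x) \<partial>lborel)"
    by (rule nn_integral_add) measurable
  also have "(\<integral>\<^sup>+x. ?G (0 + (-1) * x) \<partial>lborel) = (\<integral>\<^sup>+x. ?G x \<partial>lborel)"
    using nn_integral_real_affine[of ?G "-1" 0] by simp
  finally show ?thesis by (simp add: mult_2)
qed

lemma nn_integral_lborel_times:
  assumes [measurable]: "F \<in> borel_measurable (borel :: real measure)" "G \<in> borel_measurable (borel :: real measure)"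
  shows "(\<integral>\<^sup>+p. F (fst p) * G (snd p) \<partial>lborel) = (\<integral>\<^sup>+x. F x \<partial>lborel) * (\<integral>\<^sup>+y. G y \<partial>lborel)"
proof -
  have "(\<integral>\<^sup>+p. F (fst p) * G (snd p) \<partial>(lborel \<Otimes>\<^sub>M lborel)) = (\<integral>\<^sup>+x. \<integral>\<^sup>+y. F (fst (x, y)) * G (snd (x, y)) \<partial>lborel \<partial>lborel)"
    by (rule lborel.nn_integral_fst[symmetric]) measurable
  also have "\<dots> = (\<integral>\<^sup>+x. F x \<partial>lborel) * (\<integral>\<^sup>+y. G y \<partial>lborel)"
    by (simp add: nn_integral_cmult nn_integral_multc)
  finally show ?thesis by (simp add: lborel_prod)
qed

lemma nn_integral_powr_near_0:
  assumes s: "0 \<le> s" "s < 1" and a: "a > 0"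
  shows "(\<integral>\<^sup>+x. indicator {-a<..<a} x * ennreal (\<bar>x\<bar> powr (-s)) \<partial>lborel) \<le> ennreal (2 / (1 - s) * a powr (1 - s))"
proof -
  have "(\<integral>\<^sup>+x. indicator {-a<..<a} x * ennreal (\<bar>x\<bar> powr (-s)) \<partial>lborel)
      \<le> (\<integral>\<^sup>+x. (\<lambda>x. indicator {0..a} x * ennreal (x powr (-s))) \<bar>x\<bar> \<partial>lborel)"
    by (intro nn_integral_mono) (auto simp: indicator_def)
  also have "\<dots> \<le> 2 * (\<integral>\<^sup>+x. indicator {0..} x * (indicator {0..a} x * ennreal (x powr (-s))) \<partial>lborel)"
    by (rule nn_integral_even_le) measurable
  also have "(\<integral>\<^sup>+x. indicator {0..} x * (indicator {0..a} x * ennreal (x powr (-s))) \<partial>lborel)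
      = (\<integral>\<^sup>+x. ennreal (x powr (-s)) * indicator {0..a} x \<partial>lborel)"
    by (intro nn_integral_cong) (auto simp: indicator_def)
  also have "\<dots> = ennreal (a powr (-s + 1) / (-s + 1))"
    by (rule nn_integral_has_integral_lebesgue') (use has_integral_powr_from_0[of "-s" a] s a in auto)
  finally show ?thesis using s by (simp add: ennreal_mult' flip: ennreal_numeral ennreal_mult'')
qed

lemma nn_integral_powr_tail:
  assumes q: "q > 1" and d: "d > 0"
  shows "(\<integral>\<^sup>+x. ennreal ((d + \<bar>x\<bar>) powr (-q)) \<partial>lborel) \<le> ennreal (2 / (q - 1) * d powr (1 - q))"
proof -
  have "(\<integral>\<^sup>+x. ennreal ((d + \<bar>x\<bar>) powr (-q)) \<partial>lborel) \<le> 2 * (\<integral>\<^sup>+x. indicator {0..} x * ennreal ((d + x) powr (-q)) \<partial>lborel)"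
    by (rule nn_integral_even_le) measurable
  also have "(\<integral>\<^sup>+x. indicator {0..} x * ennreal ((d + x) powr (-q)) \<partial>lborel)
     = (\<integral>\<^sup>+x. (\<lambda>x. ennreal (x powr (-q)) * indicator {d..} x) (d + x) \<partial>lborel)"
    by (intro nn_integral_cong) (auto simp: indicator_def)
  also have "\<dots> = (\<integral>\<^sup>+x. ennreal (x powr (-q)) * indicator {d..} x \<partial>lborel)"
    by (rule nn_integral_lborel_translate) measurable
  also have "\<dots> = ennreal (- (d powr (-q + 1)) / (-q + 1))"
    by (rule nn_integral_has_integral_lebesgue') (use has_integral_powr_to_inf[of "-q" d] q d in auto)
  also have "- (d powr (-q + 1)) / (-q + 1) = d powr (1 - q) / (q - 1)"
    using q by (simp add: field_simps)
  finally show ?thesis using q by (simp add: ennreal_mult' flip: ennreal_numeral ennreal_mult'')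
qed

text \<open>From \<open>norm (x, y) \<ge> max \<bar>x\<bar> \<bar>y\<bar>\<close> the integrand is at most \<open>\<bar>x\<bar> powr (-q/2) * \<bar>y\<bar> powr (-q/2)\<close>, a
product of functions of one variable, whose integrals are elementary.\<close>

lemma nn_integral_norm_powr_near:
  assumes q: "0 \<le> q" "q < 2"
  shows "\<exists>C\<ge>0. \<forall>d>0. (\<integral>\<^sup>+p. indicator (ball 0 d) p * ennreal (norm (p :: real \<times> real) powr (-q)) \<partial>lborel) \<le> ennreal (C * d powr (2 - q))"
proof (intro exI[of _ "(2 / (1 - q/2))\<^sup>2"] conjI allI impI)
  fix d :: real assume d: "d > 0"
  define s where "s = q / 2"
  have s: "0 \<le> s" "s < 1" using q by (auto simp: s_def)
  define F where "F x = indicator {-d<..<d} x * ennreal (\<bar>x\<bar> powr (-s))" for x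
  have [measurable]: "F \<in> borel_measurable borel" unfolding F_def[abs_def] by measurable
  have le: "indicator (ball 0 d) p * ennreal (norm p powr (-q)) \<le> F (fst p) * F (snd p)" if "fst p \<noteq> 0" "snd p \<noteq> 0" for p
  proof (cases "p \<in> ball 0 d")
    case True
    obtain x y where p: "p = (x, y)" by (cases p)
    have xy: "x \<noteq> 0" "y \<noteq> 0" using that p by auto
    have n: "norm p < d" using True by simp
    have nx: "\<bar>x\<bar> \<le> norm p" "\<bar>y\<bar> \<le> norm p"
      using norm_fst_le[of x y] norm_snd_le[of y x] by (auto simp: p)
    have pos: "norm p > 0" using xy by (simp add: p zero_prod_def)
    have "norm p powr (-q) = (norm p powr (-s)) * (norm p powr (-s))"
      by (simp add: powr_add[symmetric] s_def)
    also have "\<dots> \<le> (\<bar>x\<bar> powr (-s)) * (\<bar>y\<bar> powr (-s))"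
      using nx xy s by (intro mult_mono powr_mono2') auto
    finally have "ennreal (norm p powr (-q)) \<le> ennreal (\<bar>x\<bar> powr (-s)) * ennreal (\<bar>y\<bar> powr (-s))"
      by (simp add: ennreal_mult[symmetric])
    moreover have "x \<in> {-d<..<d}" "y \<in> {-d<..<d}" using nx n by auto
    ultimately show ?thesis using True by (simp add: F_def p)
  qed simp
  have "(\<integral>\<^sup>+p. indicator (ball 0 d) p * ennreal (norm (p :: real \<times> real) powr (-q)) \<partial>lborel) \<le> (\<integral>\<^sup>+p. F (fst p) * F (snd p) \<partial>lborel)"
  proof (rule nn_integral_mono_AE)
    show "AE p in lborel. indicator (ball 0 d) p * ennreal (norm (p :: real \<times> real) powr (-q)) \<le> F (fst p) * F (snd p)"
      using AE_lborel_fst_neq[of 0] AE_lborel_snd_neq[of 0] by eventually_elim (rule le)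
  qed
  also have "\<dots> = (\<integral>\<^sup>+x. F x \<partial>lborel) * (\<integral>\<^sup>+x. F x \<partial>lborel)" by (rule nn_integral_lborel_times) measurable
  also have "\<dots> \<le> ennreal (2 / (1 - s) * d powr (1 - s)) * ennreal (2 / (1 - s) * d powr (1 - s))"
    unfolding F_def by (intro mult_mono nn_integral_powr_near_0 s d) auto
  also have "\<dots> = ennreal ((2 / (1 - q/2))\<^sup>2 * d powr (2 - q))"
  proof -
    have "d powr (1 - s) * d powr (1 - s) = d powr (2 - q)" by (simp add: powr_add[symmetric] s_def)
    then have "2 / (1 - s) * d powr (1 - s) * (2 / (1 - s) * d powr (1 - s)) = (2 / (1 - q/2))\<^sup>2 * d powr (2 - q)"
      by (simp add: power2_eq_square s_def mult_ac)
    then show ?thesis using s by (subst ennreal_mult[symmetric]) auto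
  qed
  finally show "(\<integral>\<^sup>+p. indicator (ball 0 d) p * ennreal (norm (p :: real \<times> real) powr (-q)) \<partial>lborel) \<le> ennreal ((2 / (1 - q/2))\<^sup>2 * d powr (2 - q))" .
qed simp

text \<open>Where \<open>norm (x, y) \<ge> d\<close>, the product \<open>(d + \<bar>x\<bar>) (d + \<bar>y\<bar>)\<close> is at most four times the square of
the norm, which again separates the variables.\<close>

lemma nn_integral_norm_powr_far:
  assumes q: "q > 1"
  shows "\<exists>C\<ge>0. \<forall>d>0. (\<integral>\<^sup>+p. indicator (- ball 0 d) p * ennreal (norm (p :: real \<times> real) powr (-2 * q)) \<partial>lborel) \<le> ennreal (C * d powr (2 - 2 * q))"
proof (intro exI[of _ "4 powr q * (2 / (q - 1))\<^sup>2"] conjI allI impI)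
  fix d :: real assume d: "d > 0"
  define F where "F x = ennreal ((d + \<bar>x\<bar>) powr (-q))" for x
  have [measurable]: "F \<in> borel_measurable borel" unfolding F_def[abs_def] by measurable
  have le: "indicator (- ball 0 d) p * ennreal (norm p powr (-2 * q)) \<le> ennreal (4 powr q) * (F (fst p) * F (snd p))" for p :: "real \<times> real"
  proof (cases "p \<in> ball 0 d")
    case False
    obtain x y where p: "p = (x, y)" by (cases p)
    have n: "norm p \<ge> d" using False by simp
    then have n0: "norm p > 0" using d by linarith
    have nx: "\<bar>x\<bar> \<le> norm p" "\<bar>y\<bar> \<le> norm p"
      using norm_fst_le[of x y] norm_snd_le[of y x] by (auto simp: p)
    have "(d + \<bar>x\<bar>) * (d + \<bar>y\<bar>) \<le> (2 * norm p) * (2 * norm p)"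
      using n nx d by (intro mult_mono) auto
    then have "(4 * norm p powr 2) powr (-q) \<le> ((d + \<bar>x\<bar>) * (d + \<bar>y\<bar>)) powr (-q)"
      using d q n0 by (intro powr_mono2') (auto simp: power2_eq_square powr_numeral mult_pos_pos add_pos_nonneg)
    moreover have "(4 * norm p powr 2) powr (-q) = 4 powr (-q) * norm p powr (-2 * q)"
      by (simp only: powr_mult powr_powr) simp
    moreover have "((d + \<bar>x\<bar>) * (d + \<bar>y\<bar>)) powr (-q) = (d + \<bar>x\<bar>) powr (-q) * (d + \<bar>y\<bar>) powr (-q)"
      using d by (simp add: powr_mult)
    ultimately have "4 powr (-q) * norm p powr (-2 * q) \<le> (d + \<bar>x\<bar>) powr (-q) * (d + \<bar>y\<bar>) powr (-q)" by simp
    then have "4 powr q * (4 powr (-q) * norm p powr (-2 * q)) \<le> 4 powr q * ((d + \<bar>x\<bar>) powr (-q) * (d + \<bar>y\<bar>) powr (-q))"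
      by (rule mult_left_mono) simp
    moreover have "4 powr q * (4 powr (-q) * norm p powr (-2 * q)) = norm p powr (-2 * q)"
      by (simp add: powr_minus)
    ultimately have "norm p powr (-2 * q) \<le> 4 powr q * ((d + \<bar>x\<bar>) powr (-q) * (d + \<bar>y\<bar>) powr (-q))"
      by (simp only:)
    then show ?thesis using False by (simp add: F_def p ennreal_mult[symmetric] ennreal_leI)
  qed simp
  have "(\<integral>\<^sup>+p. indicator (- ball 0 d) p * ennreal (norm (p :: real \<times> real) powr (-2 * q)) \<partial>lborel)
     \<le> (\<integral>\<^sup>+p. ennreal (4 powr q) * (F (fst p) * F (snd p)) \<partial>lborel)"
    by (intro nn_integral_mono le)
  also have "\<dots> = ennreal (4 powr q) * (\<integral>\<^sup>+p. F (fst p) * F (snd p) \<partial>lborel)" by (rule nn_integral_cmult) measurable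
  also have "(\<integral>\<^sup>+p. F (fst p) * F (snd p) \<partial>lborel) = (\<integral>\<^sup>+x. F x \<partial>lborel) * (\<integral>\<^sup>+x. F x \<partial>lborel)" by (rule nn_integral_lborel_times) measurable
  also have "ennreal (4 powr q) * \<dots> \<le> ennreal (4 powr q) * (ennreal (2 / (q - 1) * d powr (1 - q)) * ennreal (2 / (q - 1) * d powr (1 - q)))"
    unfolding F_def by (intro mult_mono nn_integral_powr_tail q d) auto
  also have "\<dots> = ennreal (4 powr q * (2 / (q - 1))\<^sup>2 * d powr (2 - 2 * q))"
  proof -
    have "d powr (1 - q) * d powr (1 - q) = d powr (2 - 2 * q)" by (simp add: powr_add[symmetric])
    then have "4 powr q * (2 / (q - 1) * d powr (1 - q) * (2 / (q - 1) * d powr (1 - q))) = 4 powr q * (2 / (q - 1))\<^sup>2 * d powr (2 - 2 * q)"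
      by (simp add: power2_eq_square mult_ac)
    then show ?thesis using q by (simp add: ennreal_mult[symmetric] del: times_divide_eq_left times_divide_eq_right)
  qed
  finally show "(\<integral>\<^sup>+p. indicator (- ball 0 d) p * ennreal (norm (p :: real \<times> real) powr (-2 * q)) \<partial>lborel) \<le> ennreal (4 powr q * (2 / (q - 1))\<^sup>2 * d powr (2 - 2 * q))" .
qed simp

lemma powr_add_le:
  fixes s t q :: real
  assumes "s \<ge> 0" "t \<ge> 0" "q \<ge> 0"
  shows "(s + t) powr q \<le> 2 powr q * (s powr q + t powr q)"
proof -
  have "(s + t) powr q \<le> (2 * max s t) powr q" using assms by (intro powr_mono2) auto
  also have "\<dots> = 2 powr q * max s t powr q" using assms by (simp add: powr_mult)
  also have "max s t powr q \<le> s powr q + t powr q" by (auto simp: max_def)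
  finally show ?thesis by (simp add: mult_left_mono)
qed

text \<open>The modulus of \<open>1 / (p - z) - 1 / (p - w)\<close> in complex notation.\<close>

definition cauchy_gap :: "real \<times> real \<Rightarrow> real \<times> real \<Rightarrow> real \<times> real \<Rightarrow> real" where
  "cauchy_gap z w p = norm (z - w) / (norm (p - z) * norm (p - w))"

text \<open>Near \<open>z\<close> or \<open>w\<close> the triangle inequality gives \<open>1 / norm (p - z) + 1 / norm (p - w)\<close> as a bound. If both
distances are at least \<open>2 d\<close>, they are comparable, and the bound is \<open>2 d / norm (p - z)\<^sup>2\<close>.\<close>

lemma cauchy_gap_powr_le:
  assumes q: "q \<ge> 0" and d: "d = norm (z - w)" "d > 0" and pz: "p \<noteq> z" "p \<noteq> w"
  shows "cauchy_gap z w p powr q \<le> 2 powr q * (indicator (ball 0 (3 * d)) (p - z) * norm (p - z) powr (-q)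
     + indicator (ball 0 (3 * d)) (p - w) * norm (p - w) powr (-q)
     + d powr q * (indicator (- ball 0 (2 * d)) (p - z) * norm (p - z) powr (-2 * q)))"
proof -
  define a b where "a = norm (p - z)" and "b = norm (p - w)"
  have ab: "a > 0" "b > 0" using pz by (auto simp: a_def b_def)
  have tri: "d \<le> a + b" "a \<le> b + d" "b \<le> a + d"
    using norm_triangle_ineq4[of "p - w" "p - z"] norm_triangle_ineq[of "p - w" "w - z"] norm_triangle_ineq[of "p - z" "z - w"]
    by (simp_all add: a_def b_def d norm_minus_commute add.commute)
  have gap: "cauchy_gap z w p = d / (a * b)" by (simp add: cauchy_gap_def d a_def b_def)
  show ?thesis
  proof (cases "a < 2 * d \<or> b < 2 * d")
    case True
    then have near: "a < 3 * d" "b < 3 * d" using tri by auto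
    have "d / (a * b) \<le> 1 / a + 1 / b" using ab tri by (simp add: field_simps)
    then have "cauchy_gap z w p powr q \<le> (1 / a + 1 / b) powr q"
      unfolding gap using ab d q by (intro powr_mono2) auto
    also have "\<dots> \<le> 2 powr q * ((1 / a) powr q + (1 / b) powr q)"
      using ab q by (intro powr_add_le) auto
    also have "\<dots> = 2 powr q * (a powr (-q) + b powr (-q))"
      using ab by (simp add: powr_minus powr_divide field_simps)
    also have "\<dots> \<le> 2 powr q * (a powr (-q) + b powr (-q) + d powr q * (indicator (- ball 0 (2 * d)) (p - z) * a powr (-2 * q)))"
      by (intro mult_left_mono) auto
    finally show ?thesis using near by (simp add: a_def b_def)
  next
    case False
    then have far: "a \<ge> 2 * d" "b \<ge> a / 2" using tri by auto
    have "d / (a * b) \<le> d / (a * (a / 2))" 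
      using far(2) ab less_imp_le[OF d(2)] by (intro divide_left_mono mult_left_mono mult_pos_pos) simp_all
    also have "\<dots> = 2 * (d * a powr (-2))"
    proof -
      have "a powr 2 = a\<^sup>2" using ab by (intro powr_numeral) simp
      then have "a powr (-2) = inverse (a * a)" by (simp only: powr_minus power2_eq_square)
      then show ?thesis by (simp only:) (simp add: divide_simps)
    qed
    finally have "cauchy_gap z w p powr q \<le> (2 * (d * a powr (-2))) powr q"
      unfolding gap using ab d q by (intro powr_mono2) auto
    also have "\<dots> = 2 powr q * (d powr q * a powr (-2 * q))"
      using ab d by (simp add: powr_mult powr_powr)
    also have "\<dots> \<le> 2 powr q * (indicator (ball 0 (3 * d)) (p - z) * a powr (-q) + indicator (ball 0 (3 * d)) (p - w) * b powr (-q) + d powr q * a powr (-2 * q))"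
      by (intro mult_left_mono) auto
    finally show ?thesis using far by (simp add: a_def b_def)
  qed
qed

text \<open>The power of \<open>norm (z - w)\<close> is the one dictated by scaling.\<close>

lemma nn_integral_cauchy_gap:
  assumes q: "1 < q" "q < 2"
  shows "\<exists>C\<ge>0. \<forall>z w. z \<noteq> w \<longrightarrow> (\<integral>\<^sup>+p. ennreal (cauchy_gap z w p powr q) \<partial>lborel) \<le> ennreal (C * norm (z - w) powr (2 - q))"
proof -
  obtain C1 where C1: "C1 \<ge> 0" "\<And>d. d > 0 \<Longrightarrow> (\<integral>\<^sup>+p. indicator (ball 0 d) p * ennreal (norm (p :: real \<times> real) powr (-q)) \<partial>lborel) \<le> ennreal (C1 * d powr (2 - q))"
    using nn_integral_norm_powr_near[of q] q by auto
  obtain C2 where C2: "C2 \<ge> 0" "\<And>d. d > 0 \<Longrightarrow> (\<integral>\<^sup>+p. indicator (- ball 0 d) p * ennreal (norm (p :: real \<times> real) powr (-2 * q)) \<partial>lborel) \<le> ennreal (C2 * d powr (2 - 2 * q))"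
    using nn_integral_norm_powr_far[of q] q by auto
  define C where "C = 2 powr q * (2 * (C1 * 3 powr (2 - q)) + C2 * 2 powr (2 - 2 * q))"
  have "C \<ge> 0" using C1(1) C2(1) by (simp add: C_def)
  moreover have "(\<integral>\<^sup>+p. ennreal (cauchy_gap z w p powr q) \<partial>lborel) \<le> ennreal (C * norm (z - w) powr (2 - q))" if "z \<noteq> w" for z w
  proof -
    define d where "d = norm (z - w)"
    have d: "d > 0" using that by (simp add: d_def)
    define N where "N u = indicator (ball 0 (3 * d)) u * ennreal (norm u powr (-q))" for u :: "real \<times> real"
    define G where "G u = indicator (- ball 0 (2 * d)) u * ennreal (norm u powr (-2 * q))" for u :: "real \<times> real"
    have [measurable]: "N \<in> borel_measurable borel" "G \<in> borel_measurable borel"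
    proof -
      have [measurable]: "(\<lambda>u :: real \<times> real. ennreal (norm u powr r)) \<in> borel_measurable borel" for r
        by (rule measurable_compose[where f=norm and N=borel]) simp_all
      have [measurable]: "ball (0 :: real \<times> real) r \<in> sets borel" for r by simp
      show "N \<in> borel_measurable borel" "G \<in> borel_measurable borel"
        unfolding N_def[abs_def] G_def[abs_def]
        by (intro borel_measurable_times_ennreal borel_measurable_indicator; simp)+
    qed
    have N_int: "(\<integral>\<^sup>+p. N (p - u) \<partial>lborel) \<le> ennreal (C1 * 3 powr (2 - q) * d powr (2 - q))" for u
      using nn_integral_lborel_translate[of N "-u"] C1(2)[of "3 * d"] d
      by (simp add: N_def[symmetric] powr_mult mult.assoc)
    have G_int: "(\<integral>\<^sup>+p. G (p - u) \<partial>lborel) \<le> ennreal (C2 * 2 powr (2 - 2 * q) * d powr (2 - 2 * q))" for u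
    proof -
      have "(\<integral>\<^sup>+p. G p \<partial>lborel) \<le> ennreal (C2 * 2 powr (2 - 2 * q) * d powr (2 - 2 * q))"
        using C2(2)[of "2 * d"] d by (simp add: G_def powr_mult mult.assoc)
      then show ?thesis using nn_integral_lborel_translate[of G "-u"] by simp
    qed
    have "(\<integral>\<^sup>+p. ennreal (cauchy_gap z w p powr q) \<partial>lborel)
       \<le> (\<integral>\<^sup>+p. ennreal (2 powr q) * (N (p - z) + N (p - w) + ennreal (d powr q) * G (p - z)) \<partial>lborel)"
    proof (rule nn_integral_mono_AE)
      have "AE p in lborel. p \<noteq> z" "AE p in lborel. p \<noteq> w"
        using AE_lborel_singleton by auto
      then show "AE p in lborel. ennreal (cauchy_gap z w p powr q) \<le> ennreal (2 powr q) * (N (p - z) + N (p - w) + ennreal (d powr q) * G (p - z))"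
      proof eventually_elim
        case (elim p)
        have ind: "indicator A u * ennreal r = ennreal (indicator A u * r)" for A and u :: "real \<times> real" and r
          by (auto simp: indicator_def)
        have eq: "ennreal (2 powr q) * (N (p - z) + N (p - w) + ennreal (d powr q) * G (p - z)) =
          ennreal (2 powr q * (indicator (ball 0 (3 * d)) (p - z) * norm (p - z) powr (-q)
     + indicator (ball 0 (3 * d)) (p - w) * norm (p - w) powr (-q)
     + d powr q * (indicator (- ball 0 (2 * d)) (p - z) * norm (p - z) powr (-2 * q))))"
          unfolding N_def G_def ind
          by (simp only: ennreal_plus[symmetric] ennreal_mult[symmetric] add_nonneg_nonneg mult_nonneg_nonneg powr_ge_zero indicator_pos_le)
        show ?case
          unfolding eq by (intro ennreal_leI cauchy_gap_powr_le) (use q d elim in \<open>auto simp: d_def\<close>)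
      qed
    qed
    also have "\<dots> = ennreal (2 powr q) * ((\<integral>\<^sup>+p. N (p - z) \<partial>lborel) + (\<integral>\<^sup>+p. N (p - w) \<partial>lborel) + ennreal (d powr q) * (\<integral>\<^sup>+p. G (p - z) \<partial>lborel))"
      by (simp add: nn_integral_cmult nn_integral_add)
    also have "\<dots> \<le> ennreal (2 powr q) * (ennreal (C1 * 3 powr (2 - q) * d powr (2 - q)) + ennreal (C1 * 3 powr (2 - q) * d powr (2 - q)) + ennreal (d powr q) * ennreal (C2 * 2 powr (2 - 2 * q) * d powr (2 - 2 * q)))"
      by (intro mult_left_mono add_mono N_int G_int) auto
    also have "\<dots> = ennreal (2 powr q * (C1 * 3 powr (2 - q) * d powr (2 - q) + C1 * 3 powr (2 - q) * d powr (2 - q) + d powr q * (C2 * 2 powr (2 - 2 * q) * d powr (2 - 2 * q))))"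
      using C1(1) C2(1)
      by (simp only: ennreal_plus[symmetric] ennreal_mult[symmetric] add_nonneg_nonneg mult_nonneg_nonneg powr_ge_zero)
    also have "\<dots> = ennreal (C * d powr (2 - q))"
    proof -
      have p: "d powr q * d powr (2 - 2 * q) = d powr (2 - q)" by (simp add: powr_add[symmetric])
      have e: "d powr q * (c * d powr (2 - 2 * q)) = c * d powr (2 - q)" for c
        by (subst mult.left_commute, subst p, rule refl)
      show ?thesis unfolding e C_def by (simp add: distrib_left distrib_right mult_ac)
    qed
    finally show ?thesis by (simp add: d_def)
  qed
  ultimately show ?thesis by blast
qed

section \<open>The regularized Cauchy kernel\<close>

text \<open>In complex notation this is the conjugate of \<open>p\<close> divided by \<open>norm p ^ 2 + e ^ 2\<close>, a smooth
approximation of \<open>1 / p\<close>. Its derivative with respect to the conjugate variable is a scaled copy of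
one bump function, so that it is an approximate fundamental solution.\<close>

definition reg_kernel :: "real \<Rightarrow> real \<times> real \<Rightarrow> complex" where
  "reg_kernel e p = inverse ((fst p)\<^sup>2 + (snd p)\<^sup>2 + e\<^sup>2) *\<^sub>R (of_real (fst p) - \<i> * of_real (snd p))"

lemma norm_pair_square: "(norm p)\<^sup>2 = (fst p)\<^sup>2 + (snd p)\<^sup>2" for p :: "real \<times> real"
  by (cases p) (simp add: norm_Pair)

text \<open>The bound for the Cauchy kernel itself holds for all \<open>e\<close> at once: the numerator of the difference is
at most \<open>norm (a - b) * (norm a * norm b + e ^ 2)\<close>, and by the Cauchy-Schwarz inequality the
denominator is at least the square of the last factor.\<close>

lemma norm_reg_kernel_diff:
  assumes "a \<noteq> 0" "b \<noteq> 0"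
  shows "norm (reg_kernel e a - reg_kernel e b) \<le> norm (a - b) / (norm a * norm b)"
proof -
  define cp where "cp p = of_real (fst p) + \<i> * of_real (snd p)" for p :: "real \<times> real"
  have ncp: "norm (cp p) = norm p" for p
    by (cases p) (simp add: cp_def norm_Pair cmod_def)
  define u v where "u = cp a" and "v = cp b"
  define A B where "A = (norm u)\<^sup>2 + e\<^sup>2" and "B = (norm v)\<^sup>2 + e\<^sup>2"
  have uv: "norm u > 0" "norm v > 0" using assms ncp by (simp_all add: u_def v_def)
  have AB: "A > 0" "B > 0" using uv by (simp_all add: A_def B_def add_pos_nonneg)
  have ker: "reg_kernel e p = cnj (cp p) / of_real ((norm (cp p))\<^sup>2 + e\<^sup>2)" for p
    unfolding reg_kernel_def ncp norm_pair_square
    by (simp add: cp_def scaleR_conv_of_real divide_inverse mult.commute)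
  have "reg_kernel e a - reg_kernel e b = (cnj u * of_real B - cnj v * of_real A) / of_real (A * B)"
    unfolding ker u_def[symmetric] v_def[symmetric] A_def[symmetric] B_def[symmetric]
    using AB by (simp add: field_simps)
  also have "cnj u * of_real B - cnj v * of_real A = cnj u * cnj v * (v - u) + of_real (e\<^sup>2) * (cnj u - cnj v)"
    unfolding A_def B_def of_real_add complex_norm_square by (simp add: algebra_simps)
  finally have "norm (reg_kernel e a - reg_kernel e b) = norm (cnj u * cnj v * (v - u) + of_real (e\<^sup>2) * (cnj u - cnj v)) / (A * B)"
    using AB by (simp add: norm_divide norm_mult[of "of_real A" "of_real B"])
  also have "\<dots> \<le> (norm u * norm v * norm (u - v) + e\<^sup>2 * norm (u - v)) / (A * B)"
  proof (rule divide_right_mono)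
    have "norm (cnj u * cnj v * (v - u)) = norm u * norm v * norm (u - v)"
      by (simp add: norm_mult norm_minus_commute)
    moreover have "norm (of_real (e\<^sup>2) * (cnj u - cnj v)) = e\<^sup>2 * norm (u - v)"
      unfolding norm_mult complex_cnj_diff[symmetric] complex_mod_cnj by (simp add: norm_power)
    ultimately show "norm (cnj u * cnj v * (v - u) + of_real (e\<^sup>2) * (cnj u - cnj v)) \<le> norm u * norm v * norm (u - v) + e\<^sup>2 * norm (u - v)"
      using norm_triangle_ineq by metis
  qed (use AB in simp)
  also have "\<dots> = norm (u - v) * ((norm u * norm v + e\<^sup>2) / (A * B))"
    by (simp add: algebra_simps)
  also have "(norm u * norm v + e\<^sup>2) / (A * B) \<le> 1 / (norm u * norm v)"
  proof -
    have "(norm u * norm v + e\<^sup>2) * (norm u * norm v) \<le> (norm u * norm v + e\<^sup>2) * (norm u * norm v + e\<^sup>2)"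
      using uv by (intro mult_left_mono) auto
    also have "\<dots> \<le> A * B"
    proof -
      have "A * B - (norm u * norm v + e\<^sup>2) * (norm u * norm v + e\<^sup>2) = e\<^sup>2 * (norm u - norm v)\<^sup>2"
        unfolding A_def B_def by (simp add: power2_eq_square algebra_simps)
      moreover have "e\<^sup>2 * (norm u - norm v)\<^sup>2 \<ge> 0" by simp
      ultimately show ?thesis by linarith
    qed
    finally show ?thesis using uv AB by (simp add: divide_simps mult_pos_pos)
  qed
  finally have "norm (reg_kernel e a - reg_kernel e b) \<le> norm (u - v) * (1 / (norm u * norm v))"
    by (simp add: mult_left_mono)
  moreover have "u - v = cp (a - b)" by (simp add: u_def v_def cp_def algebra_simps)
  ultimately show ?thesis by (simp add: ncp u_def v_def)
qed

definition reg_kernel_x :: "real \<Rightarrow> real \<times> real \<Rightarrow> complex" where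
  "reg_kernel_x e p = inverse ((fst p)\<^sup>2 + (snd p)\<^sup>2 + e\<^sup>2) *\<^sub>R 1
     + (- (2 * fst p * (inverse ((fst p)\<^sup>2 + (snd p)\<^sup>2 + e\<^sup>2))\<^sup>2)) *\<^sub>R (of_real (fst p) - \<i> * of_real (snd p))"

definition reg_kernel_y :: "real \<Rightarrow> real \<times> real \<Rightarrow> complex" where
  "reg_kernel_y e p = inverse ((fst p)\<^sup>2 + (snd p)\<^sup>2 + e\<^sup>2) *\<^sub>R (- \<i>)
     + (- (2 * snd p * (inverse ((fst p)\<^sup>2 + (snd p)\<^sup>2 + e\<^sup>2))\<^sup>2)) *\<^sub>R (of_real (fst p) - \<i> * of_real (snd p))"

lemma reg_kernel_dbar:
  assumes "e > 0"
  shows "reg_kernel_x e p + \<i> * reg_kernel_y e p = of_real (2 * e\<^sup>2 / ((norm p)\<^sup>2 + e\<^sup>2)\<^sup>2)"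
proof -
  define s where "s = (fst p)\<^sup>2 + (snd p)\<^sup>2 + e\<^sup>2"
  have s: "s > 0" using assms by (simp add: s_def add_nonneg_pos)
  define k where "k = inverse s"
  have "reg_kernel_x e p + \<i> * reg_kernel_y e p
     = of_real (2 * k - 2 * k\<^sup>2 * ((fst p)\<^sup>2 + (snd p)\<^sup>2))"
    unfolding reg_kernel_x_def reg_kernel_y_def s_def[symmetric] k_def[symmetric]
    by (simp add: complex_eq_iff power2_eq_square algebra_simps)
  also have "2 * k - 2 * k\<^sup>2 * ((fst p)\<^sup>2 + (snd p)\<^sup>2) = 2 * e\<^sup>2 / s\<^sup>2"
  proof -
    have "(fst p)\<^sup>2 + (snd p)\<^sup>2 = s - e\<^sup>2" by (simp add: s_def)
    then show ?thesis using s by (simp add: k_def field_simps power2_eq_square)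
  qed
  finally show ?thesis by (simp add: s_def norm_pair_square)
qed

lemma reg_kernel_partials:
  assumes e: "e > 0"
  shows "continuous_with_partials (\<lambda>p. reg_kernel e (p - z)) (\<lambda>p. reg_kernel_x e (p - z)) (\<lambda>p. reg_kernel_y e (p - z)) {}"
proof
  obtain a b where z: "z = (a, b)" by (cases z)
  have pos: "x\<^sup>2 + y\<^sup>2 + e\<^sup>2 \<noteq> 0" for x y :: real
    using e by (metis add_nonneg_pos less_irrefl sum_power2_ge_zero zero_less_power)
  show "continuous_on UNIV (\<lambda>p. reg_kernel e (p - z))"
    unfolding reg_kernel_def by (intro continuous_intros) (auto simp: pos)
  show "((\<lambda>t. reg_kernel e ((t, y) - z)) has_vector_derivative reg_kernel_x e ((x, y) - z)) (at x)" for x y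
  proof -
    have 1: "((\<lambda>t. inverse ((t - a)\<^sup>2 + (y - b)\<^sup>2 + e\<^sup>2)) has_field_derivative - (2 * (x - a) * (inverse ((x - a)\<^sup>2 + (y - b)\<^sup>2 + e\<^sup>2))\<^sup>2)) (at x)"
      using pos[of "x - a" "y - b"] by (auto intro!: derivative_eq_intros simp: power2_eq_square)
    have 2: "((\<lambda>t. of_real (t - a) - \<i> * of_real (y - b)) has_vector_derivative 1) (at x)"
      by (auto intro!: derivative_eq_intros)
    from has_vector_derivative_scaleR[OF 1 2] show ?thesis
      by (simp add: reg_kernel_def reg_kernel_x_def z)
  qed
  show "((\<lambda>t. reg_kernel e ((x, t) - z)) has_vector_derivative reg_kernel_y e ((x, y) - z)) (at y)" for x y
  proof -
    have 1: "((\<lambda>t. inverse ((x - a)\<^sup>2 + (t - b)\<^sup>2 + e\<^sup>2)) has_field_derivative - (2 * (y - b) * (inverse ((x - a)\<^sup>2 + (y - b)\<^sup>2 + e\<^sup>2))\<^sup>2)) (at y)"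
      using pos[of "x - a" "y - b"] by (auto intro!: derivative_eq_intros simp: power2_eq_square)
    have 2: "((\<lambda>t. of_real (x - a) - \<i> * of_real (t - b)) has_vector_derivative - \<i>) (at y)"
      by (auto intro!: derivative_eq_intros)
    from has_vector_derivative_scaleR[OF 1 2] show ?thesis
      by (simp add: reg_kernel_def reg_kernel_y_def z)
  qed
  show "(\<lambda>p. reg_kernel_x e (p - z)) \<in> borel_measurable borel" "(\<lambda>p. reg_kernel_y e (p - z)) \<in> borel_measurable borel"
    unfolding reg_kernel_x_def reg_kernel_y_def
    by (intro borel_measurable_continuous_onI continuous_intros; simp add: pos)+
qed simp

lemma norm_reg_kernel_le:
  assumes e: "e > 0"
  shows "norm (reg_kernel e p) \<le> 1 / e"
proof -
  define s where "s = (norm p)\<^sup>2 + e\<^sup>2"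
  have s: "s > 0" using e by (simp add: s_def add_nonneg_pos)
  have "norm (of_real (fst p) - \<i> * of_real (snd p)) = norm p"
    by (cases p) (simp add: norm_Pair cmod_def)
  then have "norm (reg_kernel e p) = norm p / s"
    using s by (simp add: reg_kernel_def s_def norm_pair_square divide_inverse mult.commute)
  also have "\<dots> \<le> 1 / e"
  proof -
    have "2 * (norm p * e) \<le> s" using sum_squares_bound[of "norm p" e] by (simp add: s_def mult.assoc)
    moreover have "0 \<le> norm p * e" using e by simp
    ultimately have "norm p * e \<le> s" by linarith
    then show ?thesis using s e by (simp add: divide_simps)
  qed
  finally show ?thesis .
qed

definition bump :: "real \<times> real \<Rightarrow> real" where
  "bump q = 1 / ((norm q)\<^sup>2 + 1)\<^sup>2"

lemma bump_pos: "bump q > 0"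
proof -
  have "((norm q)\<^sup>2 + 1)\<^sup>2 > 0" by (intro zero_less_power add_nonneg_pos) auto
  then show ?thesis unfolding bump_def by (rule divide_pos_pos[OF zero_less_one])
qed

lemma bump_measurable[measurable]: "bump \<in> borel_measurable borel"
proof -
  have "(norm q)\<^sup>2 + 1 \<noteq> 0" for q :: "real \<times> real"
  proof -
    have "(norm q)\<^sup>2 + 1 > 0" by (intro add_nonneg_pos) auto
    then show ?thesis by linarith
  qed
  then show ?thesis
    unfolding bump_def[abs_def] by (intro borel_measurable_continuous_onI continuous_intros) auto
qed

text \<open>The bump is dominated by the product of \<open>1 / (x ^ 2 + 1)\<close> and \<open>1 / (y ^ 2 + 1)\<close>.\<close>

lemma bump_integrable: "integrable lborel bump"
proof -
  define F where "F x = ennreal (2 * (1 + \<bar>x\<bar>) powr (-2))" for x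
  have [measurable]: "F \<in> borel_measurable borel" unfolding F_def[abs_def] by measurable
  have F_fin: "(\<integral>\<^sup>+x. F x \<partial>lborel) < \<infinity>"
  proof -
    have "(\<integral>\<^sup>+x. F x \<partial>lborel) = ennreal 2 * (\<integral>\<^sup>+x. ennreal ((1 + \<bar>x\<bar>) powr (-2)) \<partial>lborel)"
      unfolding F_def by (subst nn_integral_cmult[symmetric]) (auto simp: ennreal_mult intro!: nn_integral_cong)
    also have "\<dots> \<le> ennreal 2 * ennreal (2 / (2 - 1) * 1 powr (1 - 2))"
      by (intro mult_left_mono nn_integral_powr_tail) auto
    also have "\<dots> < \<infinity>" by (simp add: ennreal_mult_less_top)
    finally show ?thesis .
  qed
  have le: "ennreal (bump q) \<le> F (fst q) * F (snd q)" for q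
  proof -
    obtain x y where q: "q = (x, y)" by (cases q)
    have sq: "(1 + \<bar>t\<bar>)\<^sup>2 \<le> 2 * (t\<^sup>2 + 1)" for t :: real
      using sum_squares_bound[of 1 "\<bar>t\<bar>"] by (simp add: power2_sum)
    have inv: "1 / (t\<^sup>2 + 1) \<le> 2 * (1 + \<bar>t\<bar>) powr (-2)" for t :: real
    proof -
      have "(1 + \<bar>t\<bar>) powr 2 = (1 + \<bar>t\<bar>)\<^sup>2" by (intro powr_numeral) simp
      then have "2 * (1 + \<bar>t\<bar>) powr (-2) = 2 / (1 + \<bar>t\<bar>)\<^sup>2" by (simp only: powr_minus divide_inverse)
      also have "\<dots> \<ge> 1 / (t\<^sup>2 + 1)"
      proof -
        have "t\<^sup>2 + 1 > 0" "(1 + \<bar>t\<bar>)\<^sup>2 > 0" by (simp_all add: add_nonneg_pos)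
        then show ?thesis using sq[of t] by (simp add: divide_simps)
      qed
      finally show ?thesis .
    qed
    have "(x\<^sup>2 + 1) * (y\<^sup>2 + 1) \<le> ((norm q)\<^sup>2 + 1)\<^sup>2"
    proof -
      have "(x\<^sup>2 + 1) * (y\<^sup>2 + 1) \<le> ((norm q)\<^sup>2 + 1) * ((norm q)\<^sup>2 + 1)"
        by (intro mult_mono) (auto simp: q norm_pair_square)
      then show ?thesis by (simp add: power2_eq_square)
    qed
    moreover have "x\<^sup>2 + 1 > 0" "y\<^sup>2 + 1 > 0" by (simp_all add: add_nonneg_pos)
    ultimately have "bump q \<le> 1 / (x\<^sup>2 + 1) * (1 / (y\<^sup>2 + 1))"
      unfolding bump_def by (simp add: frac_le)
    also have "\<dots> \<le> (2 * (1 + \<bar>x\<bar>) powr (-2)) * (2 * (1 + \<bar>y\<bar>) powr (-2))"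
      by (intro mult_mono inv) auto
    finally show ?thesis by (simp add: F_def q ennreal_mult[symmetric] del: ennreal_numeral)
  qed
  have "(\<integral>\<^sup>+q. ennreal (norm (bump q)) \<partial>lborel) \<le> (\<integral>\<^sup>+q. F (fst q) * F (snd q) \<partial>lborel)"
    using le bump_pos by (intro nn_integral_mono) (simp add: less_imp_le)
  also have "\<dots> = (\<integral>\<^sup>+x. F x \<partial>lborel) * (\<integral>\<^sup>+x. F x \<partial>lborel)" by (rule nn_integral_lborel_times) measurable
  also have "\<dots> < \<infinity>" using F_fin by (simp add: ennreal_mult_less_top)
  finally show ?thesis by (simp add: integrable_iff_bounded)
qed

lemma bump_integral_pos: "(LINT q|lborel. bump q) > 0"
proof -
  have "(LINT q|lborel. bump q) \<noteq> 0"
  proof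
    assume "(LINT q|lborel. bump q) = 0"
    then have "AE q in lborel. bump q = 0"
      using integral_nonneg_eq_0_iff_AE[OF bump_integrable] bump_pos by (simp add: less_imp_le)
    then have "AE q in (lborel :: (real \<times> real) measure). False"
      by eventually_elim (use bump_pos in \<open>simp add: less_imp_neq[symmetric]\<close>)
    then show False by (simp add: AE_iff_null null_sets_def)
  qed
  moreover have "(LINT q|lborel. bump q) \<ge> 0"
    using bump_pos by (intro integral_nonneg_AE) (simp add: less_imp_le)
  ultimately show ?thesis by simp
qed

section \<open>The Hoelder estimate\<close>

context compactly_supported_dbar
begin

text \<open>Green's formula for the product of \<open>f\<close> with the translated kernel, on a square so large that \<open>f\<close>
vanishes on its boundary. The substitution \<open>p = z + e q\<close> turns the term in which the kernel is
differentiated into an average of \<open>f\<close> around \<open>z\<close> with weight \<open>bump\<close>.\<close>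

lemma reg_kernel_identity:
  assumes e: "e > 0"
  shows "integrable lborel (\<lambda>p. D p * reg_kernel e (p - z))"
    and "(LINT p|lborel. D p * reg_kernel e (p - z)) = - 2 * (LINT q|lborel. bump q *\<^sub>R f (z + e *\<^sub>R q))"
proof -
  define g where "g p = reg_kernel e (p - z)" for p
  define gx where "gx p = reg_kernel_x e (p - z)" for p
  define gy where "gy p = reg_kernel_y e (p - z)" for p
  define r where "r p = 2 * e\<^sup>2 / ((norm (p - z))\<^sup>2 + e\<^sup>2)\<^sup>2" for p
  have g: "continuous_with_partials g gx gy {}"
    unfolding g_def[abs_def] gx_def[abs_def] gy_def[abs_def] by (rule reg_kernel_partials[OF e])
  interpret g: continuous_with_partials g gx gy "{}" by (rule g)
  have prod: "continuous_with_partials (\<lambda>p. f p * g p) (\<lambda>p. fx p * g p + f p * gx p) (\<lambda>p. fy p * g p + f p * gy p) (Z \<union> {})"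
    by (rule times[OF g])
  have dbar: "(fx p * g p + f p * gx p) + \<i> * (fy p * g p + f p * gy p) = D p * g p + f p * of_real (r p)" for p
  proof -
    have "gx p + \<i> * gy p = of_real (r p)"
      unfolding gx_def gy_def r_def by (rule reg_kernel_dbar[OF e])
    moreover have "(fx p * g p + f p * gx p) + \<i> * (fy p * g p + f p * gy p) = D p * g p + f p * (gx p + \<i> * gy p)"
      by (simp add: algebra_simps)
    ultimately show ?thesis by simp
  qed
  have Dg: "integrable lborel (\<lambda>p. D p * g p)"
  proof (rule Bochner_Integration.integrable_bound)
    show "integrable lborel (\<lambda>p. D p * of_real (1 / e))" using D_int by (rule integrable_mult_left)
    show "AE p in lborel. norm (D p * g p) \<le> norm (D p * of_real (1 / e))"
    proof (rule AE_I2)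
      fix p
      have "norm (of_real (1 / e) :: complex) = 1 / e" using e by (simp only: norm_of_real) simp
      then show "norm (D p * g p) \<le> norm (D p * of_real (1 / e))"
        unfolding norm_mult using mult_left_mono[OF norm_reg_kernel_le[OF e, of "p - z"], of "norm (D p)"]
        by (simp only: g_def norm_ge_zero)
    qed
  qed measurable
  then show "integrable lborel (\<lambda>p. D p * reg_kernel e (p - z))" by (simp add: g_def)
  obtain M where M: "\<And>p. norm (f p) \<le> M" "M \<ge> 0" using f_bounded by blast
  have dpos: "(norm (p - z))\<^sup>2 + e\<^sup>2 > 0" for p using e by (intro add_nonneg_pos) auto
  have rc: "continuous_on UNIV r"
    unfolding r_def[abs_def] using e by (intro continuous_intros) auto
  have fr: "integrable lborel (\<lambda>p. f p * of_real (r p))"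
  proof (rule integrable_bounded_support)
    show "(\<lambda>p. f p * of_real (r p)) \<in> borel_measurable borel"
      by (intro borel_measurable_continuous_onI continuous_intros f_cont rc)
    show "bounded (rect (-B) B (-B) B)" unfolding rect_eq_cbox by (rule bounded_cbox)
    show "f p * of_real (r p) = 0" if "p \<notin> rect (-B) B (-B) B" for p using supp[OF that] by simp
    show "norm (f p * of_real (r p)) \<le> M * (2 * e\<^sup>2 / (e\<^sup>2)\<^sup>2)" for p
    proof -
      have "0 \<le> r p" by (simp add: r_def)
      moreover have "r p \<le> 2 * e\<^sup>2 / (e\<^sup>2)\<^sup>2"
        unfolding r_def using e dpos[of p] by (intro divide_left_mono power_mono mult_pos_pos zero_less_power) auto
      moreover from \<open>0 \<le> r p\<close> have "norm (of_real (r p) :: complex) = r p" by simp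
      ultimately show ?thesis unfolding norm_mult using M by (simp only:) (intro mult_mono M)
    qed
  qed simp
  interpret h: integrable_dbar "\<lambda>p. f p * g p" "\<lambda>p. fx p * g p + f p * gx p" "\<lambda>p. fy p * g p + f p * gy p" "Z \<union> {}"
    by (intro integrable_dbar.intro prod integrable_dbar_axioms.intro)
       (unfold dbar, intro Bochner_Integration.integrable_add Dg fr)
  define C where "C = \<bar>B\<bar> + 1"
  have edge: "f (C, y) = 0" "f (-C, y) = 0" "f (x, C) = 0" "f (x, -C) = 0" for x y
    by (auto intro!: supp simp: C_def)
  have "(LINT p:rect (-C) C (-C) C|lborel. D p * g p + f p * of_real (r p)) = 0"
    using h.Green_rectangle[of "-C" C "-C" C] unfolding dbar edge by (simp add: C_def set_lebesgue_integral_def)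
  moreover have "(LINT p|lborel. D p * g p + f p * of_real (r p)) = (LINT p:rect (-C) C (-C) C|lborel. D p * g p + f p * of_real (r p))"
    unfolding set_lebesgue_integral_def
  proof (rule integral_cong_AE)
    show "AE p in lborel. D p * g p + f p * of_real (r p) = indicator (rect (-C) C (-C) C) p *\<^sub>R (D p * g p + f p * of_real (r p))"
      using AE_not_in[OF countable_imp_null_set_lborel[OF Z]]
    proof eventually_elim
      case (elim p)
      have "D p * g p + f p * of_real (r p) = 0" if "p \<notin> rect (-C) C (-C) C"
      proof -
        have "p \<notin> rect (-B) B (-B) B" using that by (auto simp: C_def)
        then show ?thesis using partials_zero_off_support[OF supp] supp elim by simp
      qed
      then show ?case by (simp only: indicator_def) auto
    qed
    show "(\<lambda>p. D p * g p + f p * of_real (r p)) \<in> borel_measurable lborel"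
      by (intro borel_measurable_integrable Bochner_Integration.integrable_add Dg fr)
    then show "(\<lambda>p. indicator (rect (-C) C (-C) C) p *\<^sub>R (D p * g p + f p * of_real (r p))) \<in> borel_measurable lborel"
      by measurable
  qed
  ultimately have "(LINT p|lborel. D p * g p) = - (LINT p|lborel. f p * of_real (r p))"
    using Bochner_Integration.integral_add[OF Dg fr] by (simp add: eq_neg_iff_add_eq_0)
  also have "(LINT p|lborel. f p * of_real (r p)) = \<bar>e\<bar> ^ DIM(real \<times> real) *\<^sub>R (LINT q|lborel. f (z + e *\<^sub>R q) * of_real (r (z + e *\<^sub>R q)))"
    by (rule lborel_integral_affine) (use e borel_measurable_integrable[OF fr] in auto)
  also have "\<dots> = (LINT q|lborel. 2 * (bump q *\<^sub>R f (z + e *\<^sub>R q)))"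
  proof -
    have "e\<^sup>2 *\<^sub>R (f (z + e *\<^sub>R q) * of_real (r (z + e *\<^sub>R q))) = 2 * (bump q *\<^sub>R f (z + e *\<^sub>R q))" for q
    proof -
      have "e\<^sup>2 * r (z + e *\<^sub>R q) = 2 * bump q"
      proof -
        have "(norm (e *\<^sub>R q))\<^sup>2 + e\<^sup>2 = e\<^sup>2 * ((norm q)\<^sup>2 + 1)" by (simp add: power_mult_distrib algebra_simps)
        then have "e\<^sup>2 * r (z + e *\<^sub>R q) = 2 * (e\<^sup>2 * e\<^sup>2) / ((e\<^sup>2 * e\<^sup>2) * ((norm q)\<^sup>2 + 1)\<^sup>2)"
          unfolding r_def by (simp add: power_mult_distrib power2_eq_square mult_ac)
        then show ?thesis using e by (simp add: bump_def)
      qed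
      then have "of_real (e\<^sup>2) * of_real (r (z + e *\<^sub>R q)) = (of_real (2 * bump q) :: complex)" by (metis of_real_mult)
      then show ?thesis by (simp add: scaleR_conv_of_real mult_ac)
    qed
    moreover have "\<bar>e\<bar> ^ DIM(real \<times> real) = e\<^sup>2" by (simp add: power2_eq_square)
    ultimately show ?thesis by (simp only: Bochner_Integration.integral_scaleR_right[symmetric])
  qed
  also have "\<dots> = 2 * (LINT q|lborel. bump q *\<^sub>R f (z + e *\<^sub>R q))"
    by (rule integral_mult_right_zero)
  finally show "(LINT p|lborel. D p * reg_kernel e (p - z)) = - 2 * (LINT q|lborel. bump q *\<^sub>R f (z + e *\<^sub>R q))"
    by (simp add: g_def)
qed

lemma bump_average_tendsto:
  assumes e: "e \<longlonglongrightarrow> 0"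
  shows "(\<lambda>n. LINT q|lborel. bump q *\<^sub>R f (z + e n *\<^sub>R q)) \<longlonglongrightarrow> (LINT q|lborel. bump q) *\<^sub>R f z"
proof -
  obtain M where M: "\<And>p. norm (f p) \<le> M" "M \<ge> 0" using f_bounded by blast
  have "(\<lambda>n. LINT q|lborel. bump q *\<^sub>R f (z + e n *\<^sub>R q)) \<longlonglongrightarrow> (LINT q|lborel. bump q *\<^sub>R f z)"
  proof (rule integral_dominated_convergence[where w="\<lambda>q. bump q * M"])
    show "AE q in lborel. (\<lambda>n. bump q *\<^sub>R f (z + e n *\<^sub>R q)) \<longlonglongrightarrow> bump q *\<^sub>R f z"
    proof (rule AE_I2)
      fix q
      have "(\<lambda>n. z + e n *\<^sub>R q) \<longlonglongrightarrow> z + 0 *\<^sub>R q" by (intro tendsto_intros e)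
      then have "(\<lambda>n. f (z + e n *\<^sub>R q)) \<longlonglongrightarrow> f z"
        using continuous_on_tendsto_compose[OF f_cont] by simp
      then show "(\<lambda>n. bump q *\<^sub>R f (z + e n *\<^sub>R q)) \<longlonglongrightarrow> bump q *\<^sub>R f z" by (intro tendsto_intros)
    qed
    show "AE q in lborel. norm (bump q *\<^sub>R f (z + e n *\<^sub>R q)) \<le> bump q * M" for n
      using bump_pos M by (intro AE_I2) (simp add: less_imp_le mult_left_mono)
  qed (use bump_integrable in \<open>auto intro!: integrable_mult_left borel_measurable_scaleR borel_measurable_continuous_onI f_cont_comp continuous_intros\<close>)
  also have "(LINT q|lborel. bump q *\<^sub>R f z) = (LINT q|lborel. bump q) *\<^sub>R f z"
    by (rule Bochner_Integration.integral_scaleR_left[OF bump_integrable])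
  finally show ?thesis .
qed

text \<open>As \<open>e\<close> tends to zero, the identity for the regularized kernel expresses \<open>f z - f w\<close> as a limit of
integrals of \<open>fx + \<i> fy\<close> against differences of two kernels, and these differences are dominated by
\<open>cauchy_gap z w\<close> uniformly in \<open>e\<close>. Young's inequality with a weight \<open>L\<close> splits the integrand into the
\<open>p\<close>-th power of the datum and the \<open>q\<close>-th power of the gap; \<open>L\<close> is the power of \<open>norm (z - w)\<close> that
gives both terms the exponent \<open>1 - 2 / p\<close>.\<close>

theorem Hoelder_estimate:
  assumes p: "p > 2" and Dp: "integrable lborel (\<lambda>x. norm (D x) powr p)"
  shows "\<exists>C. \<forall>z w. norm (f z - f w) \<le> C * norm (z - w) powr (1 - 2 / p)"
proof -
  define q where "q = p / (p - 1)"
  define \<alpha> where "\<alpha> = 1 - 2 / p"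
  have q: "1 < q" "q < 2" "1 / p + 1 / q = 1" using p by (auto simp: q_def field_simps)
  have q_exp: "2 - q - \<alpha> * q / p = \<alpha>" 
  proof -
    define r where "r = p - 1"
    have r: "r > 1" "p = r + 1" using p by (auto simp: r_def)
    have "2 - q = (r - 1) / r" "\<alpha> * q / p = (r - 1) / (r * (r + 1))" "\<alpha> = (r - 1) / (r + 1)"
      using r(1) unfolding q_def \<alpha>_def r(2) by (simp_all add: divide_simps)
    moreover have "(r - 1) / r - (r - 1) / (r * (r + 1)) = (r - 1) / (r + 1)"
      using r(1) by (simp add: divide_simps) (simp add: algebra_simps)
    ultimately show ?thesis by (simp only:)
  qed
  define I where "I = (LINT x|lborel. norm (D x) powr p)"
  have I: "I \<ge> 0" by (simp add: I_def integral_nonneg_AE)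
  obtain C0 where C0: "C0 \<ge> 0" "\<And>z w. z \<noteq> w \<Longrightarrow> (\<integral>\<^sup>+x. ennreal (cauchy_gap z w x powr q) \<partial>lborel) \<le> ennreal (C0 * norm (z - w) powr (2 - q))"
    using nn_integral_cauchy_gap[OF q(1,2)] by blast
  define c where "c = (LINT q|lborel. bump q)"
  have c: "c > 0" using bump_integral_pos by (simp add: c_def)
  define S where "S = I / p + C0 / q"
  have main: "norm (f z - f w) \<le> S / (2 * c) * norm (z - w) powr \<alpha>" if zw: "z \<noteq> w" for z w
  proof -
    define d where "d = norm (z - w)"
    have d: "d > 0" using zw by (simp add: d_def)
    define L where "L = d powr (\<alpha> / p)"
    have L: "L > 0" using d by (simp add: L_def)
    have gap0: "cauchy_gap z w x \<ge> 0" for x by (simp add: cauchy_gap_def)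
    have Lp: "L powr p = d powr \<alpha>" using p by (simp add: L_def powr_powr)
    have Lq: "(1 / L) powr q * d powr (2 - q) = d powr \<alpha>"
    proof -
      have "(1 / L) powr q = d powr (- (\<alpha> / p * q))"
        using d by (simp add: L_def powr_divide powr_powr powr_minus_divide)
      moreover have "- (\<alpha> / p * q) + (2 - q) = \<alpha>" using q_exp by simp
      ultimately show ?thesis by (simp only: powr_add[symmetric])
    qed
    have bound: "norm ((LINT x|lborel. D x * reg_kernel e (x - z)) - (LINT x|lborel. D x * reg_kernel e (x - w))) \<le> S * d powr \<alpha>" if e: "e > 0" for e
    proof -
      let ?k = "\<lambda>x. D x * reg_kernel e (x - z) - D x * reg_kernel e (x - w)"
      have k: "integrable lborel ?k"
        by (intro Bochner_Integration.integrable_diff reg_kernel_identity e)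
      have "ennreal (norm (LINT x|lborel. ?k x)) \<le> (\<integral>\<^sup>+x. ennreal (norm (?k x)) \<partial>lborel)"
        by (rule integral_norm_bound_ennreal[OF k])
      also have "\<dots> \<le> (\<integral>\<^sup>+x. ennreal (L powr p / p) * ennreal (norm (D x) powr p) + ennreal ((1 / L) powr q / q) * ennreal (cauchy_gap z w x powr q) \<partial>lborel)"
      proof (rule nn_integral_mono_AE)
        have "AE x in lborel. x \<noteq> z" "AE x in lborel. x \<noteq> w"
          using AE_lborel_singleton by auto
        then show "AE x in lborel. ennreal (norm (?k x)) \<le> ennreal (L powr p / p) * ennreal (norm (D x) powr p) + ennreal ((1 / L) powr q / q) * ennreal (cauchy_gap z w x powr q)"
        proof eventually_elim
          case (elim x)
          have "norm (?k x) = norm (D x) * norm (reg_kernel e (x - z) - reg_kernel e (x - w))"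
            by (simp add: norm_mult flip: right_diff_distrib)
          also have "\<dots> \<le> norm (D x) * cauchy_gap z w x"
            using norm_reg_kernel_diff[of "x - z" "x - w" e] elim
            by (intro mult_left_mono) (auto simp: cauchy_gap_def norm_minus_commute)
          also have "\<dots> = (L * norm (D x)) * (cauchy_gap z w x * (1 / L))" using L by simp
          also have "\<dots> \<le> (L * norm (D x)) powr p / p + (cauchy_gap z w x * (1 / L)) powr q / q"
            using p q L gap0 by (intro Youngs_inequality) auto
          also have "\<dots> = L powr p / p * norm (D x) powr p + (1 / L) powr q / q * cauchy_gap z w x powr q"
            using L gap0[of x] by (simp only: powr_mult) (simp add: mult_ac)
          finally have "ennreal (norm (?k x)) \<le> ennreal (L powr p / p * norm (D x) powr p + (1 / L) powr q / q * cauchy_gap z w x powr q)"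
            by (rule ennreal_leI)
          moreover have "ennreal (L powr p / p * norm (D x) powr p + (1 / L) powr q / q * cauchy_gap z w x powr q)
            = ennreal (L powr p / p) * ennreal (norm (D x) powr p) + ennreal ((1 / L) powr q / q) * ennreal (cauchy_gap z w x powr q)"
            using p q by (subst ennreal_plus) (auto simp: ennreal_mult' simp del: times_divide_eq_left times_divide_eq_right)
          ultimately show ?case by (simp only:)
        qed
      qed
      also have "\<dots> = ennreal (L powr p / p) * (\<integral>\<^sup>+x. ennreal (norm (D x) powr p) \<partial>lborel) + ennreal ((1 / L) powr q / q) * (\<integral>\<^sup>+x. ennreal (cauchy_gap z w x powr q) \<partial>lborel)"
      proof -
        have "(\<lambda>x. cauchy_gap z w x) \<in> borel_measurable borel"
          unfolding cauchy_gap_def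
          by (intro borel_measurable_divide borel_measurable_times borel_measurable_const borel_measurable_continuous_onI continuous_intros)
        then have m2: "(\<lambda>x. ennreal (cauchy_gap z w x powr q)) \<in> borel_measurable lborel" by measurable
        have m1: "(\<lambda>x. ennreal (norm (D x) powr p)) \<in> borel_measurable lborel" by measurable
        show ?thesis
          unfolding nn_integral_cmult[OF m1, symmetric] nn_integral_cmult[OF m2, symmetric]
          by (rule nn_integral_add) (intro borel_measurable_times_ennreal borel_measurable_const m1 m2)+
      qed
      also have "(\<integral>\<^sup>+x. ennreal (norm (D x) powr p) \<partial>lborel) = ennreal I"
        unfolding I_def by (rule nn_integral_eq_integral[OF Dp]) simp
      also have "ennreal (L powr p / p) * ennreal I + ennreal ((1 / L) powr q / q) * (\<integral>\<^sup>+x. ennreal (cauchy_gap z w x powr q) \<partial>lborel)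
          \<le> ennreal (L powr p / p) * ennreal I + ennreal ((1 / L) powr q / q) * ennreal (C0 * d powr (2 - q))"
        unfolding d_def by (intro add_left_mono mult_left_mono C0(2)[OF zw]) auto
      also have "\<dots> = ennreal (L powr p / p * I + (1 / L) powr q / q * (C0 * d powr (2 - q)))"
      proof -
        have "0 \<le> L powr p / p" "0 \<le> (1 / L) powr q / q" "0 \<le> C0 * d powr (2 - q)"
          using p q C0(1) by auto
        then show ?thesis
          using I by (simp only: ennreal_mult[symmetric] ennreal_plus[symmetric] mult_nonneg_nonneg)
      qed
      also have "L powr p / p * I + (1 / L) powr q / q * (C0 * d powr (2 - q)) = S * d powr \<alpha>"
      proof -
        have "(1 / L) powr q / q * (C0 * d powr (2 - q)) = C0 / q * ((1 / L) powr q * d powr (2 - q))" by simp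
        then show ?thesis unfolding Lq Lp S_def by (simp add: algebra_simps)
      qed
      finally have "norm (LINT x|lborel. ?k x) \<le> S * d powr \<alpha>"
        using I C0(1) p q by (subst (asm) ennreal_le_iff) (auto simp: S_def)
      then show ?thesis by (subst Bochner_Integration.integral_diff[symmetric]) (use reg_kernel_identity(1)[OF e] in auto)
    qed
    define e where "e n = 1 / real (Suc n)" for n
    have e: "e \<longlonglongrightarrow> 0" "e n > 0" for n
      using LIMSEQ_inverse_real_of_nat by (auto simp: e_def[abs_def] divide_inverse)
    have "(\<lambda>n. norm (- 2 * (LINT q|lborel. bump q *\<^sub>R f (z + e n *\<^sub>R q)) - - 2 * (LINT q|lborel. bump q *\<^sub>R f (w + e n *\<^sub>R q))))
      \<longlonglongrightarrow> norm (- 2 * (c *\<^sub>R f z) - - 2 * (c *\<^sub>R f w))"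
      unfolding c_def by (intro tendsto_intros bump_average_tendsto e)
    then have "norm (- 2 * (c *\<^sub>R f z) - - 2 * (c *\<^sub>R f w)) \<le> S * d powr \<alpha>"
    proof (rule LIMSEQ_le_const2, intro exI[of _ 0] allI impI)
      fix n
      show "norm (- 2 * (LINT q|lborel. bump q *\<^sub>R f (z + e n *\<^sub>R q)) - - 2 * (LINT q|lborel. bump q *\<^sub>R f (w + e n *\<^sub>R q))) \<le> S * d powr \<alpha>"
        using bound[OF e(2)[of n]] unfolding reg_kernel_identity(2)[OF e(2)] .
    qed
    moreover have "- 2 * (c *\<^sub>R f z) - - 2 * (c *\<^sub>R f w) = (- 2 * c) *\<^sub>R (f z - f w)"
      by (simp add: scaleR_conv_of_real algebra_simps)
    ultimately have "2 * c * norm (f z - f w) \<le> S * d powr \<alpha>" using c by simp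
    then show ?thesis using c by (simp add: d_def field_simps)
  qed
  show ?thesis
  proof (intro exI[of _ "S / (2 * c)"] allI)
    fix z w show "norm (f z - f w) \<le> S / (2 * c) * norm (z - w) powr (1 - 2 / p)"
      using main[of z w] by (cases "z = w") (auto simp: \<alpha>_def)
  qed
qed

end

section \<open>A cutoff function, and the passage to the complex plane\<close>

lemma DERIV_max_0_square: "((\<lambda>t. (max 0 t)\<^sup>2) has_real_derivative 2 * max 0 t) (at (t::real))"
proof (cases t "0::real" rule: linorder_cases)
  case less
  then have "\<forall>\<^sub>F s in nhds t. (max 0 s)\<^sup>2 = 0"
    using eventually_nhds_in_open[of "{..<0}" t] by (auto elim!: eventually_mono)
  from DERIV_cong_ev[OF refl this refl] show ?thesis using less by simp
next
  case equal
  have "(\<lambda>h. max 0 h) \<midarrow>0\<rightarrow> max 0 (0::real)" by (intro tendsto_intros)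
  then have "(\<lambda>h::real. max 0 h) \<midarrow>0\<rightarrow> 0" by simp
  then have "(\<lambda>h. ((max 0 (0 + h))\<^sup>2 - (max 0 (0::real))\<^sup>2) / h) \<midarrow>0\<rightarrow> 0"
    by (rule Lim_transform_eventually) (auto simp: eventually_at_filter max_def power2_eq_square)
  then show ?thesis unfolding equal DERIV_def by simp
next
  case greater
  then have "\<forall>\<^sub>F s in nhds t. (max 0 s)\<^sup>2 = s\<^sup>2"
    using eventually_nhds_in_open[of "{0<..}" t] by (auto elim!: eventually_mono)
  from DERIV_cong_ev[OF refl this refl] show ?thesis
    using greater by (auto intro!: derivative_eq_intros)
qed

text \<open>A continuously differentiable function that vanishes on \<open>[a, b]\<close> and is at least one outside
\<open>[a - d, b + d]\<close>.\<close>

definition excess :: "real \<Rightarrow> real \<Rightarrow> real \<Rightarrow> real \<Rightarrow> real" where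
  "excess d a b x = (max 0 ((a - x) / d))\<^sup>2 + (max 0 ((x - b) / d))\<^sup>2"

definition excess' :: "real \<Rightarrow> real \<Rightarrow> real \<Rightarrow> real \<Rightarrow> real" where
  "excess' d a b x = 2 * max 0 ((a - x) / d) * (- 1 / d) + 2 * max 0 ((x - b) / d) * (1 / d)"

lemma excess_nonneg: "excess d a b x \<ge> 0"
  by (simp add: excess_def)

lemma excess_deriv:
  assumes "d > 0"
  shows "(excess d a b has_real_derivative excess' d a b x) (at x)"
proof -
  have 1: "((\<lambda>x. (a - x) / d) has_real_derivative (- 1 / d)) (at x)"
    and 2: "((\<lambda>x. (x - b) / d) has_real_derivative (1 / d)) (at x)"
    using assms by (auto intro!: derivative_eq_intros)
  show ?thesis
    unfolding excess_def[abs_def] excess'_def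
    by (rule DERIV_add[OF DERIV_chain2[OF DERIV_max_0_square 1] DERIV_chain2[OF DERIV_max_0_square 2]])
qed

definition cutoff :: "real \<Rightarrow> real \<Rightarrow> real \<Rightarrow> real \<Rightarrow> real \<Rightarrow> real \<times> real \<Rightarrow> complex" where
  "cutoff d a1 b1 a2 b2 p = of_real ((max 0 (1 - excess d a1 b1 (fst p) - excess d a2 b2 (snd p)))\<^sup>2)"

definition cutoff_x :: "real \<Rightarrow> real \<Rightarrow> real \<Rightarrow> real \<Rightarrow> real \<Rightarrow> real \<times> real \<Rightarrow> complex" where
  "cutoff_x d a1 b1 a2 b2 p = of_real (2 * max 0 (1 - excess d a1 b1 (fst p) - excess d a2 b2 (snd p)) * (- excess' d a1 b1 (fst p)))"

definition cutoff_y :: "real \<Rightarrow> real \<Rightarrow> real \<Rightarrow> real \<Rightarrow> real \<Rightarrow> real \<times> real \<Rightarrow> complex" where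
  "cutoff_y d a1 b1 a2 b2 p = of_real (2 * max 0 (1 - excess d a1 b1 (fst p) - excess d a2 b2 (snd p)) * (- excess' d a2 b2 (snd p)))"

lemma cutoff_continuous:
  assumes "d > 0"
  shows "continuous_on S (cutoff d a1 b1 a2 b2)" "continuous_on S (cutoff_x d a1 b1 a2 b2)" "continuous_on S (cutoff_y d a1 b1 a2 b2)"
  unfolding cutoff_def[abs_def] cutoff_x_def[abs_def] cutoff_y_def[abs_def] excess_def excess'_def
  using assms by (intro continuous_intros; simp)+

lemma cutoff_partials:
  assumes d: "d > 0"
  shows "((\<lambda>t. cutoff d a1 b1 a2 b2 (t, y)) has_vector_derivative cutoff_x d a1 b1 a2 b2 (x, y)) (at x)"
    and "((\<lambda>t. cutoff d a1 b1 a2 b2 (x, t)) has_vector_derivative cutoff_y d a1 b1 a2 b2 (x, y)) (at y)"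
proof -
  have 1: "((\<lambda>t. 1 - excess d a1 b1 t - excess d a2 b2 y) has_real_derivative - excess' d a1 b1 x) (at x)"
    and 2: "((\<lambda>t. 1 - excess d a1 b1 x - excess d a2 b2 t) has_real_derivative - excess' d a2 b2 y) (at y)"
    by (auto intro!: derivative_eq_intros excess_deriv d)
  show "((\<lambda>t. cutoff d a1 b1 a2 b2 (t, y)) has_vector_derivative cutoff_x d a1 b1 a2 b2 (x, y)) (at x)"
    using has_vector_derivative_of_real[OF DERIV_chain2[OF DERIV_max_0_square 1]] by (simp add: cutoff_def cutoff_x_def)
  show "((\<lambda>t. cutoff d a1 b1 a2 b2 (x, t)) has_vector_derivative cutoff_y d a1 b1 a2 b2 (x, y)) (at y)"
    using has_vector_derivative_of_real[OF DERIV_chain2[OF DERIV_max_0_square 2]] by (simp add: cutoff_def cutoff_y_def)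
qed

lemma cutoff_eq_1: "d > 0 \<Longrightarrow> p \<in> rect a1 b1 a2 b2 \<Longrightarrow> cutoff d a1 b1 a2 b2 p = 1"
proof -
  assume d: "d > 0" and p: "p \<in> rect a1 b1 a2 b2"
  have "excess d a b x = 0" if "a \<le> x" "x \<le> b" for a b x
  proof -
    have "max 0 ((a - x) / d) = 0" "max 0 ((x - b) / d) = 0"
      using d that by (simp_all add: max_absorb1 divide_nonpos_pos)
    then show ?thesis by (simp add: excess_def)
  qed
  then show "cutoff d a1 b1 a2 b2 p = 1" using p by (auto simp: cutoff_def mem_Times_iff)
qed

lemma cutoff_eq_0:
  assumes d: "d > 0" and p: "p \<notin> rect (a1 - d) (b1 + d) (a2 - d) (b2 + d)"
  shows "cutoff d a1 b1 a2 b2 p = 0"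
proof -
  have ge1: "excess d a b x \<ge> 1" if "x < a - d \<or> b + d < x" for a b x
  proof -
    have "(a - x) / d \<ge> 1 \<or> (x - b) / d \<ge> 1" using that d by (auto simp: le_divide_eq)
    then have "(max 0 ((a - x) / d))\<^sup>2 \<ge> 1 \<or> (max 0 ((x - b) / d))\<^sup>2 \<ge> 1"
      by (auto intro!: one_le_power simp: le_max_iff_disj)
    moreover have "(max 0 ((a - x) / d))\<^sup>2 \<ge> 0" "(max 0 ((x - b) / d))\<^sup>2 \<ge> 0" by simp_all
    ultimately show ?thesis unfolding excess_def by linarith
  qed
  have "fst p < a1 - d \<or> b1 + d < fst p \<or> snd p < a2 - d \<or> b2 + d < snd p"
    using p by (auto simp: mem_Times_iff)
  then have "excess d a1 b1 (fst p) + excess d a2 b2 (snd p) \<ge> 1"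
    using ge1[of "fst p" a1 b1] ge1[of "snd p" a2 b2] excess_nonneg[of d a1 b1 "fst p"] excess_nonneg[of d a2 b2 "snd p"] by linarith
  then show ?thesis by (simp add: cutoff_def max_def)
qed

text \<open>Limits of difference quotients along a sequence provide Borel versions of the partial derivatives.\<close>

lemma continuous_with_partials_exists:
  fixes f :: "real \<times> real \<Rightarrow> complex"
  assumes f: "continuous_on UNIV f" and Z: "countable Z"
    and dx: "\<And>x y. (x, y) \<notin> Z \<Longrightarrow> (\<lambda>t. f (t, y)) differentiable (at x)"
    and dy: "\<And>x y. (x, y) \<notin> Z \<Longrightarrow> (\<lambda>t. f (x, t)) differentiable (at y)"
  obtains fx fy where "continuous_with_partials f fx fy Z"
proof -
  define e where "e n = inverse (real (Suc n))" for n
  have e: "filterlim e (at 0) sequentially"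
    using LIMSEQ_inverse_real_of_nat by (intro filterlim_atI) (auto simp: e_def[abs_def])
  define fx where "fx p = lim (\<lambda>n. (f (p + (e n, 0)) - f p) /\<^sub>R e n)" for p
  define fy where "fy p = lim (\<lambda>n. (f (p + (0, e n)) - f p) /\<^sub>R e n)" for p
  have lim_eq: "lim (\<lambda>n. (g (t + e n) - g t) /\<^sub>R e n) = d" if "(g has_vector_derivative d) (at t)" for g :: "real \<Rightarrow> complex" and t d
    by (rule limI) (rule filterlim_compose[OF has_vector_derivative_quotient[OF that] e])
  have fm: "(\<lambda>p. f (p + c)) \<in> borel_measurable borel" for c
    by (intro borel_measurable_continuous_onI continuous_on_compose2[OF f] continuous_intros) auto
  show ?thesis
  proof (rule that[of fx fy], unfold_locales)
    show "((\<lambda>t. f (t, y)) has_vector_derivative fx (x, y)) (at x)" if "(x, y) \<notin> Z" for x y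
      using dx[OF that] lim_eq[of "\<lambda>t. f (t, y)" _ x] unfolding vector_derivative_works by (simp add: fx_def)
    show "((\<lambda>t. f (x, t)) has_vector_derivative fy (x, y)) (at y)" if "(x, y) \<notin> Z" for x y
      using dy[OF that] lim_eq[of "\<lambda>t. f (x, t)" _ y] unfolding vector_derivative_works by (simp add: fy_def)
    show "fx \<in> borel_measurable borel" "fy \<in> borel_measurable borel"
      unfolding fx_def[abs_def] fy_def[abs_def] using fm fm[of 0]
      by (intro borel_measurable_lim_metric borel_measurable_scaleR borel_measurable_diff borel_measurable_const; simp)+
  qed (use f Z in auto)
qed

definition to_complex :: "real \<times> real \<Rightarrow> complex" where "to_complex p = Complex (fst p) (snd p)"
definition of_complex :: "complex \<Rightarrow> real \<times> real" where "of_complex z = (Re z, Im z)"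

lemma to_of_complex[simp]: "to_complex (of_complex z) = z" "of_complex (to_complex p) = p"
  by (simp_all add: to_complex_def of_complex_def)

lemma to_complex_Pair[simp]: "to_complex (x, y) = Complex x y" by (simp add: to_complex_def)

lemma continuous_to_complex: "continuous_on S to_complex"
  unfolding to_complex_def Complex_eq by (intro continuous_intros)

lemma continuous_of_complex: "continuous_on S of_complex"
  unfolding of_complex_def by (intro continuous_intros)

lemma measurable_to_complex[measurable]: "to_complex \<in> borel_measurable borel"
  by (intro borel_measurable_continuous_onI continuous_to_complex)

lemma measurable_of_complex[measurable]: "of_complex \<in> borel_measurable borel"
  by (intro borel_measurable_continuous_onI continuous_of_complex)

lemma norm_of_complex_diff: "norm (of_complex z - of_complex w) = norm (z - w)"
  by (simp add: of_complex_def norm_Pair cmod_def)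

lemma lborel_complex: "lborel = distr lborel borel to_complex"
proof (rule lborel_eqI)
  fix l u :: complex assume le: "\<And>b. b \<in> Basis \<Longrightarrow> l \<bullet> b \<le> u \<bullet> b"
  have B: "(Basis :: (real \<times> real) set) = {(1, 0), (0, 1)}" by (auto simp: Basis_prod_def)
  have "emeasure (distr lborel borel to_complex) (box l u) = emeasure lborel (to_complex -` box l u)"
    by (subst emeasure_distr) auto
  also have "to_complex -` box l u = box (of_complex l) (of_complex u)"
    by (auto simp: in_box_complex_iff to_complex_def of_complex_def mem_box B)
  also have "emeasure lborel \<dots> = (\<Prod>b\<in>Basis. (of_complex u - of_complex l) \<bullet> b)"
    using le[of 1] le[of \<i>] by (intro emeasure_lborel_box) (auto simp: B of_complex_def Basis_complex_def)
  also have "(\<Prod>b\<in>Basis. (of_complex u - of_complex l) \<bullet> b) = (\<Prod>b\<in>Basis. (u - l) \<bullet> b)"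
    unfolding B by (simp add: of_complex_def Basis_complex_def inner_prod_def inner_complex_def)
  finally show "emeasure (distr lborel borel to_complex) (box l u) = (\<Prod>b\<in>Basis. (u - l) \<bullet> b)" .
qed simp

lemma lborel_complex_integral:
  fixes g :: "complex \<Rightarrow> 'b::{banach, second_countable_topology}"
  assumes [measurable]: "g \<in> borel_measurable borel"
  shows "(LINT z|lborel. g z) = (LINT p|lborel. g (to_complex p))"
    and "integrable lborel g \<longleftrightarrow> integrable lborel (\<lambda>p. g (to_complex p))"
proof -
  show "(LINT z|lborel. g z) = (LINT p|lborel. g (to_complex p))"
    by (subst lborel_complex, subst integral_distr) auto
  show "integrable lborel g \<longleftrightarrow> integrable lborel (\<lambda>p. g (to_complex p))"
    by (subst lborel_complex, subst integrable_distr_eq) auto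
qed

lemma lebesgue_on_integral:
  fixes h :: "complex \<Rightarrow> 'b::{banach, second_countable_topology}"
  assumes R: "R \<in> sets borel" and h: "(\<lambda>z. indicator R z *\<^sub>R h z) \<in> borel_measurable borel"
  shows "(LINT z|lebesgue_on R. h z) = (LINT p|lborel. indicator R (to_complex p) *\<^sub>R h (to_complex p))"
    and "integrable (lebesgue_on R) h \<longleftrightarrow> integrable lborel (\<lambda>p. indicator R (to_complex p) *\<^sub>R h (to_complex p))"
proof -
  have "(LINT z|lebesgue_on R. h z) = (LINT z|lebesgue. indicator R z *\<^sub>R h z)"
    using R by (intro integral_restrict_space) auto
  also have "\<dots> = (LINT z|lborel. indicator R z *\<^sub>R h z)"
    by (rule integral_completion) (use h in simp)
  finally show "(LINT z|lebesgue_on R. h z) = (LINT p|lborel. indicator R (to_complex p) *\<^sub>R h (to_complex p))"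
    using lborel_complex_integral(1)[OF h] by simp
  have "integrable (lebesgue_on R) h \<longleftrightarrow> integrable lebesgue (\<lambda>z. indicator R z *\<^sub>R h z)"
    using R by (intro integrable_restrict_space) auto
  also have "\<dots> \<longleftrightarrow> integrable lborel (\<lambda>z. indicator R z *\<^sub>R h z)"
    by (rule integrable_completion) (use h in simp)
  finally show "integrable (lebesgue_on R) h \<longleftrightarrow> integrable lborel (\<lambda>p. indicator R (to_complex p) *\<^sub>R h (to_complex p))"
    using lborel_complex_integral(2)[OF h] by simp
qed

section \<open>Membership in the Sobolev space\<close>

lemma integrable_norm_square:
  assumes fin: "(\<integral>\<^sup>+p. ennreal ((norm (g p))\<^sup>2) \<partial>lborel) < \<infinity>" and g: "g \<in> borel_measurable borel"
  shows "integrable lborel (\<lambda>p. (norm (g p))\<^sup>2)"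
  using assms by (simp add: integrable_iff_bounded)

lemma has_partials_at_slices:
  assumes "has_partials_at u z"
  shows "((\<lambda>x. u (Complex x (Im z))) has_vector_derivative partial_x u z) (at (Re z))"
    and "((\<lambda>y. u (Complex (Re z) y)) has_vector_derivative partial_y u z) (at (Im z))"
  using assms unfolding has_partials_at_def partial_x_def partial_y_def by (simp_all add: vector_derivative_works)

lemma test_function_partials:
  assumes \<phi>: "test_function R \<phi>"
  shows "continuous_with_partials (\<lambda>p. \<phi> (to_complex p)) (\<lambda>p. partial_x \<phi> (to_complex p)) (\<lambda>p. partial_y \<phi> (to_complex p)) {}"
    and "continuous_on UNIV \<phi>" "continuous_on UNIV (partial_x \<phi>)" "continuous_on UNIV (partial_y \<phi>)"
proof -
  have C: "C_k 0 \<phi>" "C_k (Suc 0) \<phi>" using \<phi> unfolding test_function_def by blast+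
  show c: "continuous_on UNIV \<phi>" "continuous_on UNIV (partial_x \<phi>)" "continuous_on UNIV (partial_y \<phi>)"
    using C by simp_all
  have p: "has_partials_at \<phi> z" for z using C by simp
  have comp: "continuous_on UNIV (\<lambda>p. h (to_complex p))" if "continuous_on UNIV h" for h :: "complex \<Rightarrow> complex"
    by (rule continuous_on_compose2[OF that continuous_to_complex]) simp
  show "continuous_with_partials (\<lambda>p. \<phi> (to_complex p)) (\<lambda>p. partial_x \<phi> (to_complex p)) (\<lambda>p. partial_y \<phi> (to_complex p)) {}"
  proof
    show "((\<lambda>t. \<phi> (to_complex (t, y))) has_vector_derivative partial_x \<phi> (to_complex (x, y))) (at x)" for x y
      using has_partials_at_slices(1)[OF p[of "Complex x y"]] by simp
    show "((\<lambda>t. \<phi> (to_complex (x, t))) has_vector_derivative partial_y \<phi> (to_complex (x, y))) (at y)" for x y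
      using has_partials_at_slices(2)[OF p[of "Complex x y"]] by simp
  qed (use comp c in \<open>auto intro!: borel_measurable_continuous_onI\<close>)
qed

lemma test_function_bounded:
  assumes \<phi>: "test_function R \<phi>"
  obtains M where "\<And>z. norm (\<phi> z) \<le> M" "M \<ge> 0"
proof -
  have K: "compact (closure {z. \<phi> z \<noteq> 0})" using \<phi> unfolding test_function_def by blast
  have "compact (\<phi> ` closure {z. \<phi> z \<noteq> 0})"
    by (rule compact_continuous_image[OF continuous_on_subset[OF test_function_partials(2)[OF \<phi>] subset_UNIV] K])
  then obtain M where M: "\<forall>w\<in>\<phi> ` closure {z. \<phi> z \<noteq> 0}. norm w \<le> M"
    using compact_imp_bounded bounded_iff by blast
  have "norm (\<phi> z) \<le> max M 0" for z
    using M closure_subset[of "{z. \<phi> z \<noteq> 0}"] by (cases "\<phi> z = 0") (auto simp: le_max_iff_disj)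
  then show ?thesis using that[of "max M 0"] by simp
qed

lemma test_function_zero_outside:
  assumes \<phi>: "test_function R \<phi>" and z: "z \<notin> R"
  shows "\<phi> z = 0" "partial_x \<phi> z = 0" "partial_y \<phi> z = 0"
proof -
  define U where "U = - closure {z. \<phi> z \<noteq> 0}"
  have U: "open U" "z \<in> U" using \<phi> z unfolding test_function_def U_def by auto
  have zero: "\<phi> w = 0" if "w \<in> U" for w
    using that closure_subset[of "{z. \<phi> z \<noteq> 0}"] unfolding U_def by auto
  then show "\<phi> z = 0" using U(2) by blast
  have c: "continuous_on UNIV (\<lambda>t. Complex t y)" "continuous_on UNIV (\<lambda>t. Complex y t)" for y
    unfolding Complex_eq by (intro continuous_intros)+
  have "((\<lambda>t. \<phi> (Complex t (Im z))) has_vector_derivative 0) (at (Re z))"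
  proof (rule has_vector_derivative_transform_within_open)
    show "open ((\<lambda>t. Complex t (Im z)) -` U)" by (rule open_vimage[OF U(1) c(1)])
  qed (use zero U in auto)
  then show "partial_x \<phi> z = 0" unfolding partial_x_def by (rule vector_derivative_at)
  have "((\<lambda>t. \<phi> (Complex (Re z) t)) has_vector_derivative 0) (at (Im z))"
  proof (rule has_vector_derivative_transform_within_open)
    show "open ((\<lambda>t. Complex (Re z) t) -` U)" by (rule open_vimage[OF U(1) c(2)])
  qed (use zero U in auto)
  then show "partial_y \<phi> z = 0" unfolding partial_y_def by (rule vector_derivative_at)
qed

context compactly_supported_dbar
begin

lemma partials_supported_AE: "AE p in lborel. p \<notin> rect (-B) B (-B) B \<longrightarrow> fx p = 0 \<and> fy p = 0"
  using AE_not_in[OF countable_imp_null_set_lborel[OF Z]]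
proof eventually_elim
  case (elim p)
  then show ?case using partials_zero_off_support[OF supp] by blast
qed

lemma integrable_times_bounded:
  assumes g: "g \<in> borel_measurable borel" and g2: "integrable lborel (\<lambda>p. (norm (g p))\<^sup>2)"
    and supp_g: "AE p in lborel. p \<notin> rect (-B) B (-B) B \<longrightarrow> g p = 0"
    and h: "h \<in> borel_measurable borel" "\<And>p. norm (h p) \<le> M" "M \<ge> 0"
  shows "integrable lborel (\<lambda>p. g p * h p :: complex)"
proof (rule Bochner_Integration.integrable_bound)
  show "integrable lborel (\<lambda>p. (indicator (rect (-B) B (-B) B) p + (norm (g p))\<^sup>2) * M)"
    using emeasure_rect_finite[of "-B" B "-B" B] g2
    by (intro integrable_mult_left Bochner_Integration.integrable_add integrable_real_indicator) auto
  show "AE p in lborel. norm (g p * h p) \<le> norm ((indicator (rect (-B) B (-B) B) p + (norm (g p))\<^sup>2) * M)"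
    using supp_g
  proof eventually_elim
    case (elim p)
    have "norm (g p) \<le> indicator (rect (-B) B (-B) B) p + (norm (g p))\<^sup>2"
    proof (cases "p \<in> rect (-B) B (-B) B")
      case True
      have "2 * norm (g p) \<le> 1 + (norm (g p))\<^sup>2" using sum_squares_bound[of 1 "norm (g p)"] by simp
      then have "norm (g p) \<le> 1 + (norm (g p))\<^sup>2" using norm_ge_zero[of "g p"] by linarith
      then show ?thesis using True by simp
    qed (use elim in simp)
    then have "norm (g p) * norm (h p) \<le> (indicator (rect (-B) B (-B) B) p + (norm (g p))\<^sup>2) * M"
      using h by (intro mult_mono) auto
    also have "\<dots> \<le> norm ((indicator (rect (-B) B (-B) B) p + (norm (g p))\<^sup>2) * M)" by simp
    finally show ?case by (simp only: norm_mult)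
  qed
qed (use g h in simp)

lemma integrable_f_times:
  assumes "continuous_on UNIV h"
  shows "integrable lborel (\<lambda>p. f p * h p)"
proof -
  have fh: "continuous_on UNIV (\<lambda>p. f p * h p)" by (intro continuous_intros f_cont assms)
  have "compact ((\<lambda>p. f p * h p) ` rect (-B) B (-B) B)"
    unfolding rect_eq_cbox by (intro compact_continuous_image continuous_on_subset[OF fh] compact_cbox) auto
  then obtain M where M: "\<forall>w\<in>(\<lambda>p. f p * h p) ` rect (-B) B (-B) B. norm w \<le> M"
    using compact_imp_bounded bounded_iff by blast
  show ?thesis
  proof (rule integrable_bounded_support)
    show "(\<lambda>p. f p * h p) \<in> borel_measurable borel" by (rule borel_measurable_continuous_onI[OF fh])
    show "bounded (rect (-B) B (-B) B)" unfolding rect_eq_cbox by (rule bounded_cbox)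
    show "f p * h p = 0" if "p \<notin> rect (-B) B (-B) B" for p using supp[OF that] by simp
    show "norm (f p * h p) \<le> max M 0" for p
      using M supp[of p] by (cases "p \<in> rect (-B) B (-B) B") (auto simp: le_max_iff_disj)
  qed simp
qed

text \<open>The product \<open>f h\<close> has compact support, and its partial derivatives are integrable because those of
\<open>f\<close> are square integrable; hence their integrals vanish.\<close>

lemma integration_by_parts:
  assumes D2: "(\<integral>\<^sup>+p. ennreal ((norm (D p))\<^sup>2) \<partial>lborel) < \<infinity>"
    and h: "continuous_with_partials h hx hy {}" and hM: "\<And>p. norm (h p) \<le> M" "M \<ge> 0"
    and c: "continuous_on UNIV hx" "continuous_on UNIV hy"
  shows "(LINT p|lborel. f p * hx p) = - (LINT p|lborel. fx p * h p)"
    and "(LINT p|lborel. f p * hy p) = - (LINT p|lborel. fy p * h p)"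
proof -
  interpret h: continuous_with_partials h hx hy "{}" by (rule h)
  interpret fh: continuous_with_partials "\<lambda>p. f p * h p" "\<lambda>p. fx p * h p + f p * hx p" "\<lambda>p. fy p * h p + f p * hy p" "Z \<union> {}"
    by (rule times[OF h])
  have fx2: "integrable lborel (\<lambda>p. (norm (fx p))\<^sup>2)" and fy2: "integrable lborel (\<lambda>p. (norm (fy p))\<^sup>2)"
    using D2 partials_square_integrable by (auto intro!: integrable_norm_square elim: le_less_trans)
  have fxh: "integrable lborel (\<lambda>p. fx p * h p)"
    by (rule integrable_times_bounded[OF fx_m fx2 _ h.f_m hM]) (use partials_supported_AE in eventually_elim, simp)
  have fyh: "integrable lborel (\<lambda>p. fy p * h p)"
    by (rule integrable_times_bounded[OF fy_m fy2 _ h.f_m hM]) (use partials_supported_AE in eventually_elim, simp)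
  have fhx: "integrable lborel (\<lambda>p. f p * hx p)" and fhy: "integrable lborel (\<lambda>p. f p * hy p)"
    by (intro integrable_f_times c)+
  have "(LINT p|lborel. fx p * h p + f p * hx p) = 0"
    by (rule fh.integral_fx_eq_0[of B]) (use supp fxh fhx in auto)
  then show "(LINT p|lborel. f p * hx p) = - (LINT p|lborel. fx p * h p)"
    using Bochner_Integration.integral_add[OF fxh fhx] by (simp add: eq_neg_iff_add_eq_0 add.commute)
  have "(LINT p|lborel. fy p * h p + f p * hy p) = 0"
    by (rule fh.integral_fy_eq_0[of B]) (use supp fyh fhy in auto)
  then show "(LINT p|lborel. f p * hy p) = - (LINT p|lborel. fy p * h p)"
    using Bochner_Integration.integral_add[OF fyh fhy] by (simp add: eq_neg_iff_add_eq_0 add.commute)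
qed

lemma W12_restriction:
  assumes R: "open R" "bounded R" and u: "\<And>z. z \<in> R \<Longrightarrow> u z = f (of_complex z)"
    and D2: "(\<integral>\<^sup>+p. ennreal ((norm (D p))\<^sup>2) \<partial>lborel) < \<infinity>"
  shows "W12 R u"
proof -
  have Rb[measurable]: "R \<in> sets borel" using R(1) by simp
  have Lp: "Lp_on 2 R v"
    if v: "\<And>z. z \<in> R \<Longrightarrow> v z = g (of_complex z)" and g[measurable]: "g \<in> borel_measurable borel"
      and g2: "integrable lborel (\<lambda>p. (norm (g p))\<^sup>2)" for v g
  proof -
    have "(\<lambda>z. indicator R z *\<^sub>R v z) = (\<lambda>z. indicator R z *\<^sub>R g (of_complex z))"
      by (rule ext) (simp add: v split: split_indicator)
    then have m: "(\<lambda>z. indicator R z *\<^sub>R v z) \<in> borel_measurable borel" by simp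
    have 1: "v \<in> borel_measurable (lebesgue_on R)"
    proof (subst borel_measurable_restrict_space_iff)
      show "(\<lambda>x. indicator R x *\<^sub>R v x) \<in> borel_measurable lebesgue"
        using m by (simp add: measurable_completion)
    qed simp
    have eq: "(\<lambda>z. indicator R z *\<^sub>R (norm (v z) powr 2)) = (\<lambda>z. indicator R z *\<^sub>R (norm (g (of_complex z)))\<^sup>2)"
      by (rule ext) (simp add: v split: split_indicator)
    then have m2: "(\<lambda>z. indicator R z *\<^sub>R (norm (v z) powr 2)) \<in> borel_measurable borel" by simp
    have "integrable lborel (\<lambda>p. indicator R (to_complex p) *\<^sub>R (norm (v (to_complex p)) powr 2))"
    proof (rule Bochner_Integration.integrable_bound[OF g2])
      show "(\<lambda>p. indicator R (to_complex p) *\<^sub>R (norm (v (to_complex p)) powr 2)) \<in> borel_measurable lborel"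
        using measurable_compose[OF measurable_to_complex m2] by simp
      show "AE p in lborel. norm (indicator R (to_complex p) *\<^sub>R (norm (v (to_complex p)) powr 2)) \<le> norm ((norm (g p))\<^sup>2)"
        by (intro AE_I2) (simp add: v split: split_indicator)
    qed
    then have 2: "integrable (lebesgue_on R) (\<lambda>z. norm (v z) powr 2)"
      using lebesgue_on_integral(2)[OF Rb m2] by simp
    show ?thesis unfolding Lp_on_def using 1 2 by blast
  qed
  have f2: "integrable lborel (\<lambda>p. (norm (f p))\<^sup>2)"
  proof -
    have "integrable lborel (\<lambda>p. f p * cnj (f p))"
      by (intro integrable_f_times continuous_intros f_cont)
    from integrable_norm[OF this] show ?thesis by (simp add: norm_mult power2_eq_square)
  qed
  have fx2: "integrable lborel (\<lambda>p. (norm (fx p))\<^sup>2)" and fy2: "integrable lborel (\<lambda>p. (norm (fy p))\<^sup>2)"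
    using D2 partials_square_integrable by (auto intro!: integrable_norm_square elim: le_less_trans)
  have weak: "(LINT z|lebesgue_on R. u z * \<psi> z) = (LINT p|lborel. f p * \<psi> (to_complex p))"
    "(LINT z|lebesgue_on R. g (of_complex z) * \<phi> z) = (LINT p|lborel. g p * \<phi> (to_complex p))"
    if \<psi>: "continuous_on UNIV \<psi>" "continuous_on UNIV \<phi>" "\<And>z. z \<notin> R \<Longrightarrow> \<psi> z = 0" "\<And>z. z \<notin> R \<Longrightarrow> \<phi> z = 0" and g[measurable]: "g \<in> borel_measurable borel"
    for \<psi> \<phi> :: "complex \<Rightarrow> complex" and g
  proof -
    have [measurable]: "\<psi> \<in> borel_measurable borel" "\<phi> \<in> borel_measurable borel"
      using \<psi> by (auto intro: borel_measurable_continuous_onI)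
    have "(\<lambda>z. indicator R z *\<^sub>R (u z * \<psi> z)) = (\<lambda>z. f (of_complex z) * \<psi> z)"
      using u \<psi>(3) by (intro ext) (simp split: split_indicator)
    then have e1: "\<And>z. indicator R z *\<^sub>R (u z * \<psi> z) = f (of_complex z) * \<psi> z" and "(\<lambda>z. indicator R z *\<^sub>R (u z * \<psi> z)) \<in> borel_measurable borel"
      by (auto dest: fun_cong)
    then show "(LINT z|lebesgue_on R. u z * \<psi> z) = (LINT p|lborel. f p * \<psi> (to_complex p))"
      using lebesgue_on_integral(1)[OF Rb, of "\<lambda>z. u z * \<psi> z"] by simp
    have "(\<lambda>z. indicator R z *\<^sub>R (g (of_complex z) * \<phi> z)) = (\<lambda>z. g (of_complex z) * \<phi> z)"
      using \<psi>(4) by (intro ext) (simp split: split_indicator)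
    then have e2: "\<And>z. indicator R z *\<^sub>R (g (of_complex z) * \<phi> z) = g (of_complex z) * \<phi> z" and m2: "(\<lambda>z. indicator R z *\<^sub>R (g (of_complex z) * \<phi> z)) \<in> borel_measurable borel"
      by (auto dest: fun_cong)
    show "(LINT z|lebesgue_on R. g (of_complex z) * \<phi> z) = (LINT p|lborel. g p * \<phi> (to_complex p))"
      using lebesgue_on_integral(1)[OF Rb m2, unfolded e2] by simp
  qed
  have parts: "(LINT z|lebesgue_on R. u z * partial_x \<phi> z) = - (LINT z|lebesgue_on R. fx (of_complex z) * \<phi> z)"
    "(LINT z|lebesgue_on R. u z * partial_y \<phi> z) = - (LINT z|lebesgue_on R. fy (of_complex z) * \<phi> z)"
    if \<phi>: "test_function R \<phi>" for \<phi>
  proof -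
    obtain M where M: "\<And>z. norm (\<phi> z) \<le> M" "M \<ge> 0" using test_function_bounded[OF \<phi>] by blast
    note t = test_function_partials[OF \<phi>] and z = test_function_zero_outside[OF \<phi>]
    have comp: "continuous_on UNIV (\<lambda>p. h (to_complex p))" if "continuous_on UNIV h" for h :: "complex \<Rightarrow> complex"
      by (rule continuous_on_compose2[OF that continuous_to_complex]) simp
    note ibp = integration_by_parts[OF D2 t(1) M(1) M(2) comp[OF t(3)] comp[OF t(4)]]
    show "(LINT z|lebesgue_on R. u z * partial_x \<phi> z) = - (LINT z|lebesgue_on R. fx (of_complex z) * \<phi> z)"
      using ibp(1) weak(1)[OF t(3) t(2) z(2) z(1) fx_m] weak(2)[OF t(3) t(2) z(2) z(1) fx_m] by simp
    show "(LINT z|lebesgue_on R. u z * partial_y \<phi> z) = - (LINT z|lebesgue_on R. fy (of_complex z) * \<phi> z)"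
      using ibp(2) weak(1)[OF t(4) t(2) z(3) z(1) fy_m] weak(2)[OF t(4) t(2) z(3) z(1) fy_m] by simp
  qed
  have "Lp_on 2 R u" by (rule Lp[OF u f_m f2])
  moreover have "Lp_on 2 R (\<lambda>z. fx (of_complex z))" by (rule Lp[OF refl fx_m fx2])
  moreover have "Lp_on 2 R (\<lambda>z. fy (of_complex z))" by (rule Lp[OF refl fy_m fy2])
  moreover have "weak_partial_x R u (\<lambda>z. fx (of_complex z))" "weak_partial_y R u (\<lambda>z. fy (of_complex z))"
    unfolding weak_partial_x_def weak_partial_y_def using parts by blast+
  ultimately show ?thesis unfolding W12_def by blast
qed

end

section \<open>Interior regularity\<close>

lemma enlarge_rectangle:
  assumes \<Omega>: "open \<Omega>" and K: "cbox (Complex a1 a2) (Complex b1 b2) \<subseteq> \<Omega>" and ab: "a1 \<le> b1" "a2 \<le> b2"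
  obtains d where "d > 0" "cbox (Complex (a1 - d) (a2 - d)) (Complex (b1 + d) (b2 + d)) \<subseteq> \<Omega>"
proof -
  obtain e where e: "e > 0" "(\<Union>x\<in>cbox (Complex a1 a2) (Complex b1 b2). ball x e) \<subseteq> \<Omega>"
    using compact_subset_open_imp_ball_epsilon_subset[OF compact_cbox \<Omega> K] by blast
  define d where "d = e / 3"
  have "z \<in> \<Omega>" if z: "z \<in> cbox (Complex (a1 - d) (a2 - d)) (Complex (b1 + d) (b2 + d))" for z
  proof -
    define w where "w = Complex (max a1 (min b1 (Re z))) (max a2 (min b2 (Im z)))"
    have w: "w \<in> cbox (Complex a1 a2) (Complex b1 b2)"
      using ab by (auto simp: w_def in_cbox_complex_iff)
    have "\<bar>Re (w - z)\<bar> \<le> d" "\<bar>Im (w - z)\<bar> \<le> d"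
      using z ab e(1) by (auto simp: w_def in_cbox_complex_iff d_def max_def min_def abs_le_iff)
    then have "norm (w - z) \<le> d + d" using cmod_le[of "w - z"] by linarith
    then have "z \<in> ball w e" using e(1) by (simp add: dist_norm d_def)
    then show ?thesis using e(2) w by blast
  qed
  then show ?thesis using that[of d] e(1) by (auto simp: d_def)
qed

lemma powr_add_norm_le:
  fixes x y :: complex
  assumes "p \<ge> 0"
  shows "norm (x + y) powr p \<le> 2 powr p * (norm x powr p + norm y powr p)"
proof -
  have "norm (x + y) powr p \<le> (norm x + norm y) powr p"
    using assms norm_triangle_ineq by (intro powr_mono2) auto
  also have "\<dots> \<le> 2 powr p * (norm x powr p + norm y powr p)"
    using assms by (intro powr_add_le) auto
  finally show ?thesis .
qed

text \<open>The estimates are applied to \<open>f\<close>, the product of \<open>u\<close> with a cutoff function \<open>\<eta>\<close> that equals one on \<open>R\<close>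
and is supported in a slightly larger compact rectangle \<open>K0\<close> in \<open>\<Omega>1\<close>. By the product rule \<open>fx + \<i> fy\<close>
is almost everywhere \<open>2 \<eta> P\<close> plus a bounded function supported in \<open>K0\<close>, hence in \<open>L\<^sup>p\<close>.\<close>

theorem theorem2p6:
  fixes \<Omega>1 \<Omega>2 :: "complex set" and u P :: "complex \<Rightarrow> complex" and p :: real
  assumes "open \<Omega>1" and "open \<Omega>2"
    and "u ` \<Omega>1 \<subseteq> \<Omega>2"
    and "continuous_on \<Omega>1 u"
    and "condition_star \<Omega>1 u"
    and "2 \<le> p"
    and "Lp_loc p \<Omega>1 P"
    and "AE z in lebesgue_on \<Omega>1. dbar u z = P z"
  shows "\<forall>R. R \<Subset> \<Omega>1 \<longrightarrow> W12 R u \<and> (2 < p \<longrightarrow> Holder_on (1 - 2 / p) R u)"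
proof (intro allI impI)
  fix R assume "R \<Subset> \<Omega>1"
  then obtain a1 b1 a2 b2 where ab: "a1 < b1" "a2 < b2" and R: "R = box (Complex a1 a2) (Complex b1 b2)"
    and clR: "closure R \<subseteq> \<Omega>1"
    unfolding compact_rectangle_in_def by blast
  have "box (Complex a1 a2) (Complex b1 b2) \<noteq> {}"
  proof -
    have "Complex ((a1 + b1) / 2) ((a2 + b2) / 2) \<in> box (Complex a1 a2) (Complex b1 b2)"
      using ab by (simp add: in_box_complex_iff)
    then show ?thesis by blast
  qed
  then have clR': "cbox (Complex a1 a2) (Complex b1 b2) \<subseteq> \<Omega>1"
    using clR unfolding R by (simp add: closure_box)
  obtain d where d: "d > 0" and K: "cbox (Complex (a1 - d) (a2 - d)) (Complex (b1 + d) (b2 + d)) \<subseteq> \<Omega>1"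
    using enlarge_rectangle[OF assms(1) clR'] ab by (metis less_imp_le)
  define K0 where "K0 = cbox (Complex (a1 - d) (a2 - d)) (Complex (b1 + d) (b2 + d))"
  have K0: "compact K0" "K0 \<subseteq> \<Omega>1" using K by (auto simp: K0_def)
  have K0b[measurable]: "K0 \<in> sets borel" by (simp add: K0_def)
  have K0_iff: "to_complex q \<in> K0 \<longleftrightarrow> q \<in> rect (a1 - d) (b1 + d) (a2 - d) (b2 + d)" for q
    by (auto simp: K0_def in_cbox_complex_iff to_complex_def mem_Times_iff)
  define \<eta> where "\<eta> = cutoff d a1 b1 a2 b2"
  define \<eta>x where "\<eta>x = cutoff_x d a1 b1 a2 b2"
  define \<eta>y where "\<eta>y = cutoff_y d a1 b1 a2 b2"
  have \<eta>c: "continuous_on S \<eta>" "continuous_on S \<eta>x" "continuous_on S \<eta>y" for S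
    using cutoff_continuous[OF d] by (simp_all add: \<eta>_def \<eta>x_def \<eta>y_def)
  have \<eta>0: "\<eta> q = 0" if "to_complex q \<notin> K0" for q
    using cutoff_eq_0[OF d] that unfolding K0_iff \<eta>_def by blast
  define f where "f q = (if to_complex q \<in> \<Omega>1 then \<eta> q * u (to_complex q) else 0)" for q
  \<comment> \<open>On \<open>U\<close> the function is the product, on \<open>V\<close> it is zero, and the two open sets cover the plane.\<close>
  define U where "U = to_complex -` \<Omega>1"
  define V where "V = to_complex -` (- K0)"
  have oU: "open U" unfolding U_def by (rule open_vimage[OF assms(1) continuous_to_complex])
  have oV: "open V" unfolding V_def
    by (rule open_vimage[OF open_Compl[OF compact_imp_closed[OF K0(1)]] continuous_to_complex])
  have UV: "U \<union> V = UNIV" using K0(2) by (auto simp: U_def V_def)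
  have fU: "f q = \<eta> q * u (to_complex q)" if "q \<in> U" for q using that by (simp add: f_def U_def)
  have fV: "f q = 0" if "q \<in> V" for q using that \<eta>0 by (simp add: f_def V_def)
  have u_cont: "continuous_on U (\<lambda>q. u (to_complex q))"
    by (rule continuous_on_compose2[OF assms(4) continuous_to_complex]) (auto simp: U_def)
  have f_cont: "continuous_on UNIV f"
  proof -
    have "continuous_on U f"
      by (rule continuous_on_eq[OF continuous_on_mult[OF \<eta>c(1) u_cont]]) (simp add: fU)
    moreover have "continuous_on V f"
      by (rule continuous_on_eq[OF continuous_on_const[of V 0]]) (simp add: fV)
    ultimately show ?thesis using continuous_on_open_Un[OF oU oV] UV by simp
  qed
  define Z where "Z = of_complex ` {z \<in> \<Omega>1. \<not> has_partials_at u z}"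
  have Z: "countable Z" using assms(5) by (simp add: Z_def condition_star_def)
  have good: "has_partials_at u (Complex x y)" if "(x, y) \<notin> Z" "(x, y) \<in> U" for x y
    using that by (force simp: Z_def U_def of_complex_def image_iff)
  have slice_open: "open ((\<lambda>t. (t, y)) -` S)" "open ((\<lambda>t. (y, t)) -` S)" if "open S" for y and S :: "(real \<times> real) set"
    by (rule open_vimage[OF that]; intro continuous_intros)+
  have dU: "((\<lambda>t. f (t, y)) has_vector_derivative \<eta>x (x, y) * u (Complex x y) + \<eta> (x, y) * partial_x u (Complex x y)) (at x)"
    "((\<lambda>t. f (x, t)) has_vector_derivative \<eta>y (x, y) * u (Complex x y) + \<eta> (x, y) * partial_y u (Complex x y)) (at y)"
    if "(x, y) \<notin> Z" "(x, y) \<in> U" for x y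
  proof -
    note h = has_partials_at_slices[OF good[OF that], simplified]
    show "((\<lambda>t. f (t, y)) has_vector_derivative \<eta>x (x, y) * u (Complex x y) + \<eta> (x, y) * partial_x u (Complex x y)) (at x)"
    proof (rule has_vector_derivative_transform_within_open)
      show "((\<lambda>t. \<eta> (t, y) * u (Complex t y)) has_vector_derivative \<eta>x (x, y) * u (Complex x y) + \<eta> (x, y) * partial_x u (Complex x y)) (at x)"
        using has_vector_derivative_mult[OF cutoff_partials(1)[OF d] h(1)] by (simp add: \<eta>_def \<eta>x_def add.commute)
      show "open ((\<lambda>t. (t, y)) -` U)" by (rule slice_open(1)[OF oU])
    qed (use that fU in auto)
    show "((\<lambda>t. f (x, t)) has_vector_derivative \<eta>y (x, y) * u (Complex x y) + \<eta> (x, y) * partial_y u (Complex x y)) (at y)"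
    proof (rule has_vector_derivative_transform_within_open)
      show "((\<lambda>t. \<eta> (x, t) * u (Complex x t)) has_vector_derivative \<eta>y (x, y) * u (Complex x y) + \<eta> (x, y) * partial_y u (Complex x y)) (at y)"
        using has_vector_derivative_mult[OF cutoff_partials(2)[OF d] h(2)] by (simp add: \<eta>_def \<eta>y_def add.commute)
      show "open ((\<lambda>t. (x, t)) -` U)" by (rule slice_open(2)[OF oU])
    qed (use that fU in auto)
  qed
  have dV: "((\<lambda>t. f (t, y)) has_vector_derivative 0) (at x)" "((\<lambda>t. f (x, t)) has_vector_derivative 0) (at y)"
    if "(x, y) \<in> V" for x y
  proof -
    show "((\<lambda>t. f (t, y)) has_vector_derivative 0) (at x)"
      by (rule has_vector_derivative_transform_within_open[OF _ slice_open(1)[OF oV], of "\<lambda>t. 0"]) (use that fV in auto)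
    show "((\<lambda>t. f (x, t)) has_vector_derivative 0) (at y)"
      by (rule has_vector_derivative_transform_within_open[OF _ slice_open(2)[OF oV], of "\<lambda>t. 0"]) (use that fV in auto)
  qed
  have "(\<lambda>t. f (t, y)) differentiable (at x)" "(\<lambda>t. f (x, t)) differentiable (at y)" if "(x, y) \<notin> Z" for x y
  proof -
    have "(x, y) \<in> U \<or> (x, y) \<in> V" using UV by blast
    then show "(\<lambda>t. f (t, y)) differentiable (at x)" "(\<lambda>t. f (x, t)) differentiable (at y)"
      using dU[OF that] dV[of x y] by (auto intro: differentiableI_vector)
  qed
  then obtain fx fy where cwp: "continuous_with_partials f fx fy Z"
    using continuous_with_partials_exists[OF f_cont Z] by blast
  interpret cwp: continuous_with_partials f fx fy Z by (rule cwp)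
  define B where "B = Max {\<bar>a1 - d\<bar>, \<bar>b1 + d\<bar>, \<bar>a2 - d\<bar>, \<bar>b2 + d\<bar>}"
  have inB: "q \<in> rect (-B) B (-B) B" if "to_complex q \<in> K0" for q
  proof -
    have "\<bar>a1 - d\<bar> \<le> B" "\<bar>b1 + d\<bar> \<le> B" "\<bar>a2 - d\<bar> \<le> B" "\<bar>b2 + d\<bar> \<le> B" unfolding B_def by (intro Max_ge; simp)+
    then show ?thesis using that unfolding K0_iff by (auto simp: mem_Times_iff)
  qed
  have supp: "f q = 0" if "q \<notin> rect (-B) B (-B) B" for q
  proof (rule fV)
    show "q \<in> V" using inB[of q] that unfolding V_def by blast
  qed
  define D where "D q = fx q + \<i> * fy q" for q
  have Dm[measurable]: "D \<in> borel_measurable borel" unfolding D_def[abs_def] by measurable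
  have D_U: "D q = (\<eta>x q + \<i> * \<eta>y q) * u (to_complex q) + \<eta> q * (2 * dbar u (to_complex q))" if "q \<notin> Z" "q \<in> U" for q
  proof -
    obtain x y where q: "q = (x, y)" by (cases q)
    have "fx q = \<eta>x q * u (to_complex q) + \<eta> q * partial_x u (to_complex q)"
      using vector_derivative_unique_at[OF cwp.fx dU(1)] that by (simp add: q)
    moreover have "fy q = \<eta>y q * u (to_complex q) + \<eta> q * partial_y u (to_complex q)"
      using vector_derivative_unique_at[OF cwp.fy dU(2)] that by (simp add: q)
    ultimately show ?thesis by (simp add: D_def dbar_def algebra_simps)
  qed
  have D_V: "D q = 0" if "q \<notin> Z" "q \<in> V" for q
  proof -
    obtain x y where q: "q = (x, y)" by (cases q)
    have "fx q = 0" using vector_derivative_unique_at[OF cwp.fx dV(1)] that by (simp add: q)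
    moreover have "fy q = 0" using vector_derivative_unique_at[OF cwp.fy dV(2)] that by (simp add: q)
    ultimately show ?thesis by (simp add: D_def)
  qed
  obtain C where C: "C \<ge> 0" "\<And>q. to_complex q \<in> K0 \<Longrightarrow> norm ((\<eta>x q + \<i> * \<eta>y q) * u (to_complex q)) \<le> C"
    "\<And>q. norm (\<eta> q) \<le> 1"
  proof -
    define G where "G q = (\<eta>x q + \<i> * \<eta>y q) * u (to_complex q)" for q
    define Q where "Q = rect (a1 - d) (b1 + d) (a2 - d) (b2 + d)"
    have "Q \<subseteq> U" using K0(2) K0_iff unfolding Q_def U_def by blast
    then have "continuous_on Q G"
      unfolding G_def[abs_def] by (intro continuous_intros \<eta>c continuous_on_subset[OF u_cont])
    then have "compact (G ` Q)" by (rule compact_continuous_image) (simp only: Q_def rect_eq_cbox compact_cbox)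
    then obtain C where "\<forall>w\<in>G ` Q. norm w \<le> C" using compact_imp_bounded bounded_iff by blast
    then have "norm (G q) \<le> max C 0" if "to_complex q \<in> K0" for q
      using that by (auto simp: K0_iff Q_def le_max_iff_disj)
    moreover have "norm (\<eta> q) \<le> 1" for q
    proof -
      have "max 0 (1 - excess d a1 b1 (fst q) - excess d a2 b2 (snd q)) \<le> 1"
        using excess_nonneg[of d a1 b1 "fst q"] excess_nonneg[of d a2 b2 "snd q"] by simp
      then have "(max 0 (1 - excess d a1 b1 (fst q) - excess d a2 b2 (snd q)))\<^sup>2 \<le> 1" by (intro power_le_one) auto
      then show ?thesis unfolding \<eta>_def cutoff_def by (simp only: norm_of_real) simp
    qed
    ultimately show ?thesis using that[of "max C 0"] by (simp add: G_def)
  qed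
  have P: "P \<in> borel_measurable (lebesgue_on K0)" "integrable (lebesgue_on K0) (\<lambda>z. norm (P z) powr p)"
    using assms(7) K0 unfolding Lp_loc_def Lp_on_def by blast+
  have AE_P: "AE z in lebesgue. z \<in> \<Omega>1 \<longrightarrow> dbar u z = P z"
    using assms(8) by (subst (asm) AE_restrict_space_iff) (use assms(1) in auto)
  have AE_Z: "AE z in lebesgue. of_complex z \<notin> Z"
  proof -
    have "countable (to_complex ` Z)" using Z by simp
    then have "AE z in lborel. z \<notin> to_complex ` Z" by (intro AE_not_in countable_imp_null_set_lborel)
    then have "AE z in lebesgue. z \<notin> to_complex ` Z" by (rule AE_completion)
    then show ?thesis by eventually_elim (metis image_eqI to_of_complex(1))
  qed
  define Dp where "Dp z = norm (D (of_complex z)) powr p" for z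
  have Dp_m[measurable]: "Dp \<in> borel_measurable borel" unfolding Dp_def[abs_def] by measurable
  \<comment> \<open>The hypothesis on \<open>P\<close> concerns Lebesgue measurable functions, so the bound is first obtained for the completed measure.\<close>
  have "integrable lebesgue Dp"
  proof (rule Bochner_Integration.integrable_bound)
    show "integrable lebesgue (\<lambda>z. indicator K0 z *\<^sub>R (2 powr p * (C powr p + 2 powr p * norm (P z) powr p)))"
    proof -
      have "integrable (lebesgue_on K0) (\<lambda>z. 2 powr p * (C powr p + 2 powr p * norm (P z) powr p))"
      proof (intro integrable_mult_right Bochner_Integration.integrable_add P(2))
        have "emeasure (lebesgue_on K0) (space (lebesgue_on K0)) < \<infinity>"
          using emeasure_compact_finite[OF K0(1)] by (simp add: emeasure_restrict_space space_restrict_space less_top)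
        then show "integrable (lebesgue_on K0) (\<lambda>z. C powr p)"
          by (intro finite_measure.integrable_const finite_measureI) simp
      qed
      then show ?thesis by (subst (asm) integrable_restrict_space) auto
    qed
    show "Dp \<in> borel_measurable lebesgue" using Dp_m by (simp add: measurable_completion)
    show "AE z in lebesgue. norm (Dp z) \<le> norm (indicator K0 z *\<^sub>R (2 powr p * (C powr p + 2 powr p * norm (P z) powr p)))"
      using AE_P AE_Z
    proof eventually_elim
      case (elim z)
      show ?case
      proof (cases "z \<in> K0")
        case True
        then have zU: "of_complex z \<in> U" "dbar u z = P z" using K0(2) elim by (auto simp: U_def)
        let ?q = "of_complex z"
        have "D ?q = (\<eta>x ?q + \<i> * \<eta>y ?q) * u z + \<eta> ?q * (2 * P z)"
          using D_U[OF elim(2) zU(1)] zU(2) by simp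
        then have "Dp z \<le> 2 powr p * (norm ((\<eta>x ?q + \<i> * \<eta>y ?q) * u z) powr p + norm (\<eta> ?q * (2 * P z)) powr p)"
          unfolding Dp_def using powr_add_norm_le assms(6) by simp
        also have "\<dots> \<le> 2 powr p * (C powr p + (2 * norm (P z)) powr p)"
        proof (intro mult_left_mono add_mono powr_mono2)
          show "norm ((\<eta>x ?q + \<i> * \<eta>y ?q) * u z) \<le> C" using C(2)[of ?q] True by simp
          show "norm (\<eta> ?q * (2 * P z)) \<le> 2 * norm (P z)"
            using mult_right_mono[OF C(3)[of ?q], of "2 * norm (P z)"] by (simp add: norm_mult)
        qed (use assms(6) in auto)
        also have "\<dots> = 2 powr p * (C powr p + 2 powr p * norm (P z) powr p)" by (simp add: powr_mult)
        finally show ?thesis using True by (simp add: Dp_def)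
      next
        case False
        then have "D (of_complex z) = 0" using D_V[OF elim(2)] by (simp add: V_def)
        then show ?thesis using False by (simp add: Dp_def)
      qed
    qed
  qed
  then have "integrable lborel Dp" by (subst (asm) integrable_completion) simp_all
  then have Dp_int: "integrable lborel (\<lambda>q. norm (D q) powr p)"
    using lborel_complex_integral(2)[OF Dp_m] by (simp add: Dp_def)
  have D_supp: "AE q in lborel. q \<notin> rect (-B) B (-B) B \<longrightarrow> D q = 0"
    using AE_not_in[OF countable_imp_null_set_lborel[OF Z]]
  proof eventually_elim
    case (elim q)
    then show ?case using D_V[of q] inB[of q] unfolding V_def by blast
  qed
  \<comment> \<open>On a bounded set lower powers are dominated by \<open>1 + norm (D q) powr p\<close>; this is used for the exponents one and two.\<close>
  have D_low: "integrable lborel (\<lambda>q. norm (D q) ^ n)" if n: "real n \<le> p" "n > 0" for n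
  proof (rule Bochner_Integration.integrable_bound)
    show "integrable lborel (\<lambda>q. indicator (rect (-B) B (-B) B) q + norm (D q) powr p)"
      using emeasure_rect_finite[of "-B" B "-B" B]
      by (intro Bochner_Integration.integrable_add Dp_int integrable_real_indicator) auto
    show "AE q in lborel. norm (norm (D q) ^ n) \<le> norm (indicator (rect (-B) B (-B) B) q + norm (D q) powr p)"
      using D_supp
    proof eventually_elim
      case (elim q)
      show ?case
      proof (cases "q \<in> rect (-B) B (-B) B")
        case True
        have "norm (D q) ^ n \<le> 1 + norm (D q) powr p"
        proof (cases "norm (D q) \<le> 1")
          case True
          then have "norm (D q) ^ n \<le> 1" by (intro power_le_one) auto
          then show ?thesis by (meson add_increasing2 powr_ge_zero)
        next
          case False
          then have "0 < norm (D q)" by linarith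
          then have "norm (D q) ^ n = norm (D q) powr real n" by (rule powr_realpow[symmetric])
          also have "\<dots> \<le> norm (D q) powr p" using False n by (intro powr_mono) auto
          finally show ?thesis by simp
        qed
        then show ?thesis using True by simp
      qed (use elim n in \<open>simp add: zero_power\<close>)
    qed
  qed simp
  have D_int: "integrable lborel D"
    using D_low[of 1] assms(6) integrable_norm_iff[of D lborel] by simp
  interpret csd: compactly_supported_dbar f fx fy Z B
    by (intro compactly_supported_dbar.intro integrable_dbar.intro cwp integrable_dbar_axioms.intro
        compactly_supported_dbar_axioms.intro) (use D_int supp in \<open>auto simp: D_def[abs_def]\<close>)
  have uR: "u z = f (of_complex z)" if "z \<in> R" for z
  proof -
    have "z \<in> \<Omega>1" using that closure_subset[of R] clR by blast
    moreover have "\<eta> (of_complex z) = 1"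
      unfolding \<eta>_def using that by (intro cutoff_eq_1[OF d]) (auto simp: R in_box_complex_iff of_complex_def)
    ultimately show ?thesis by (simp add: f_def)
  qed
  have D2: "(\<integral>\<^sup>+q. ennreal ((norm (fx q + \<i> * fy q))\<^sup>2) \<partial>lborel) < \<infinity>"
  proof -
    have "(\<integral>\<^sup>+q. ennreal ((norm (D q))\<^sup>2) \<partial>lborel) = ennreal (LINT q|lborel. (norm (D q))\<^sup>2)"
      by (rule nn_integral_eq_integral) (use D_low[of 2] assms(6) in auto)
    then show ?thesis by (simp add: D_def)
  qed
  have "W12 R u"
    by (rule csd.W12_restriction[OF _ _ uR D2]) (simp_all add: R open_box)
  moreover have "Holder_on (1 - 2 / p) R u" if p2: "2 < p"
  proof -
    obtain C where "\<And>z w. norm (f z - f w) \<le> C * norm (z - w) powr (1 - 2 / p)"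
      using csd.Hoelder_estimate[OF p2] Dp_int unfolding D_def by blast
    then have "norm (u z - u w) \<le> C * norm (z - w) powr (1 - 2 / p)" if "z \<in> R" "w \<in> R" for z w
      using uR that norm_of_complex_diff by metis
    then show ?thesis unfolding Holder_on_def by blast
  qed
  ultimately show "W12 R u \<and> (2 < p \<longrightarrow> Holder_on (1 - 2 / p) R u)" by blast
qed

end
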